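(* There exists a constant $C_3>0$ such that for every $\beta\ge1$ there is a constant $C>0$ for which the following holds. Let $N\ge512$, let $\Phi_1,\Phi_2$ be two orthonormal bases of $\mathbb{C}^N$ with mutual incoherence $\mu$ satisfying $\mu\le1/\sqrt{2(\beta+1)\log N}$, and let $\Phi=(\Phi_1\;\;\Phi_2)$. Let $p_1,p_2\in[0,1]$ be sampling parameters with $\min(\mathbf{E}|\Gamma_1|,\mathbf{E}|\Gamma_2|)\ge4(\beta+1)\log N$ and $$\mathbf{E}|\Gamma_1|+\mathbf{E}|\Gamma_2|\le\frac{C_3}{\mu^2\cdot((\beta+1)\log N)^{5/2}}.$$ Let $f=\Phi\alpha$ be a random signal, where the random support $\Gamma=\Gamma_1\cup\Gamma_2$ and the random coefficient vector $\alpha$ supported on $\Gamma$ are sampled according to the probability model. Then with probability at least $1-C\log N\cdot N^{-\beta}$, the solutions of $$(P_0)\quad\min_{\alpha'\in\mathbb{C}^{2N}}\|\alpha'\|_{\ell_0}\ \text{ subject to }\ \Phi\alpha'=f\qquad\text{and}\qquad(P_1)\quad\min_{\alpha'\in\mathbb{C}^{2N}}\|\alpha'\|_{\ell_1}\ \text{ subject to }\ \Phi\alpha'=f$$ are identical and equal to $\alpha$ (i.e. $\alpha$ is the unique minimizer of each program).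
   Context: $\Phi=(\Phi_1\;\;\Phi_2)$ is the $N\times2N$ matrix whose first $N$ columns are the vectors of the orthonormal basis $\Phi_1$ and last $N$ columns those of $\Phi_2$. The mutual incoherence is $\mu=\mu(\Phi_1,\Phi_2)=\max_{\phi\in\Phi_1,\psi\in\Phi_2}|\langle\phi,\psi\rangle|$. $\|\alpha\|_{\ell_0}$ is the number of nonzero entries of $\alpha$ and $\|\alpha\|_{\ell_1}=\sum_\gamma|\alpha(\gamma)|$. Probability model: $I_1(j)$ and $I_2(j)$, $j=0,\dots,N-1$, are two independent sequences of i.i.d. Bernoulli random variables with parameters $p_1$ and $p_2$ respectively; $\Gamma_1=\{j:I_1(j)=1\}$, $\Gamma_2=\{j:I_2(j)=1\}$, so $\mathbf{E}|\Gamma_i|=p_iN$. $\Gamma=\Gamma_1\cup\Gamma_2$ is viewed as a subset of the $2N$ column indices of $\Phi$ (disjoint union: $\Gamma_1$ among the columns of $\Phi_1$, $\Gamma_2$ among those of $\Phi_2$). Given $(\Gamma_1,\Gamma_2)$, the coefficients $\{\alpha(\gamma),\gamma\in\Gamma\}$ are i.i.d. draws from a continuous probability distribution on $\mathbb{C}$ (one having a density) that is circularly symmetric (phase uniform on $[0,2\pi)$), and $\alpha(\gamma)=0$ for $\gamma\notin\Gamma$. $\log$ is the natural logarithm. *)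

theory Defs
  imports "HOL-Probability.Probability" "Jordan_Normal_Form.Matrix"
begin

unbundle no vec_syntax
no_notation inner (infix \<open>\<bullet>\<close> 70)

hide_const (open) Finite_Cartesian_Product.vec Finite_Cartesian_Product.mat

text \<open>
  The dimension \<open>N\<close> is quantified inside the main statement, so vectors and matrices are those
  with explicit carriers. An orthonormal basis of \<open>\<complex>\<^sup>N\<close> is the matrix whose columns are the basis
  vectors; \<open>N\<close> orthonormal vectors in dimension \<open>N\<close> are automatically a basis.
\<close>

definition orthonormal_basis :: "nat \<Rightarrow> complex mat \<Rightarrow> bool" where
  "orthonormal_basis N A \<longleftrightarrow> A \<in> carrier_mat N N \<and>
     (\<forall>i<N. \<forall>j<N. col A i \<bullet>c col A j = (if i = j then 1 else 0))"

definition mutual_incoherence :: "complex mat \<Rightarrow> complex mat \<Rightarrow> real" where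
  "mutual_incoherence A B =
     Max {cmod (\<phi> \<bullet>c \<psi>) | \<phi> \<psi>. \<phi> \<in> set (cols A) \<and> \<psi> \<in> set (cols B)}"

definition dictionary :: "complex mat \<Rightarrow> complex mat \<Rightarrow> complex mat" where
  "dictionary A B = mat_of_cols (dim_row A) (cols A @ cols B)"

definition l0_norm :: "complex vec \<Rightarrow> nat" where
  "l0_norm v = card {i. i < dim_vec v \<and> v $ i \<noteq> 0}"

definition l1_norm :: "complex vec \<Rightarrow> real" where
  "l1_norm v = (\<Sum>i<dim_vec v. cmod (v $ i))"

definition solutions :: "(complex vec \<Rightarrow> 'b::ord) \<Rightarrow> complex mat \<Rightarrow> complex vec \<Rightarrow> complex vec set" where
  "solutions J A f = {v. is_arg_min J (\<lambda>w. w \<in> carrier_vec (dim_col A) \<and> A *\<^sub>v w = f) v}"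

definition bernoulli_subset :: "nat \<Rightarrow> real \<Rightarrow> nat set pmf" where
  "bernoulli_subset N p =
     map_pmf (\<lambda>I. {j. j < N \<and> I j}) (Pi_pmf {..<N} False (\<lambda>_. bernoulli_pmf p))"

definition expected_card :: "nat set pmf \<Rightarrow> real" where
  "expected_card P = measure_pmf.expectation P (\<lambda>G. real (card G))"

text \<open>Column \<open>j\<close> of the second basis is column \<open>N + j\<close> of the dictionary.\<close>

definition joint_support :: "nat \<Rightarrow> nat set \<Rightarrow> nat set \<Rightarrow> nat set" where
  "joint_support N G1 G2 = G1 \<union> (\<lambda>j. N + j) ` G2"

definition coeff_space :: "nat \<Rightarrow> (nat \<Rightarrow> complex) measure" where
  "coeff_space N = (\<Pi>\<^sub>M i\<in>{..<2 * N}. borel)"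

text \<open>
  Conditional law of the coefficients given the support \<open>G\<close>: the entries on \<open>G\<close> are i.i.d.
  with law \<open>D\<close>, the others vanish.
\<close>

definition coeff_law_on :: "nat \<Rightarrow> complex measure \<Rightarrow> nat set \<Rightarrow> (nat \<Rightarrow> complex) measure" where
  "coeff_law_on N D G =
     distr (\<Pi>\<^sub>M \<gamma>\<in>G. D) (coeff_space N) (\<lambda>z. \<lambda>\<gamma>\<in>{..<2 * N}. if \<gamma> \<in> G then z \<gamma> else 0)"

definition coeff_law :: "nat \<Rightarrow> real \<Rightarrow> real \<Rightarrow> complex measure \<Rightarrow> (nat \<Rightarrow> complex) measure" where
  "coeff_law N p1 p2 D =
     Giry_Monad.bind (measure_pmf (pair_pmf (bernoulli_subset N p1) (bernoulli_subset N p2)))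
       (\<lambda>(G1, G2). coeff_law_on N D (joint_support N G1 G2))"

definition continuous_distribution :: "complex measure \<Rightarrow> bool" where
  "continuous_distribution D \<longleftrightarrow> prob_space D \<and>
     (\<exists>g \<in> borel_measurable lborel. D = density lborel g)"

definition circularly_symmetric :: "complex measure \<Rightarrow> bool" where
  "circularly_symmetric D \<longleftrightarrow> (\<forall>\<theta>::real. distr D borel (\<lambda>z. cis \<theta> * z) = D)"

end

theory Submission
  imports Defs "HOL-Library.Function_Algebras" "Jordan_Normal_Form.Determinant"
begin

text \<open>
  Write \<open>\<Gamma>\<close> for the joint support and \<open>\<phi>\<^sub>\<gamma>\<close> for the columns of the dictionary. Recovery follows from two
  properties of the support alone, collected in the locale \<open>separated_support\<close>: synthesis from the
  columns in \<open>\<Gamma>\<close> is bounded below, \<open>\<parallel>x\<parallel>\<^sup>2 \<le> 2 \<parallel>\<Phi>\<^sub>\<Gamma> x\<parallel>\<^sup>2\<close>, and every column outside \<open>\<Gamma>\<close> is almost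
  orthogonal to them, \<open>\<Sum>g\<in>\<Gamma>. |\<langle>\<phi>\<^sub>\<gamma>, \<phi>\<^sub>g\<rangle>|\<^sup>2 \<le> \<eta>\<close> with \<open>\<eta>\<close> of order \<open>1 / ((\<beta> + 1) log N)\<close>.

  For the \<open>l\<^sub>1\<close> program, let \<open>w\<^sub>\<gamma>\<close> be the coefficients of the orthogonal projection of \<open>\<phi>\<^sub>\<gamma>\<close> onto the span
  of \<open>\<Phi>\<^sub>\<Gamma>\<close>. A kernel vector \<open>h\<close> is determined on \<open>\<Gamma>\<close> by its values outside,
  \<open>h(g) = - \<Sum>\<gamma>\<notin>\<Gamma>. h(\<gamma>) w\<^sub>\<gamma>(g)\<close> (\<open>kernel_on_support\<close>), so moving from \<open>\<alpha>\<close> to \<open>\<alpha> + h\<close> loses at most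
  \<open>\<Sum>\<gamma>\<notin>\<Gamma>. |h(\<gamma>)| |\<Sum>g. w\<^sub>\<gamma>(g) cnj (sgn \<alpha>(g))|\<close> on \<open>\<Gamma>\<close> and gains \<open>\<Sum>\<gamma>\<notin>\<Gamma>. |h(\<gamma>)|\<close> outside. Hence \<open>\<alpha>\<close> is the
  unique minimizer once all the inner sums have modulus below 1. They are sums of independent symmetric
  terms with \<open>\<parallel>w\<^sub>\<gamma>\<parallel>\<^sup>2 \<le> 4 \<eta>\<close>, so Hoeffding's inequality bounds each failure probability by
  \<open>4 exp (- 1 / (16 \<eta>))\<close> (\<open>phase_sum_tail\<close>).

  For the \<open>l\<^sub>0\<close> program, a competitor with support \<open>\<Gamma>' \<noteq> \<Gamma>\<close> and \<open>|\<Gamma>'| \<le> |\<Gamma>|\<close> puts the signal into the span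
  of \<open>\<Phi>\<^sub>\<Gamma>\<^sub>'\<close>. A dimension count shows that this span misses some column of \<open>\<Gamma>\<close>
  (\<open>separating_functional\<close>), so \<open>\<alpha>\<close> lies on a fixed proper hyperplane, a null set because the
  coefficients have no atoms (\<open>hyperplane_null\<close>).

  It remains to see that the support is separated with high probability. The cardinalities exceed four
  times their means only with exponentially small probability, and then almost orthogonality is
  immediate since every inner product across the bases is at most \<open>\<mu>\<close>. The lower bound asks that the
  cross Gram matrix of \<open>\<Gamma>\<^sub>1\<close> and \<open>\<Gamma>\<^sub>2\<close> have operator norm at most \<open>1/2\<close>. For fixed \<open>\<Gamma>\<^sub>1\<close> the square of this
  norm is that of \<open>X = \<Sum>j\<in>\<Gamma>\<^sub>2. v\<^sub>j v\<^sub>j\<^sup>*\<close>, where the full family of the \<open>v\<^sub>j\<close> resolves the identity and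
  \<open>\<parallel>v\<^sub>j\<parallel>\<^sup>2 \<le> \<rho> = \<mu>\<^sup>2 |\<Gamma>\<^sub>1|\<close>. A matrix Chernoff bound for such sums has an elementary proof by trace moments:
  \<open>\<langle>(Y + v v\<^sup>*)\<^sup>m v, v\<rangle> \<le> \<langle>(Y + \<rho>)\<^sup>m v, v\<rangle>\<close> for positive \<open>Y\<close> (\<open>rank_one_update_moment\<close>), whence
  \<open>E Tr X\<^sup>n\<^sup>+\<^sup>1 \<le> p E Tr (X + \<rho>)\<^sup>n\<close> and, by induction, \<open>E Tr X\<^sup>n \<le> |\<Gamma>\<^sub>1| s\<^sup>n\<close> whenever \<open>s\<close> dominates both \<open>n \<rho>\<close> and \<open>e p\<close>.
  Markov's inequality with \<open>n\<close> about \<open>2 (\<beta> + 1) log N\<close>, \<open>s = 1/12\<close> and threshold \<open>1/4\<close> gives the claim. These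
  values lead to \<open>C\<^sub>3 = 1/144\<close>. The certificates contribute \<open>8 N\<^sup>-\<^sup>\<beta>\<close> to the failure probability and the random
  supports \<open>3 N\<^sup>-\<^sup>\<beta>\<close>, which explains \<open>C = 11\<close>.
\<close>

section \<open>Inner products over a finite index set\<close>

definition ip :: "'r set \<Rightarrow> ('r \<Rightarrow> complex) \<Rightarrow> ('r \<Rightarrow> complex) \<Rightarrow> complex" where
  "ip R x y = (\<Sum>r\<in>R. x r * cnj (y r))"

lemma ip_commute: "ip R y x = cnj (ip R x y)"
  by (simp add: ip_def mult.commute)

lemma ip_add_left: "ip R (\<lambda>r. x r + y r) z = ip R x z + ip R y z"
  by (simp add: ip_def sum.distrib distrib_right)

lemma ip_scale_left: "ip R (\<lambda>r. c * x r) z = c * ip R x z"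
  by (simp add: ip_def sum_distrib_left mult.assoc)

lemma ip_sum_left: "ip R (\<lambda>r. \<Sum>g\<in>A. c g * x g r) z = (\<Sum>g\<in>A. c g * ip R (x g) z)"
  by (simp add: ip_def sum_distrib_left sum_distrib_right mult.assoc sum.swap[of _ R A])

lemma ip_sum_right: "ip R z (\<lambda>r. \<Sum>g\<in>A. c g * x g r) = (\<Sum>g\<in>A. cnj (c g) * ip R z (x g))"
  by (subst ip_commute) (simp add: ip_sum_left ip_commute[of R _ z])

lemma ip_self: "ip R x x = of_real (\<Sum>r\<in>R. (cmod (x r))\<^sup>2)"
  by (simp add: ip_def flip: complex_norm_square)

lemma ip_diff_left: "ip R (\<lambda>r. x r - y r) z = ip R x z - ip R y z"
  by (simp add: ip_def sum_subtractf left_diff_distrib)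

lemma ip_zero_iff:
  assumes "finite R"
  shows "ip R x x = 0 \<longleftrightarrow> (\<forall>r\<in>R. x r = 0)"
  unfolding ip_self of_real_eq_0_iff using assms by (simp add: sum_nonneg_eq_0_iff)

lemma ip_add_right: "ip R z (\<lambda>r. x r + y r) = ip R z x + ip R z y"
  by (simp add: ip_def distrib_left sum.distrib)

lemma ip_mult_commute: "ip R x y * ip R y x = of_real ((cmod (ip R x y))\<^sup>2)"
  by (subst ip_commute[of R y x]) (rule complex_norm_square[symmetric])

lemma complex_Cauchy_Schwarz_sum:
  fixes f g :: "'r \<Rightarrow> complex"
  shows "(cmod (\<Sum>r\<in>R. f r * g r))\<^sup>2 \<le> (\<Sum>r\<in>R. (cmod (f r))\<^sup>2) * (\<Sum>r\<in>R. (cmod (g r))\<^sup>2)"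
proof -
  have "(cmod (\<Sum>r\<in>R. f r * g r))\<^sup>2 \<le> (\<Sum>r\<in>R. cmod (f r) * cmod (g r))\<^sup>2"
    by (intro power_mono sum_norm_le) (auto simp: norm_mult)
  also have "\<dots> \<le> (\<Sum>r\<in>R. (cmod (f r))\<^sup>2) * (\<Sum>r\<in>R. (cmod (g r))\<^sup>2)"
    by (rule Cauchy_Schwarz_ineq_sum)
  finally show ?thesis .
qed

section \<open>Log-convex sequences\<close>

text \<open>
  Log-convexity makes the ratios \<open>a (k + 1) / a k\<close> increasing, so moving weight from the smaller index
  to the larger one increases the product. The ratios are cross-multiplied, because terms may vanish.
\<close>

lemma log_convex_mult_le:
  fixes a :: "nat \<Rightarrow> real"
  assumes nonneg: "\<And>k. 0 \<le> a k" and conv: "\<And>k. (a (Suc k))\<^sup>2 \<le> a k * a (Suc (Suc k))"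
  shows "a k * a l \<le> a 0 * a (k + l)"
proof -
  have exch: "a (Suc k) * a l \<le> a k * a (Suc l)" if "k \<le> l" for k l
    using that
  proof (induction l rule: dec_induct)
    case base
    then show ?case by (simp add: mult.commute)
  next
    case (step l)
    show ?case
    proof (cases "a (Suc l) = 0")
      case False
      then have pos: "a (Suc l) > 0" using nonneg[of "Suc l"] by simp
      have "a (Suc l) * (a (Suc k) * a (Suc l)) = a (Suc k) * (a (Suc l))\<^sup>2"
        by (simp add: power2_eq_square)
      also have "\<dots> \<le> a (Suc k) * (a l * a (Suc (Suc l)))"
        by (intro mult_left_mono conv nonneg)
      also have "\<dots> \<le> (a k * a (Suc l)) * a (Suc (Suc l))"
        using mult_right_mono[OF step.IH nonneg[of "Suc (Suc l)"]] by (simp add: mult.assoc)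
      finally have "a (Suc l) * (a (Suc k) * a (Suc l)) \<le> a (Suc l) * (a k * a (Suc (Suc l)))"
        by (simp add: mult_ac)
      then show ?thesis using pos by simp
    qed (simp add: nonneg)
  qed
  have ord: "a k * a l \<le> a 0 * a (k + l)" if "k \<le> l" for k l
    using that
  proof (induction k arbitrary: l)
    case (Suc k)
    have "a (Suc k) * a l \<le> a k * a (Suc l)" using Suc.prems by (intro exch) simp
    also have "\<dots> \<le> a 0 * a (k + Suc l)" using Suc.prems by (intro Suc.IH) simp
    finally show ?case by simp
  qed simp
  show ?thesis
  proof (cases "k \<le> l")
    case False
    then show ?thesis using ord[of l k] by (simp add: mult.commute add.commute)
  qed (rule ord)
qed

lemma log_convex_power_le:
  fixes a :: "nat \<Rightarrow> real"
  assumes nonneg: "\<And>k. 0 \<le> a k" and conv: "\<And>k. (a (Suc k))\<^sup>2 \<le> a k * a (Suc (Suc k))"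
  shows "a 1 ^ Suc n \<le> a 0 ^ n * a (Suc n)"
proof (induction n)
  case (Suc n)
  have "a 1 ^ Suc (Suc n) = a 1 * a 1 ^ Suc n" by simp
  also have "\<dots> \<le> a 1 * (a 0 ^ n * a (Suc n))"
    by (intro mult_left_mono Suc.IH nonneg)
  also have "\<dots> = a 0 ^ n * (a 1 * a (Suc n))" by simp
  also have "\<dots> \<le> a 0 ^ n * (a 0 * a (Suc (Suc n)))"
    using log_convex_mult_le[of a 1 "Suc n", OF assms] nonneg[of 0]
    by (intro mult_left_mono zero_le_power) simp_all
  finally show ?case by (simp add: mult_ac)
qed simp

section \<open>Moments of sums of rank-one operators\<close>

definition rank_one_sum :: "'a set \<Rightarrow> ('b \<Rightarrow> 'a \<Rightarrow> complex) \<Rightarrow> 'b set \<Rightarrow> ('a \<Rightarrow> complex) \<Rightarrow> ('a \<Rightarrow> complex)" where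
  "rank_one_sum T v S x = (\<lambda>j. \<Sum>i\<in>S. ip T x (v i) * v i j)"

text \<open>
  The \<open>k\<close>-th moment of \<open>x\<close>, that is \<open>\<langle>X\<^sup>k x, x\<rangle>\<close> for \<open>X = \<Sum>i\<in>S. v\<^sub>i v\<^sub>i\<^sup>*\<close> on \<open>\<complex>\<^sup>T\<close>. The inner product only
  looks at coordinates in \<open>T\<close>, so the values of \<open>X x\<close> elsewhere are irrelevant.
\<close>

definition op_moment :: "'a set \<Rightarrow> ('b \<Rightarrow> 'a \<Rightarrow> complex) \<Rightarrow> 'b set \<Rightarrow> nat \<Rightarrow> ('a \<Rightarrow> complex) \<Rightarrow> real" where
  "op_moment T v S k x = Re (ip T ((rank_one_sum T v S ^^ k) x) x)"

lemma ip_rank_one_sum: "ip T (rank_one_sum T v S x) y = (\<Sum>i\<in>S. ip T x (v i) * ip T (v i) y)"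
  by (simp add: rank_one_sum_def ip_sum_left)

lemma rank_one_sum_selfadjoint:
  "ip T (rank_one_sum T v S x) y = ip T x (rank_one_sum T v S y)"
  by (subst (2) ip_commute) (simp add: ip_rank_one_sum ip_commute[of T y] ip_commute[of T _ x] mult.commute)

lemma rank_one_sum_funpow_selfadjoint:
  "ip T ((rank_one_sum T v S ^^ k) x) y = ip T x ((rank_one_sum T v S ^^ k) y)"
proof (induction k arbitrary: x y)
  case (Suc k)
  show ?case by (simp add: rank_one_sum_selfadjoint Suc funpow_swap1)
qed simp

lemma funpow_shift:
  "ip T ((rank_one_sum T v S ^^ (k + l)) x) y = ip T ((rank_one_sum T v S ^^ k) x) ((rank_one_sum T v S ^^ l) y)"
  by (simp add: rank_one_sum_funpow_selfadjoint funpow_add add.commute[of k l])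

text \<open>
  All powers of \<open>X\<close> are positive semidefinite: an even power is \<open>\<langle>X\<^sup>m x, X\<^sup>m y\<rangle>\<close>, and in an odd power the
  middle factor \<open>X\<close> splits into \<open>\<Sum>i\<in>S. \<langle>X\<^sup>m x, v\<^sub>i\<rangle> \<langle>v\<^sub>i, X\<^sup>m y\<rangle>\<close>. Writing both as a Gram form over a disjoint
  sum of index types gives positivity and the Cauchy-Schwarz inequality without spectral theory.
\<close>

lemma op_form_gram:
  fixes T :: "'a set" and v :: "'b \<Rightarrow> 'a \<Rightarrow> complex"
  obtains f :: "('a \<Rightarrow> complex) \<Rightarrow> 'a + 'b \<Rightarrow> complex" and R where
    "\<And>x y. ip T ((rank_one_sum T v S ^^ k) x) y = ip R (f x) (f y)"
proof (cases "even k")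
  case True
  then obtain m where k: "k = m + m" by (metis evenE mult_2)
  show ?thesis
  proof (rule that[of "Inl ` T" "\<lambda>x. case_sum ((rank_one_sum T v S ^^ m) x) (\<lambda>_. 0)"])
    fix x y
    show "ip T ((rank_one_sum T v S ^^ k) x) y =
      ip (Inl ` T) (case_sum ((rank_one_sum T v S ^^ m) x) (\<lambda>_. 0 :: complex))
        (case_sum ((rank_one_sum T v S ^^ m) y) (\<lambda>_. 0))"
      unfolding k funpow_shift by (simp add: ip_def sum.reindex)
  qed
next
  case False
  then obtain m where k: "k = Suc (m + m)" by (metis oddE mult_2 Suc_eq_plus1)
  show ?thesis
  proof (rule that[of "Inr ` S" "\<lambda>x. case_sum (\<lambda>_. 0) (\<lambda>i. ip T ((rank_one_sum T v S ^^ m) x) (v i))"])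
    fix x y
    have "ip T ((rank_one_sum T v S ^^ k) x) y
        = ip T (rank_one_sum T v S ((rank_one_sum T v S ^^ m) x)) ((rank_one_sum T v S ^^ m) y)"
      using funpow_shift[where k = "Suc m" and l = m] by (simp add: k)
    then show "ip T ((rank_one_sum T v S ^^ k) x) y =
      ip (Inr ` S) (case_sum (\<lambda>_. 0 :: complex) (\<lambda>i. ip T ((rank_one_sum T v S ^^ m) x) (v i)))
        (case_sum (\<lambda>_. 0) (\<lambda>i. ip T ((rank_one_sum T v S ^^ m) y) (v i)))"
      by (simp add: ip_rank_one_sum ip_def[of "Inr ` S"] sum.reindex ip_commute[of T _ "v _"])
  qed
qed

lemma op_form_self: "ip T ((rank_one_sum T v S ^^ k) x) x = of_real (op_moment T v S k x)"
proof (rule op_form_gram[where T = T and v = v and S = S and k = k])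
  fix f :: "('a \<Rightarrow> complex) \<Rightarrow> 'a + 'b \<Rightarrow> complex" and R
  assume "\<And>x y. ip T ((rank_one_sum T v S ^^ k) x) y = ip R (f x) (f y)"
  then show ?thesis by (simp add: op_moment_def ip_self)
qed

lemma op_moment_nonneg: "0 \<le> op_moment T v S k x"
proof (rule op_form_gram[where T = T and v = v and S = S and k = k])
  fix f :: "('a \<Rightarrow> complex) \<Rightarrow> 'a + 'b \<Rightarrow> complex" and R
  assume "\<And>x y. ip T ((rank_one_sum T v S ^^ k) x) y = ip R (f x) (f y)"
  then show ?thesis by (simp add: op_moment_def ip_self sum_nonneg)
qed

lemma op_form_Cauchy_Schwarz:
  "(cmod (ip T ((rank_one_sum T v S ^^ k) x) y))\<^sup>2 \<le> op_moment T v S k x * op_moment T v S k y"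
proof (rule op_form_gram[where T = T and v = v and S = S and k = k])
  fix f :: "('a \<Rightarrow> complex) \<Rightarrow> 'a + 'b \<Rightarrow> complex" and R
  assume *: "\<And>x y. ip T ((rank_one_sum T v S ^^ k) x) y = ip R (f x) (f y)"
  show ?thesis
    using complex_Cauchy_Schwarz_sum[of "f x" "\<lambda>r. cnj (f y r)" R]
    by (simp add: op_moment_def * ip_self) (simp add: ip_def)
qed

lemma op_moment_log_convex:
  "(op_moment T v S (Suc k) x)\<^sup>2 \<le> op_moment T v S k x * op_moment T v S (Suc (Suc k)) x"
proof -
  let ?X = "rank_one_sum T v S"
  have 1: "ip T ((?X ^^ k) x) (?X x) = of_real (op_moment T v S (Suc k) x)"
    by (simp add: rank_one_sum_selfadjoint flip: op_form_self)
  have 2: "op_moment T v S k (?X x) = op_moment T v S (Suc (Suc k)) x"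
    by (simp add: op_moment_def rank_one_sum_selfadjoint flip: funpow_swap1)
  show ?thesis
    using op_form_Cauchy_Schwarz[where T = T and v = v and S = S and k = k and x = x and y = "?X x"] unfolding 1 2 by simp
qed

lemma op_moment_mult_le:
  "op_moment T v S k x * op_moment T v S l x \<le> op_moment T v S 0 x * op_moment T v S (k + l) x"
  by (rule log_convex_mult_le) (rule op_moment_nonneg op_moment_log_convex)+
text \<open>
  If \<open>a k = \<langle>Y\<^sup>k v, v\<rangle>\<close>, then \<open>shift_sum \<rho> a m k = \<langle>(Y + \<rho>)\<^sup>m Y\<^sup>k v, v\<rangle>\<close>: the binomial expansion is unfolded one
  factor at a time, so that only the sequence of moments occurs.
\<close>

fun shift_sum :: "real \<Rightarrow> (nat \<Rightarrow> real) \<Rightarrow> nat \<Rightarrow> nat \<Rightarrow> real" where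
  "shift_sum \<rho> a 0 k = a k"
| "shift_sum \<rho> a (Suc m) k = shift_sum \<rho> a m (Suc k) + \<rho> * shift_sum \<rho> a m k"

lemma shift_sum_mono:
  assumes "0 \<le> \<rho>" and "\<And>j. j \<le> k + m \<Longrightarrow> a j \<le> b j"
  shows "shift_sum \<rho> a m k \<le> shift_sum \<rho> b m k"
  using assms(2) by (induction m arbitrary: k) (auto intro!: add_mono mult_left_mono assms(1))

lemma shift_sum_sum:
  "shift_sum \<rho> (\<lambda>k. \<Sum>x\<in>A. c x * f x k) m k = (\<Sum>x\<in>A. c x * shift_sum \<rho> (f x) m k)"
  by (induction m arbitrary: k) (simp_all add: sum_distrib_left sum.distrib ring_distribs mult_ac)

lemma shift_sum_geometric: "shift_sum \<rho> (\<lambda>k. d * s ^ k) m k = d * s ^ k * (s + \<rho>) ^ m"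
  by (induction m arbitrary: k) (simp_all add: algebra_simps)

lemma shift_sum_mult_le:
  assumes "0 \<le> \<rho>" and "\<And>l. a l * a k \<le> \<rho> * a (l + k)"
  shows "shift_sum \<rho> a m l * a k \<le> \<rho> * shift_sum \<rho> a m (l + k)"
proof (induction m arbitrary: l)
  case (Suc m)
  have "\<rho> * (shift_sum \<rho> a m l * a k) \<le> \<rho> * (\<rho> * shift_sum \<rho> a m (l + k))"
    by (intro mult_left_mono Suc.IH assms)
  then show ?case using Suc.IH[of "Suc l"] by (simp add: algebra_simps)
qed (use assms in simp)

text \<open>
  With \<open>X = X\<^sub>S\<close>, \<open>Y = X + v v\<^sup>*\<close> and \<open>c m k = \<langle>Y\<^sup>m v, X\<^sup>k v\<rangle>\<close> one has \<open>c (m + 1) k = c m (k + 1) + c m 0 \<cdot> a k\<close>.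
  Dropping the last product gives the lower bound. For the upper bound, each product of two moments is
  absorbed by log-convexity, \<open>a l \<cdot> a k \<le> a 0 \<cdot> a (l + k)\<close> with \<open>a 0 \<le> \<rho>\<close>: on the vector \<open>v\<close> itself, the update
  is no worse than adding the scalar \<open>\<rho>\<close>.
\<close>

lemma rank_one_update_moment:
  assumes fin: "finite S" and i: "i \<notin> S" and \<rho>: "Re (ip T (v i) (v i)) \<le> \<rho>"
  shows "op_moment T v S m (v i) \<le> op_moment T v (insert i S) m (v i)"
    and "op_moment T v (insert i S) m (v i) \<le> shift_sum \<rho> (\<lambda>k. op_moment T v S k (v i)) m 0"
proof -
  let ?X = "rank_one_sum T v S" and ?Y = "rank_one_sum T v (insert i S)"
  define a where "a k = op_moment T v S k (v i)" for k
  define c where "c m k = Re (ip T ((?Y ^^ m) (v i)) ((?X ^^ k) (v i)))" for m k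
  have a_nonneg: "0 \<le> a k" for k by (simp add: a_def op_moment_nonneg)
  have a0: "a 0 \<le> \<rho>" using \<rho> by (simp add: a_def op_moment_def)
  then have \<rho>0: "0 \<le> \<rho>" using a_nonneg[of 0] by linarith
  have a_mult: "a l * a k \<le> \<rho> * a (l + k)" for l k
    using op_moment_mult_le[of T v S l "v i" k] mult_right_mono[OF a0 a_nonneg[of "l + k"]]
    by (simp add: a_def)
  have Y: "?Y x = (\<lambda>j. ?X x j + ip T x (v i) * v i j)" for x
    using fin i by (simp add: rank_one_sum_def add.commute)
  have step: "c (Suc m) k = c m (Suc k) + c m 0 * a k" for m k
  proof -
    let ?y = "(?Y ^^ m) (v i)"
    have "ip T (v i) ((?X ^^ k) (v i)) = of_real (a k)"
      by (simp add: a_def flip: op_form_self rank_one_sum_funpow_selfadjoint)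
    then have "ip T (?Y ?y) ((?X ^^ k) (v i))
        = ip T ?y (?X ((?X ^^ k) (v i))) + ip T ?y (v i) * of_real (a k)"
      unfolding Y[of ?y] ip_add_left ip_scale_left rank_one_sum_selfadjoint by simp
    then show ?thesis by (simp add: c_def)
  qed
  have c0: "c 0 k = a k" for k
    by (simp add: c_def a_def op_moment_def rank_one_sum_funpow_selfadjoint)
  have nonneg: "0 \<le> c m 0" for m
    using op_moment_nonneg[of T v "insert i S" m "v i"] by (simp add: c_def op_moment_def)
  have lower: "a (m + k) \<le> c m k" for m k
  proof (induction m arbitrary: k)
    case (Suc m)
    show ?case using Suc[of "Suc k"] mult_nonneg_nonneg[OF nonneg[of m] a_nonneg[of k]]
      by (simp add: step)
  qed (simp add: c0)
  have upper: "c m k \<le> shift_sum \<rho> a m k" for m k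
  proof (induction m arbitrary: k)
    case (Suc m)
    have "c m 0 * a k \<le> shift_sum \<rho> a m 0 * a k"
      by (intro mult_right_mono Suc a_nonneg)
    also have "\<dots> \<le> \<rho> * shift_sum \<rho> a m k"
      using shift_sum_mult_le[where a = a and \<rho> = \<rho> and m = m and l = 0 and k = k] \<rho>0 a_mult by simp
    finally show ?case using Suc[of "Suc k"] by (simp add: step)
  qed (simp add: c0)
  show "op_moment T v S m (v i) \<le> op_moment T v (insert i S) m (v i)"
    using lower[of m 0] by (simp add: a_def c_def op_moment_def)
  show "op_moment T v (insert i S) m (v i) \<le> shift_sum \<rho> (\<lambda>k. op_moment T v S k (v i)) m 0"
    using upper[of m 0] by (simp add: a_def[abs_def] c_def op_moment_def)
qed

section \<open>Trace moments under random sampling\<close>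

text \<open>
  The expectation over a random subset of \<open>I\<close> that contains each element independently with
  probability \<open>p\<close>.
\<close>

definition subset_expect :: "real \<Rightarrow> 'b set \<Rightarrow> ('b set \<Rightarrow> real) \<Rightarrow> real" where
  "subset_expect p I F = (\<Sum>S\<in>Pow I. p ^ card S * (1 - p) ^ card (I - S) * F S)"

lemma subset_expect_mono:
  assumes "0 \<le> p" "p \<le> 1" and "\<And>S. S \<subseteq> I \<Longrightarrow> F S \<le> G S"
  shows "subset_expect p I F \<le> subset_expect p I G"
  unfolding subset_expect_def using assms by (intro sum_mono mult_left_mono) auto

lemma subset_expect_sum: "subset_expect p I (\<lambda>S. \<Sum>x\<in>A. F x S) = (\<Sum>x\<in>A. subset_expect p I (F x))"
  by (simp add: subset_expect_def sum_distrib_left sum.swap[of _ "Pow I" A])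

lemma subset_expect_const:
  assumes "finite I" shows "subset_expect p I (\<lambda>S. c) = c"
proof -
  have "subset_expect p I (\<lambda>S. 1) = (p + (1 - p)) ^ card I"
    using prod_add[OF assms, of "\<lambda>_. p" "\<lambda>_. 1 - p"] by (simp add: subset_expect_def)
  moreover have "subset_expect p I (\<lambda>S. c) = c * subset_expect p I (\<lambda>S. 1)"
    by (simp add: subset_expect_def sum_distrib_left mult_ac)
  ultimately show ?thesis by simp
qed

lemma sum_Pow_insert:
  assumes "finite J" "i \<notin> J"
  shows "(\<Sum>S\<in>Pow (insert i J). f S) = (\<Sum>S\<in>Pow J. f S + f (insert i S))"
proof -
  have "(\<Sum>S\<in>Pow (insert i J). f S) = (\<Sum>S\<in>Pow J. f S) + (\<Sum>S\<in>insert i ` Pow J. f S)"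
    unfolding Pow_insert using assms by (intro sum.union_disjoint) auto
  also have "(\<Sum>S\<in>insert i ` Pow J. f S) = (\<Sum>S\<in>Pow J. f (insert i S))"
    using assms by (subst sum.reindex) (auto simp: inj_on_def)
  finally show ?thesis by (simp add: sum.distrib)
qed

text \<open>
  The event \<open>i \<in> S\<close> is independent of \<open>S - {i}\<close>.
\<close>

lemma subset_expect_member:
  assumes fin: "finite I" and i: "i \<in> I"
  shows "subset_expect p I (\<lambda>S. if i \<in> S then F (S - {i}) else 0)
    = p * subset_expect p I (\<lambda>S. F (S - {i}))"
proof -
  define J where "J = I - {i}"
  have I: "I = insert i J" and J: "finite J" "i \<notin> J" using fin i by (auto simp: J_def)
  have diff: "insert i J - S = insert i (J - S)" "insert i J - insert i S = J - S"
    "card (insert i (J - S)) = Suc (card (J - S))" "card (insert i S) = Suc (card S)"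
    "insert i S - {i} = S" "S - {i} = S" "i \<notin> S"
    if "S \<in> Pow J" for S using that J finite_subset[of S J] by (auto intro!: card_insert_disjoint)
  have "subset_expect p I (\<lambda>S. if i \<in> S then F (S - {i}) else 0)
      = (\<Sum>S\<in>Pow J. p * (p ^ card S * (1 - p) ^ card (J - S) * F S))"
    unfolding subset_expect_def I sum_Pow_insert[OF J] by (intro sum.cong) (simp_all add: diff)
  also have "\<dots> = p * subset_expect p I (\<lambda>S. F (S - {i}))"
    unfolding subset_expect_def I sum_Pow_insert[OF J] sum_distrib_left
    by (intro sum.cong refl) (simp only: diff, simp add: algebra_simps)
  finally show ?thesis .
qed

locale parseval_frame =
  fixes T :: "'a set" and I :: "'b set" and v :: "'b \<Rightarrow> 'a \<Rightarrow> complex"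
  assumes finite_T: "finite T" and finite_I: "finite I"
    and resolution: "\<And>j k. j \<in> T \<Longrightarrow> k \<in> T \<Longrightarrow>
      (\<Sum>i\<in>I. v i j * cnj (v i k)) = (if j = k then 1 else 0)"
begin

lemma parseval: "(\<Sum>i\<in>I. ip T x (v i) * ip T (v i) y) = ip T x y"
proof -
  have "(\<Sum>i\<in>I. ip T x (v i) * ip T (v i) y)
      = (\<Sum>i\<in>I. \<Sum>k\<in>T. \<Sum>j\<in>T. x k * cnj (y j) * (v i j * cnj (v i k)))"
    by (simp add: ip_def sum_product mult_ac)
  also have "\<dots> = (\<Sum>k\<in>T. \<Sum>j\<in>T. \<Sum>i\<in>I. x k * cnj (y j) * (v i j * cnj (v i k)))"
    by (simp add: sum.swap[of _ I T])
  also have "\<dots> = (\<Sum>k\<in>T. \<Sum>j\<in>T. x k * cnj (y j) * (if j = k then 1 else 0))"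
    by (simp add: resolution flip: sum_distrib_left)
  also have "\<dots> = ip T x y"
    using finite_T by (simp add: ip_def if_distrib[of "\<lambda>z. _ * z"] cong: if_cong)
  finally show ?thesis .
qed

text \<open>
  The trace of \<open>X\<^sub>S\<^sup>k\<close>, computed in the Parseval frame \<open>v\<close> instead of an orthonormal basis.
\<close>

definition trace_moment :: "'b set \<Rightarrow> nat \<Rightarrow> real" where
  "trace_moment S k = (\<Sum>i\<in>I. op_moment T v S k (v i))"

lemma trace_moment_nonneg: "0 \<le> trace_moment S k"
  by (simp add: trace_moment_def sum_nonneg op_moment_nonneg)

lemma trace_moment_0: "trace_moment S 0 = real (card T)"
proof -
  have "complex_of_real (trace_moment S 0) = (\<Sum>i\<in>I. \<Sum>j\<in>T. v i j * cnj (v i j))"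
    by (simp add: trace_moment_def flip: op_form_self) (simp add: ip_def)
  also have "\<dots> = (\<Sum>j\<in>T. \<Sum>i\<in>I. v i j * cnj (v i j))" by (rule sum.swap)
  also have "\<dots> = of_real (real (card T))" by (simp add: resolution)
  finally show ?thesis using of_real_eq_iff by blast
qed

text \<open>
  \<open>Tr X\<^sup>n\<^sup>+\<^sup>1 = Tr (X\<^sup>n \<Sum>j\<in>S. v\<^sub>j v\<^sub>j\<^sup>*)\<close>. Only the sampled vectors remain, which brings the random set out of
  the power and lets independence act on it.
\<close>

lemma trace_moment_Suc: "trace_moment S (Suc n) = (\<Sum>i\<in>S. op_moment T v S n (v i))"
proof -
  let ?X = "rank_one_sum T v S"
  have "complex_of_real (trace_moment S (Suc n)) = (\<Sum>i\<in>I. ip T (?X ((?X ^^ n) (v i))) (v i))"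
    by (simp add: trace_moment_def flip: op_form_self)
  also have "\<dots> = (\<Sum>i\<in>I. \<Sum>j\<in>S. ip T (v j) (v i) * ip T (v i) ((?X ^^ n) (v j)))"
    by (simp add: ip_rank_one_sum rank_one_sum_funpow_selfadjoint mult.commute)
  also have "\<dots> = (\<Sum>j\<in>S. \<Sum>i\<in>I. ip T (v j) (v i) * ip T (v i) ((?X ^^ n) (v j)))"
    by (rule sum.swap)
  also have "\<dots> = (\<Sum>j\<in>S. ip T ((?X ^^ n) (v j)) (v j))"
    by (simp add: parseval rank_one_sum_funpow_selfadjoint)
  also have "\<dots> = of_real (\<Sum>i\<in>S. op_moment T v S n (v i))"
    by (simp add: op_form_self)
  finally show ?thesis using of_real_eq_iff by blast
qed

text \<open>
  Each sampled \<open>i\<close> contributes \<open>\<langle>X\<^sub>S\<^sup>n v\<^sub>i, v\<^sub>i\<rangle>\<close>; replacing the contribution of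
  \<open>i\<close> to \<open>X\<^sub>S\<close> by the scalar \<open>\<rho>\<close> leaves a quantity that depends only on \<open>S - {i}\<close>, independence produces
  the factor \<open>p\<close>, and monotonicity puts \<open>i\<close> back. In terms of operators, \<open>E Tr X\<^sup>n\<^sup>+\<^sup>1 \<le> p E Tr (X + \<rho>)\<^sup>n\<close>.
\<close>

lemma expect_trace_moment_Suc:
  assumes p: "0 \<le> p" "p \<le> 1" and \<rho>0: "0 \<le> \<rho>"
    and \<rho>: "\<And>i. i \<in> I \<Longrightarrow> Re (ip T (v i) (v i)) \<le> \<rho>"
  shows "subset_expect p I (\<lambda>S. trace_moment S (Suc n))
    \<le> p * shift_sum \<rho> (\<lambda>k. subset_expect p I (\<lambda>S. trace_moment S k)) n 0"
proof -
  let ?sh = "\<lambda>S i. shift_sum \<rho> (\<lambda>k. op_moment T v S k (v i)) n 0"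
  have fin: "finite (S - {i})" if "S \<subseteq> I" for S and i using that finite_I finite_subset by auto
  have "subset_expect p I (\<lambda>S. trace_moment S (Suc n))
      \<le> subset_expect p I (\<lambda>S. \<Sum>i\<in>I. if i \<in> S then ?sh (S - {i}) i else 0)"
  proof (rule subset_expect_mono[OF p])
    fix S assume S: "S \<subseteq> I"
    have "trace_moment S (Suc n) = (\<Sum>i\<in>I. if i \<in> S then op_moment T v S n (v i) else 0)"
      unfolding trace_moment_Suc using S finite_I by (simp add: sum.If_cases Int_absorb1)
    also have "\<dots> \<le> (\<Sum>i\<in>I. if i \<in> S then ?sh (S - {i}) i else 0)"
    proof (intro sum_mono)
      fix i assume i: "i \<in> I"
      show "(if i \<in> S then op_moment T v S n (v i) else 0) \<le> (if i \<in> S then ?sh (S - {i}) i else 0)"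
        using rank_one_update_moment(2)[where i = i and m = n and v = v and S = "S - {i}", OF fin[OF S] _ \<rho>[OF i]] by (auto simp: insert_absorb)
    qed
    finally show "trace_moment S (Suc n) \<le> (\<Sum>i\<in>I. if i \<in> S then ?sh (S - {i}) i else 0)" .
  qed
  also have "\<dots> = (\<Sum>i\<in>I. p * subset_expect p I (\<lambda>S. ?sh (S - {i}) i))"
    by (simp add: subset_expect_sum subset_expect_member[OF finite_I, where F = "\<lambda>S. ?sh S _"])
  also have "\<dots> \<le> (\<Sum>i\<in>I. p * subset_expect p I (\<lambda>S. ?sh S i))"
  proof (intro sum_mono mult_left_mono subset_expect_mono p shift_sum_mono \<rho>0)
    fix i S k assume i: "i \<in> I" and S: "S \<subseteq> I"
    show "op_moment T v (S - {i}) k (v i) \<le> op_moment T v S k (v i)"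
      using rank_one_update_moment(1)[where i = i and m = k and v = v and S = "S - {i}", OF fin[OF S] _ \<rho>[OF i]]
      by (cases "i \<in> S") (auto simp: insert_absorb)
  qed
  also have "\<dots> = p * shift_sum \<rho> (\<lambda>k. subset_expect p I (\<lambda>S. trace_moment S k)) n 0"
    unfolding trace_moment_def subset_expect_sum
    by (simp add: subset_expect_def shift_sum_sum[where c = "\<lambda>_. 1" and A = I, simplified]
        shift_sum_sum[where A = "Pow I"] sum_distrib_left)
  finally show ?thesis .
qed

text \<open>
  The recursion propagates the bound \<open>d s\<^sup>k\<close> as long as \<open>p (s + \<rho>)\<^sup>k \<le> s\<^sup>k\<^sup>+\<^sup>1\<close>, and for \<open>k \<le> n\<close> this follows from
  \<open>(1 + \<rho>/s)\<^sup>k \<le> exp (n \<rho> / s) \<le> e\<close>.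
\<close>

lemma expect_trace_moment_le:
  assumes p: "0 \<le> p" "p \<le> 1" and \<rho>0: "0 \<le> \<rho>"
    and \<rho>: "\<And>i. i \<in> I \<Longrightarrow> Re (ip T (v i) (v i)) \<le> \<rho>"
    and s: "0 < s" "n * \<rho> \<le> s" "exp 1 * p \<le> s"
  shows "subset_expect p I (\<lambda>S. trace_moment S n) \<le> real (card T) * s ^ n"
proof -
  have *: "p * (s + \<rho>) ^ k \<le> s ^ Suc k" if "k \<le> n" for k
  proof -
    have "(1 + \<rho> / s) ^ k \<le> exp (\<rho> / s) ^ k"
      using s \<rho>0 by (intro power_mono exp_ge_add_one_self) auto
    also have "\<dots> = exp (k * (\<rho> / s))" by (rule exp_of_nat_mult[symmetric])
    also have "\<dots> \<le> exp 1"
      using s \<rho>0 that mult_right_mono[of "real k" "real n" \<rho>] by (simp add: field_simps)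
    finally have "(1 + \<rho> / s) ^ k \<le> exp 1" .
    then have "p * (s + \<rho>) ^ k \<le> p * (s ^ k * exp 1)"
      using s p power_mult_distrib[of s "1 + \<rho> / s" k]
      by (intro mult_left_mono) (simp_all add: distrib_left)
    also have "\<dots> = s ^ k * (exp 1 * p)" by simp
    also have "\<dots> \<le> s ^ k * s" using s by (intro mult_left_mono) auto
    finally show ?thesis by (simp add: mult.commute)
  qed
  have "subset_expect p I (\<lambda>S. trace_moment S k) \<le> real (card T) * s ^ k" if "k \<le> n" for k
    using that
  proof (induction k rule: less_induct)
    case (less k)
    show ?case
    proof (cases k)
      case 0
      then show ?thesis by (simp add: trace_moment_0 subset_expect_const[OF finite_I])
    next
      case (Suc m)
      have "subset_expect p I (\<lambda>S. trace_moment S k)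
          \<le> p * shift_sum \<rho> (\<lambda>k. subset_expect p I (\<lambda>S. trace_moment S k)) m 0"
        unfolding Suc by (rule expect_trace_moment_Suc[OF p \<rho>0 \<rho>])
      also have "\<dots> \<le> p * shift_sum \<rho> (\<lambda>k. real (card T) * s ^ k) m 0"
        using less Suc p \<rho>0 by (intro mult_left_mono shift_sum_mono) auto
      also have "\<dots> = real (card T) * (p * (s + \<rho>) ^ m)" by (simp add: shift_sum_geometric)
      also have "\<dots> \<le> real (card T) * s ^ Suc m"
        using less Suc by (intro mult_left_mono *) auto
      finally show ?thesis using Suc by simp
    qed
  qed
  then show ?thesis by simp
qed

text \<open>
  A positive form is bounded by its trace. Expanding one argument in the Parseval frame and applying
  Cauchy-Schwarz first to the form and then to the sum gives \<open>a\<^sup>2 \<le> a \<cdot> (\<parallel>x\<parallel>\<^sup>2 Tr X\<^sup>n)\<close>.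
\<close>

lemma op_moment_le_trace_moment: "op_moment T v S n x \<le> op_moment T v S 0 x * trace_moment S n"
proof (cases "op_moment T v S n x = 0")
  case False
  let ?X = "rank_one_sum T v S"
  let ?a = "op_moment T v S n x"
  have pos: "0 < ?a" using False op_moment_nonneg[of T v S n x] by linarith
  have x0: "(\<Sum>i\<in>I. (cmod (ip T (v i) x))\<^sup>2) = op_moment T v S 0 x"
  proof -
    have "complex_of_real (\<Sum>i\<in>I. (cmod (ip T (v i) x))\<^sup>2) = ip T x x"
      unfolding parseval[of x x, symmetric]
      by (simp add: complex_norm_square ip_commute[of T x "v _"] mult.commute del: of_real_power)
    then show ?thesis using op_form_self[where k = 0 and T = T and v = v and S = S and x = x] of_real_eq_iff by (metis funpow_0)
  qed
  have "of_real ?a = (\<Sum>i\<in>I. ip T ((?X ^^ n) x) (v i) * ip T (v i) x)"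
    by (simp add: parseval op_form_self)
  then have "?a\<^sup>2 = (cmod (\<Sum>i\<in>I. ip T ((?X ^^ n) x) (v i) * ip T (v i) x))\<^sup>2"
    by (metis norm_of_real power2_abs)
  also have "\<dots> \<le> (\<Sum>i\<in>I. (cmod (ip T ((?X ^^ n) x) (v i)))\<^sup>2) * (\<Sum>i\<in>I. (cmod (ip T (v i) x))\<^sup>2)"
    by (rule complex_Cauchy_Schwarz_sum)
  also have "\<dots> \<le> (\<Sum>i\<in>I. ?a * op_moment T v S n (v i)) * op_moment T v S 0 x"
    unfolding x0 by (intro mult_right_mono sum_mono op_form_Cauchy_Schwarz op_moment_nonneg)
  also have "\<dots> = ?a * (op_moment T v S 0 x * trace_moment S n)"
    by (simp add: trace_moment_def sum_distrib_left mult_ac)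
  finally show ?thesis using pos by (simp add: power2_eq_square)
qed (simp add: op_moment_nonneg trace_moment_nonneg)

text \<open>
  Log-convexity bounds the first moment by the \<open>n + 1\<close>-st, \<open>\<langle>X x, x\<rangle>\<^sup>n\<^sup>+\<^sup>1 \<le> \<parallel>x\<parallel>\<^sup>2\<^sup>n \<langle>X\<^sup>n\<^sup>+\<^sup>1 x, x\<rangle>\<close>, so a bound on the
  trace of a power is a bound on the operator norm.
\<close>

lemma sampled_form_le:
  assumes "trace_moment S (Suc n) \<le> t ^ Suc n" and t: "0 \<le> t"
  shows "(\<Sum>i\<in>S. (cmod (ip T x (v i)))\<^sup>2) \<le> t * (\<Sum>j\<in>T. (cmod (x j))\<^sup>2)"
proof -
  let ?a = "\<lambda>k. op_moment T v S k x"
  have a0: "?a 0 = (\<Sum>j\<in>T. (cmod (x j))\<^sup>2)" by (simp add: op_moment_def ip_self)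
  have "of_real (?a 1) = (\<Sum>i\<in>S. ip T x (v i) * ip T (v i) x)"
    unfolding op_form_self[symmetric] by (simp add: ip_rank_one_sum)
  also have "\<dots> = of_real (\<Sum>i\<in>S. (cmod (ip T x (v i)))\<^sup>2)"
    by (simp add: complex_norm_square ip_commute[of T x "v _"] mult.commute del: of_real_power)
  finally have a1: "?a 1 = (\<Sum>i\<in>S. (cmod (ip T x (v i)))\<^sup>2)" using of_real_eq_iff by blast
  have "?a 1 ^ Suc n \<le> ?a 0 ^ n * ?a (Suc n)"
    by (rule log_convex_power_le) (rule op_moment_nonneg op_moment_log_convex)+
  also have "\<dots> \<le> ?a 0 ^ n * (?a 0 * t ^ Suc n)"
    by (intro mult_left_mono order_trans[OF op_moment_le_trace_moment] assms zero_le_power op_moment_nonneg)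
  also have "\<dots> = (t * ?a 0) ^ Suc n" by (simp add: power_mult_distrib mult_ac)
  finally have "?a 1 ^ Suc n \<le> (t * ?a 0) ^ Suc n" .
  then have "?a 1 \<le> t * ?a 0"
    by (rule power_le_imp_le_base) (intro mult_nonneg_nonneg t op_moment_nonneg)
  then show ?thesis unfolding a0 a1 .
qed

end

section \<open>Bernoulli index sets\<close>

lemma subset_expect_cmult: "subset_expect p I (\<lambda>S. c * F S) = c * subset_expect p I F"
  by (simp add: subset_expect_def sum_distrib_left mult_ac)

lemma subset_expect_card:
  assumes "finite I" shows "subset_expect p I (\<lambda>S. real (card S)) = p * card I"
proof -
  have "subset_expect p I (\<lambda>S. real (card S)) = subset_expect p I (\<lambda>S. \<Sum>i\<in>I. if i \<in> S then 1 else 0)"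
    unfolding subset_expect_def using assms
    by (intro sum.cong refl) (auto simp: sum.If_cases Int_absorb1)
  also have "\<dots> = (\<Sum>i\<in>I. p)"
    unfolding subset_expect_sum using assms
    by (intro sum.cong refl) (simp add: subset_expect_member[where F = "\<lambda>_. 1"] subset_expect_const)
  finally show ?thesis by simp
qed

lemma subset_expect_two_power:
  assumes "finite I" shows "subset_expect p I (\<lambda>S. 2 ^ card S) = (1 + p) ^ card I"
proof -
  have "subset_expect p I (\<lambda>S. 2 ^ card S) = (\<Sum>S\<in>Pow I. (\<Prod>i\<in>S. 2 * p) * (\<Prod>i\<in>I - S. 1 - p))"
    by (simp add: subset_expect_def power_mult_distrib mult_ac)
  also have "\<dots> = (\<Prod>i\<in>I. 2 * p + (1 - p))" by (rule prod_add[OF assms, symmetric])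
  finally show ?thesis by (simp add: algebra_simps)
qed

lemma set_bernoulli_subset: "set_pmf (bernoulli_subset N p) \<subseteq> Pow {..<N}"
  by (auto simp: bernoulli_subset_def)

lemma pmf_bernoulli_subset:
  assumes p: "0 \<le> p" "p \<le> 1" and S: "S \<subseteq> {..<N}"
  shows "pmf (bernoulli_subset N p) S = p ^ card S * (1 - p) ^ card ({..<N} - S)"
proof -
  let ?P = "Pi_pmf {..<N} False (\<lambda>_. bernoulli_pmf p)"
  have "pmf (bernoulli_subset N p) S = measure ?P ((\<lambda>I. {j. j < N \<and> I j}) -` {S})"
    by (simp add: bernoulli_subset_def pmf_map)
  also have "\<dots> = measure ?P (PiE_dflt {..<N} False (\<lambda>j. {j \<in> S}))"
  proof (rule measure_pmf.finite_measure_eq_AE)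
    show "AE I in ?P. I \<in> (\<lambda>I. {j. j < N \<and> I j}) -` {S} \<longleftrightarrow> I \<in> PiE_dflt {..<N} False (\<lambda>j. {j \<in> S})"
    proof (rule AE_pmfI)
      fix I assume "I \<in> set_pmf ?P"
      then have "\<forall>x. x \<notin> {..<N} \<longrightarrow> I x = False"
        using set_Pi_pmf_subset[of "{..<N}" False "\<lambda>_. bernoulli_pmf p"] by auto
      then show "I \<in> (\<lambda>I. {j. j < N \<and> I j}) -` {S} \<longleftrightarrow> I \<in> PiE_dflt {..<N} False (\<lambda>j. {j \<in> S})"
        using S by (auto simp: PiE_dflt_def set_eq_iff)
    qed
  qed auto
  also have "\<dots> = (\<Prod>j<N. measure (bernoulli_pmf p) {j \<in> S})"
    by (rule measure_Pi_pmf_PiE_dflt) simp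
  also have "\<dots> = (\<Prod>j<N. if j \<in> S then p else 1 - p)"
    using p by (intro prod.cong) (auto simp: measure_pmf_single)
  also have "\<dots> = p ^ card ({..<N} \<inter> {j. j \<in> S}) * (1 - p) ^ card ({..<N} \<inter> - {j. j \<in> S})"
    by (simp add: prod.If_cases)
  also have "{..<N} \<inter> {j. j \<in> S} = S" using S by auto
  also have "{..<N} \<inter> - {j. j \<in> S} = {..<N} - S" by auto
  finally show ?thesis .
qed

lemma expectation_bernoulli_subset:
  assumes "0 \<le> p" "p \<le> 1"
  shows "measure_pmf.expectation (bernoulli_subset N p) F = subset_expect p {..<N} F"
proof -
  have "measure_pmf.expectation (bernoulli_subset N p) F
      = (\<Sum>S\<in>Pow {..<N}. pmf (bernoulli_subset N p) S *\<^sub>R F S)"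
    using set_bernoulli_subset by (intro integral_measure_pmf) auto
  then show ?thesis using assms by (simp add: subset_expect_def pmf_bernoulli_subset)
qed

lemma expected_card_bernoulli_subset:
  "0 \<le> p \<Longrightarrow> p \<le> 1 \<Longrightarrow> expected_card (bernoulli_subset N p) = real N * p"
  by (simp add: expected_card_def expectation_bernoulli_subset subset_expect_card mult.commute)

lemma bernoulli_subset_Markov:
  assumes p: "0 \<le> p" "p \<le> 1" and c: "0 < c"
    and nonneg: "\<And>S. S \<subseteq> {..<N} \<Longrightarrow> 0 \<le> F S"
    and A: "\<And>S. S \<subseteq> {..<N} \<Longrightarrow> S \<in> A \<Longrightarrow> c \<le> F S"
  shows "measure_pmf.prob (bernoulli_subset N p) A \<le> subset_expect p {..<N} F / c"
proof -
  have "measure_pmf.prob (bernoulli_subset N p) A = subset_expect p {..<N} (indicator A)"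
    using p by (simp flip: expectation_bernoulli_subset)
  also have "\<dots> \<le> subset_expect p {..<N} (\<lambda>S. (1 / c) * F S)"
    using p c nonneg A by (intro subset_expect_mono) (auto simp: indicator_def field_simps)
  finally show ?thesis unfolding subset_expect_cmult by simp
qed

text \<open>
  Markov's inequality for \<open>2 ^ card S\<close>, whose expectation \<open>(1 + p)\<^sup>N\<close> is at most \<open>exp (N p)\<close>; the threshold
  \<open>4 N p\<close> is large enough because \<open>4 ln 2 \<ge> 2\<close>.
\<close>

lemma bernoulli_subset_card_tail:
  assumes p: "0 \<le> p" "p \<le> 1"
  shows "measure_pmf.prob (bernoulli_subset N p) {S. 4 * (real N * p) < real (card S)} \<le> exp (- (real N * p))"
proof -
  let ?m = "real N * p"
  have "measure_pmf.prob (bernoulli_subset N p) {S. 4 * ?m < real (card S)}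
      \<le> subset_expect p {..<N} (\<lambda>S. 2 ^ card S) / exp (2 * ?m)"
  proof (rule bernoulli_subset_Markov[OF p])
    fix S assume "S \<in> {S. 4 * ?m < real (card S)}"
    then have "2 * ?m \<le> real (card S) * ln 2"
      using mult_mono[of "4 * ?m" "real (card S)" "1 / 2" "ln 2"] ln2_ge_two_thirds p by (simp add: mult.commute mult.left_commute)
    then have "exp (2 * ?m) \<le> exp (real (card S) * ln 2)" unfolding exp_le_cancel_iff .
    also have "\<dots> = 2 ^ card S" unfolding exp_of_nat_mult by simp
    finally show "exp (2 * ?m) \<le> 2 ^ card S" .
  qed auto
  also have "\<dots> \<le> exp ?m / exp (2 * ?m)"
  proof (rule divide_right_mono)
    have "(1 + p) ^ N \<le> exp p ^ N" using p exp_ge_add_one_self[of p] by (intro power_mono) auto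
    then show "subset_expect p {..<N} (\<lambda>S. 2 ^ card S) \<le> exp ?m"
      by (simp add: subset_expect_two_power exp_of_nat_mult)
  qed simp
  also have "\<dots> = exp (- ?m)" by (simp flip: exp_diff)
  finally show ?thesis .
qed

text \<open>
  The matrix Chernoff bound for a randomly sampled Parseval frame, from Markov's inequality for the trace
  of a high power.
\<close>

lemma bernoulli_sampled_form_tail:
  fixes v :: "nat \<Rightarrow> 'a \<Rightarrow> complex"
  assumes frame: "parseval_frame T {..<N} v"
    and p: "0 \<le> p" "p \<le> 1" and \<rho>0: "0 \<le> \<rho>"
    and \<rho>: "\<And>i. i < N \<Longrightarrow> Re (ip T (v i) (v i)) \<le> \<rho>"
    and s: "0 < s" "real (Suc n) * \<rho> \<le> s" "exp 1 * p \<le> s" and t: "0 < t"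
  shows "measure_pmf.prob (bernoulli_subset N p)
    {S. \<not> (\<forall>x. (\<Sum>i\<in>S. (cmod (ip T x (v i)))\<^sup>2) \<le> t * (\<Sum>j\<in>T. (cmod (x j))\<^sup>2))}
    \<le> real (card T) * (s / t) ^ Suc n"
proof -
  interpret parseval_frame T "{..<N}" v by (fact frame)
  have "measure_pmf.prob (bernoulli_subset N p)
    {S. \<not> (\<forall>x. (\<Sum>i\<in>S. (cmod (ip T x (v i)))\<^sup>2) \<le> t * (\<Sum>j\<in>T. (cmod (x j))\<^sup>2))}
    \<le> subset_expect p {..<N} (\<lambda>S. trace_moment S (Suc n)) / t ^ Suc n"
  proof (rule bernoulli_subset_Markov[OF p])
    fix S assume "S \<in> {S. \<not> (\<forall>x. (\<Sum>i\<in>S. (cmod (ip T x (v i)))\<^sup>2) \<le> t * (\<Sum>j\<in>T. (cmod (x j))\<^sup>2))}"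
    then have "\<not> trace_moment S (Suc n) \<le> t ^ Suc n"
      using sampled_form_le[of S n t] t by auto
    then show "t ^ Suc n \<le> trace_moment S (Suc n)" by simp
  qed (use t trace_moment_nonneg in auto)
  also have "\<dots> \<le> real (card T) * s ^ Suc n / t ^ Suc n"
    using expect_trace_moment_le[OF p \<rho>0 \<rho> s] t by (intro divide_right_mono) auto
  finally show ?thesis by (simp add: power_divide)
qed

section \<open>Deterministic recovery from a separated support\<close>

definition synth :: "('g \<Rightarrow> 'r \<Rightarrow> complex) \<Rightarrow> 'g set \<Rightarrow> ('g \<Rightarrow> complex) \<Rightarrow> 'r \<Rightarrow> complex" where
  "synth \<phi> G x = (\<lambda>r. \<Sum>g\<in>G. x g * \<phi> g r)"

lemma ip_synth_left: "ip R (synth \<phi> G x) z = (\<Sum>g\<in>G. x g * ip R (\<phi> g) z)"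
  by (simp add: synth_def ip_sum_left)

lemma ip_synth_right: "ip R z (synth \<phi> G x) = (\<Sum>g\<in>G. cnj (x g) * ip R z (\<phi> g))"
  by (simp add: synth_def ip_sum_right)

lemma synth_orthonormal:
  assumes fin: "finite G"
    and on: "\<And>g h. g \<in> G \<Longrightarrow> h \<in> G \<Longrightarrow> ip R (\<phi> g) (\<phi> h) = (if g = h then 1 else 0)"
  shows "ip R (synth \<phi> G x) (synth \<phi> G x) = of_real (\<Sum>g\<in>G. (cmod (x g))\<^sup>2)"
proof -
  have "ip R (\<phi> g) (synth \<phi> G x) = cnj (x g)" if g: "g \<in> G" for g
  proof -
    have "ip R (\<phi> g) (synth \<phi> G x) = (\<Sum>h\<in>G. if g = h then cnj (x h) else 0)"
      unfolding ip_synth_right using on[OF g] by (intro sum.cong refl) simp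
    then show ?thesis using g fin by simp
  qed
  then have "ip R (synth \<phi> G x) (synth \<phi> G x) = (\<Sum>g\<in>G. x g * cnj (x g))"
    unfolding ip_synth_left by (intro sum.cong refl) simp
  then show ?thesis by (simp only: of_real_sum complex_norm_square)
qed

text \<open>
  One Gram-Schmidt step per new vector \<open>\<phi> g\<close>: the residual of \<open>y\<close> is corrected along the residual \<open>e\<close> of
  \<open>\<phi> g\<close>. If \<open>e\<close> vanishes, the quotient defining \<open>c\<close> is \<open>0\<close> and nothing has to be corrected, so linear
  dependence needs no separate treatment.
\<close>

lemma orthogonal_projection_exists:
  assumes "finite R" "finite G"
  shows "\<exists>w. \<forall>g\<in>G. ip R (\<lambda>r. y r - synth \<phi> G w r) (\<phi> g) = 0"
  using assms(2)
proof (induction G arbitrary: y rule: finite_induct)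
  case (insert g G)
  obtain u where u: "\<And>h. h \<in> G \<Longrightarrow> ip R (\<lambda>r. \<phi> g r - synth \<phi> G u r) (\<phi> h) = 0"
    using insert.IH by blast
  obtain w where w: "\<And>h. h \<in> G \<Longrightarrow> ip R (\<lambda>r. y r - synth \<phi> G w r) (\<phi> h) = 0"
    using insert.IH by blast
  define e where "e = (\<lambda>r. \<phi> g r - synth \<phi> G u r)"
  define z where "z = (\<lambda>r. y r - synth \<phi> G w r)"
  define c where "c = ip R z e / ip R e e"
  \<comment> \<open>Coefficients of \<open>synth \<phi> G w + c e\<close>, the projection onto the enlarged span.\<close>
  define w' where "w' = (\<lambda>h. if h = g then c else w h - c * u h)"
  have "synth \<phi> (insert g G) w' r = c * \<phi> g r + (\<Sum>h\<in>G. (w h - c * u h) * \<phi> h r)" for r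
  proof -
    have "(\<Sum>h\<in>G. w' h * \<phi> h r) = (\<Sum>h\<in>G. (w h - c * u h) * \<phi> h r)"
      using insert.hyps by (intro sum.cong) (auto simp: w'_def)
    then show ?thesis using insert.hyps by (simp add: synth_def) (simp add: w'_def)
  qed
  then have res: "(\<lambda>r. y r - synth \<phi> (insert g G) w' r) = (\<lambda>r. z r - c * e r)"
    by (auto simp: z_def e_def synth_def algebra_simps sum_subtractf sum_distrib_left)
  have orth: "ip R (\<lambda>r. z r - c * e r) (\<phi> h) = 0" if "h \<in> G" for h
    using u[OF that] w[OF that] by (simp add: ip_diff_left ip_scale_left flip: z_def e_def)
  have "ip R z e - c * ip R e e = 0"
  proof (cases "ip R e e = 0")
    case True
    then show ?thesis using ip_zero_iff[OF assms(1), of e] by (simp add: ip_def)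
  qed (simp add: c_def)
  then have "ip R (\<lambda>r. z r - c * e r) e = 0" by (simp add: ip_diff_left ip_scale_left)
  moreover have "\<phi> g = (\<lambda>r. e r + synth \<phi> G u r)" by (simp add: e_def)
  then have "ip R (\<lambda>r. z r - c * e r) (\<phi> g)
      = ip R (\<lambda>r. z r - c * e r) e + ip R (\<lambda>r. z r - c * e r) (synth \<phi> G u)"
    by (simp add: ip_def distrib_left sum.distrib)
  ultimately have "ip R (\<lambda>r. z r - c * e r) (\<phi> g) = 0"
    by (simp add: ip_synth_right orth)
  then show ?case using orth res by (intro exI[of _ w']) auto
qed simp

text \<open>
  The subgradient inequality for the modulus; at \<open>a = 0\<close> it holds with the convention \<open>sgn 0 = 0\<close>.
\<close>

lemma norm_add_ge_sgn:
  fixes a h :: complex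
  shows "cmod a + Re (h * cnj (sgn a)) \<le> cmod (a + h)"
proof (cases "a = 0")
  case False
  then have "a * cnj (sgn a) = cmod a"
    using complex_norm_square[of a] by (simp add: sgn_eq field_simps power2_eq_square)
  then have "cmod a + Re (h * cnj (sgn a)) = Re ((a + h) * cnj (sgn a))"
    by (simp add: distrib_right del: times_complex.sel)
  also have "\<dots> \<le> cmod ((a + h) * cnj (sgn a))" by (rule complex_Re_le_cmod)
  also have "\<dots> = cmod (a + h)" using False by (simp add: norm_mult norm_sgn)
  finally show ?thesis .
qed simp

text \<open>
  Complex-valued functions form a vector space over \<open>\<complex>\<close>; its dimension theory is needed once, to compare
  the spans of two sets of columns.
\<close>

interpretation cfun: vector_space "\<lambda>(c::complex) (f::'r \<Rightarrow> complex) r. c * f r"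
  by unfold_locales (auto simp: algebra_simps)

lemma cfun_sum_apply: "(\<Sum>x\<in>A. (f x :: 'r \<Rightarrow> complex)) = (\<lambda>r. \<Sum>x\<in>A. f x r)"
  by (induction A rule: infinite_finite_induct) auto

text \<open>
  The family \<open>\<phi>\<close> indexed by \<open>J\<close> consists of the columns of a dictionary with row set \<open>R\<close>, and \<open>\<Gamma>\<close> is the
  support of the signal.
\<close>

locale separated_support =
  fixes R :: "'r set" and J \<Gamma> :: "'g set" and \<phi> :: "'g \<Rightarrow> 'r \<Rightarrow> complex" and \<eta> :: real
  assumes finite_R: "finite R" and finite_J: "finite J" and sub: "\<Gamma> \<subseteq> J"
    and coercive: "\<And>x. (\<Sum>g\<in>\<Gamma>. (cmod (x g))\<^sup>2) \<le> 2 * Re (ip R (synth \<phi> \<Gamma> x) (synth \<phi> \<Gamma> x))"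
    and cross: "\<And>\<gamma>. \<gamma> \<in> J - \<Gamma> \<Longrightarrow> (\<Sum>g\<in>\<Gamma>. (cmod (ip R (\<phi> \<gamma>) (\<phi> g)))\<^sup>2) \<le> \<eta>"
    and unit: "\<And>\<gamma>. \<gamma> \<in> J - \<Gamma> \<Longrightarrow> ip R (\<phi> \<gamma>) (\<phi> \<gamma>) = 1"
    and \<eta>_less: "\<eta> < 1 / 2"
begin

lemma finite_\<Gamma>: "finite \<Gamma>" using sub finite_J finite_subset by blast

lemma synth_injective:
  assumes "\<And>r. r \<in> R \<Longrightarrow> synth \<phi> \<Gamma> x r = 0" and "g \<in> \<Gamma>"
  shows "x g = 0"
proof -
  have "ip R (synth \<phi> \<Gamma> x) (synth \<phi> \<Gamma> x) = 0" using assms(1) ip_zero_iff[OF finite_R] by blast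
  then have "(\<Sum>g\<in>\<Gamma>. (cmod (x g))\<^sup>2) \<le> 0" using coercive[of x] by simp
  then have "(\<Sum>g\<in>\<Gamma>. (cmod (x g))\<^sup>2) = 0" by (intro antisym sum_nonneg) auto
  then show ?thesis using assms(2) finite_\<Gamma> by (simp add: sum_nonneg_eq_0_iff)
qed

lemma cross_bound:
  assumes "\<gamma> \<in> J - \<Gamma>"
  shows "(cmod (ip R (\<phi> \<gamma>) (synth \<phi> \<Gamma> x)))\<^sup>2 \<le> (\<Sum>g\<in>\<Gamma>. (cmod (x g))\<^sup>2) * \<eta>"
proof -
  have "(cmod (ip R (\<phi> \<gamma>) (synth \<phi> \<Gamma> x)))\<^sup>2
      \<le> (\<Sum>g\<in>\<Gamma>. (cmod (cnj (x g)))\<^sup>2) * (\<Sum>g\<in>\<Gamma>. (cmod (ip R (\<phi> \<gamma>) (\<phi> g)))\<^sup>2)"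
    unfolding ip_synth_right by (rule complex_Cauchy_Schwarz_sum)
  also have "\<dots> \<le> (\<Sum>g\<in>\<Gamma>. (cmod (x g))\<^sup>2) * \<eta>"
    using cross[OF assms] by (simp add: mult_left_mono sum_nonneg)
  finally show ?thesis .
qed

text \<open>
  The projection \<open>P\<close> satisfies \<open>\<parallel>P\<parallel>\<^sup>2 = \<langle>\<phi>\<^sub>\<gamma>, P\<rangle> \<le> \<parallel>w\<parallel> \<surd>\<eta>\<close>, while the lower bound on the synthesis gives
  \<open>\<parallel>w\<parallel>\<^sup>2 \<le> 2 \<parallel>P\<parallel>\<^sup>2\<close>.
\<close>

lemma projection_coefficients:
  obtains w where "\<And>\<gamma>. \<gamma> \<in> J - \<Gamma> \<Longrightarrow> (\<Sum>g\<in>\<Gamma>. (cmod (w \<gamma> g))\<^sup>2) \<le> 4 * \<eta>"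
    and "\<And>\<gamma> g. g \<in> \<Gamma> \<Longrightarrow> ip R (\<lambda>r. \<phi> \<gamma> r - synth \<phi> \<Gamma> (w \<gamma>) r) (\<phi> g) = 0"
proof -
  have "\<forall>\<gamma>. \<exists>w. \<forall>g\<in>\<Gamma>. ip R (\<lambda>r. \<phi> \<gamma> r - synth \<phi> \<Gamma> w r) (\<phi> g) = 0"
    using orthogonal_projection_exists[OF finite_R finite_\<Gamma>] by blast
  then obtain w where w: "\<And>\<gamma> g. g \<in> \<Gamma> \<Longrightarrow> ip R (\<lambda>r. \<phi> \<gamma> r - synth \<phi> \<Gamma> (w \<gamma>) r) (\<phi> g) = 0"
    by metis
  have "(\<Sum>g\<in>\<Gamma>. (cmod (w \<gamma> g))\<^sup>2) \<le> 4 * \<eta>" if \<gamma>: "\<gamma> \<in> J - \<Gamma>" for \<gamma>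
  proof -
    let ?P = "synth \<phi> \<Gamma> (w \<gamma>)" and ?W = "\<Sum>g\<in>\<Gamma>. (cmod (w \<gamma> g))\<^sup>2"
    have W0: "0 \<le> ?W" by (intro sum_nonneg) auto
    have "ip R (\<lambda>r. \<phi> \<gamma> r - ?P r) ?P = 0" by (simp add: ip_synth_right w)
    then have eq: "ip R (\<phi> \<gamma>) ?P = ip R ?P ?P" by (simp add: ip_diff_left)
    have "?W \<le> 2 * cmod (ip R (\<phi> \<gamma>) ?P)"
      using coercive[of "w \<gamma>"] complex_Re_le_cmod[of "ip R ?P ?P"] unfolding eq by linarith
    then have "?W\<^sup>2 \<le> (2 * cmod (ip R (\<phi> \<gamma>) ?P))\<^sup>2" using W0 by (rule power_mono)
    also have "\<dots> \<le> 4 * (?W * \<eta>)" using cross_bound[OF \<gamma>, of "w \<gamma>"] by (simp add: power_mult_distrib)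
    finally have "?W * ?W \<le> ?W * (4 * \<eta>)" by (simp add: power2_eq_square mult_ac)
    moreover have "0 \<le> \<eta>" using order_trans[OF sum_nonneg cross[OF \<gamma>]] by simp
    ultimately show ?thesis using W0 by (cases "?W = 0") auto
  qed
  then show ?thesis using w that by blast
qed

text \<open>
  Correct \<open>h\<close> on \<open>\<Gamma>\<close> by the projection coefficients of the outer columns. The synthesis of the resulting coefficients
  \<open>u\<close> equals minus a combination of residuals, which are orthogonal to the columns in \<open>\<Gamma>\<close>. Hence it is
  orthogonal to itself, and injectivity forces \<open>u = 0\<close>.
\<close>

lemma kernel_on_support:
  assumes w: "\<And>\<gamma> g. g \<in> \<Gamma> \<Longrightarrow> ip R (\<lambda>r. \<phi> \<gamma> r - synth \<phi> \<Gamma> (w \<gamma>) r) (\<phi> g) = 0"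
    and ker: "\<And>r. r \<in> R \<Longrightarrow> synth \<phi> J h r = 0" and g: "g \<in> \<Gamma>"
  shows "h g = - (\<Sum>\<gamma>\<in>J - \<Gamma>. h \<gamma> * w \<gamma> g)"
proof -
  define u where "u g = h g + (\<Sum>\<gamma>\<in>J - \<Gamma>. h \<gamma> * w \<gamma> g)" for g
  define e where "e = (\<lambda>r. \<Sum>\<gamma>\<in>J - \<Gamma>. h \<gamma> * (\<phi> \<gamma> r - synth \<phi> \<Gamma> (w \<gamma>) r))"
  have u_eq: "synth \<phi> \<Gamma> u r = - e r" if r: "r \<in> R" for r
  proof -
    have "synth \<phi> J h r = (\<Sum>\<gamma>\<in>J - \<Gamma>. h \<gamma> * \<phi> \<gamma> r) + synth \<phi> \<Gamma> h r"
      unfolding synth_def by (rule sum.subset_diff[OF sub finite_J])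
    moreover have "synth \<phi> \<Gamma> u r = synth \<phi> \<Gamma> h r + (\<Sum>\<gamma>\<in>J - \<Gamma>. h \<gamma> * synth \<phi> \<Gamma> (w \<gamma>) r)"
      by (simp add: u_def synth_def distrib_right sum.distrib sum_distrib_right sum_distrib_left
          mult.assoc sum.swap[of _ \<Gamma> "J - \<Gamma>"])
    moreover have "e r = (\<Sum>\<gamma>\<in>J - \<Gamma>. h \<gamma> * \<phi> \<gamma> r) - (\<Sum>\<gamma>\<in>J - \<Gamma>. h \<gamma> * synth \<phi> \<Gamma> (w \<gamma>) r)"
      by (simp add: e_def right_diff_distrib sum_subtractf)
    ultimately show ?thesis using ker[OF r] by (simp add: add_eq_0_iff)
  qed
  have "ip R e (\<phi> g) = 0" if "g \<in> \<Gamma>" for g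
    unfolding e_def ip_sum_left using w[OF that] by simp
  then have "ip R e (synth \<phi> \<Gamma> u) = 0" by (simp add: ip_synth_right)
  then have "ip R (synth \<phi> \<Gamma> u) (synth \<phi> \<Gamma> u) = 0" using u_eq by (simp add: ip_def sum_negf)
  then have "u g = 0" using g ip_zero_iff[OF finite_R] synth_injective by blast
  then show ?thesis by (simp add: u_def eq_neg_iff_add_eq_0)
qed

text \<open>
  A kernel vector that vanished outside \<open>\<Gamma>\<close> would vanish altogether, so the gain outside \<open>\<Gamma>\<close> is strictly
  larger than the loss on \<open>\<Gamma>\<close>.
\<close>

lemma l1_recovery:
  assumes w: "\<And>\<gamma> g. g \<in> \<Gamma> \<Longrightarrow> ip R (\<lambda>r. \<phi> \<gamma> r - synth \<phi> \<Gamma> (w \<gamma>) r) (\<phi> g) = 0"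
    and dual: "\<And>\<gamma>. \<gamma> \<in> J - \<Gamma> \<Longrightarrow> cmod (\<Sum>g\<in>\<Gamma>. w \<gamma> g * cnj (sgn (\<alpha> g))) < 1"
    and supp: "\<And>\<gamma>. \<gamma> \<in> J - \<Gamma> \<Longrightarrow> \<alpha> \<gamma> = 0"
    and ker: "\<And>r. r \<in> R \<Longrightarrow> synth \<phi> J h r = 0" and nz: "\<exists>\<gamma>\<in>J. h \<gamma> \<noteq> 0"
  shows "(\<Sum>\<gamma>\<in>J. cmod (\<alpha> \<gamma>)) < (\<Sum>\<gamma>\<in>J. cmod (\<alpha> \<gamma> + h \<gamma>))"
proof -
  let ?q = "\<lambda>\<gamma>. \<Sum>g\<in>\<Gamma>. w \<gamma> g * cnj (sgn (\<alpha> g))"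
  have split: "(\<Sum>\<gamma>\<in>J. f \<gamma>) = (\<Sum>\<gamma>\<in>J - \<Gamma>. f \<gamma>) + (\<Sum>\<gamma>\<in>\<Gamma>. f \<gamma>)" for f :: "'g \<Rightarrow> real"
    by (rule sum.subset_diff[OF sub finite_J])
  have hg: "h g = - (\<Sum>\<gamma>\<in>J - \<Gamma>. h \<gamma> * w \<gamma> g)" if "g \<in> \<Gamma>" for g
    using kernel_on_support[OF w ker that] .
  obtain \<gamma>0 where \<gamma>0: "\<gamma>0 \<in> J - \<Gamma>" "h \<gamma>0 \<noteq> 0"
  proof (rule ccontr)
    assume "\<not> thesis"
    then have "\<forall>\<gamma>\<in>J - \<Gamma>. h \<gamma> = 0" using that by blast
    moreover from this have "h \<gamma> = 0" if "\<gamma> \<in> \<Gamma>" for \<gamma>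
      unfolding hg[OF that] by simp
    ultimately have "\<forall>\<gamma>\<in>J. h \<gamma> = 0" by blast
    then show False using nz by blast
  qed
  have "(\<Sum>g\<in>\<Gamma>. h g * cnj (sgn (\<alpha> g)))
      = (\<Sum>g\<in>\<Gamma>. - (\<Sum>\<gamma>\<in>J - \<Gamma>. h \<gamma> * w \<gamma> g) * cnj (sgn (\<alpha> g)))"
    by (intro sum.cong refl arg_cong2[where f = "(*)"] hg)
  also have "\<dots> = - (\<Sum>\<gamma>\<in>J - \<Gamma>. h \<gamma> * ?q \<gamma>)"
    by (simp add: sum_distrib_left sum_distrib_right mult.assoc sum_negf sum.swap[of _ \<Gamma> "J - \<Gamma>"])
  finally have "- Re (\<Sum>g\<in>\<Gamma>. h g * cnj (sgn (\<alpha> g))) = Re (\<Sum>\<gamma>\<in>J - \<Gamma>. h \<gamma> * ?q \<gamma>)"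
    by simp
  then have "- (\<Sum>g\<in>\<Gamma>. Re (h g * cnj (sgn (\<alpha> g)))) = Re (\<Sum>\<gamma>\<in>J - \<Gamma>. h \<gamma> * ?q \<gamma>)"
    unfolding Re_sum .
  also have "\<dots> \<le> cmod (\<Sum>\<gamma>\<in>J - \<Gamma>. h \<gamma> * ?q \<gamma>)" by (rule complex_Re_le_cmod)
  also have "\<dots> \<le> (\<Sum>\<gamma>\<in>J - \<Gamma>. cmod (h \<gamma>) * cmod (?q \<gamma>))"
    by (intro sum_norm_le) (simp add: norm_mult)
  also have "\<dots> < (\<Sum>\<gamma>\<in>J - \<Gamma>. cmod (h \<gamma>))"
  proof (rule sum_strict_mono_ex1)
    show "\<forall>\<gamma>\<in>J - \<Gamma>. cmod (h \<gamma>) * cmod (?q \<gamma>) \<le> cmod (h \<gamma>)"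
      using dual by (auto intro!: mult_left_le simp: less_imp_le)
    show "\<exists>\<gamma>\<in>J - \<Gamma>. cmod (h \<gamma>) * cmod (?q \<gamma>) < cmod (h \<gamma>)"
      using dual[OF \<gamma>0(1)] \<gamma>0 by (intro bexI[of _ \<gamma>0]) auto
  qed (use finite_J in simp)
  finally have "(\<Sum>g\<in>\<Gamma>. cmod (\<alpha> g))
      < (\<Sum>\<gamma>\<in>J - \<Gamma>. cmod (h \<gamma>)) + (\<Sum>g\<in>\<Gamma>. cmod (\<alpha> g) + Re (h g * cnj (sgn (\<alpha> g))))"
    by (simp add: sum.distrib del: times_complex.sel)
  also have "\<dots> \<le> (\<Sum>\<gamma>\<in>J - \<Gamma>. cmod (\<alpha> \<gamma> + h \<gamma>)) + (\<Sum>g\<in>\<Gamma>. cmod (\<alpha> g + h g))"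
    using supp by (intro add_mono sum_mono norm_add_ge_sgn) auto
  finally show ?thesis unfolding split using supp by simp
qed

text \<open>
  Otherwise every column of \<open>\<Gamma>\<close> equals its projection onto the span of \<open>\<Gamma>'\<close>. If \<open>\<Gamma>' \<subseteq> \<Gamma>\<close>, independence of
  the columns of \<open>\<Gamma>\<close> gives \<open>|\<Gamma>| \<le> |\<Gamma>'|\<close> and thus \<open>\<Gamma>' = \<Gamma>\<close>. If \<open>\<Gamma>'\<close> has an element \<open>\<gamma>\<close> outside \<open>\<Gamma>\<close>, almost
  orthogonality makes \<open>\<phi> \<gamma>\<close> independent of the columns of \<open>\<Gamma>\<close>, so \<open>|\<Gamma>| + 1\<close> independent vectors lie in a
  span of \<open>|\<Gamma>'| \<le> |\<Gamma>|\<close> vectors.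
\<close>

lemma separating_functional:
  assumes sub': "\<Gamma>' \<subseteq> J" and ne: "\<Gamma>' \<noteq> \<Gamma>" and card: "card \<Gamma>' \<le> card \<Gamma>"
  shows "\<exists>y. (\<forall>g\<in>\<Gamma>'. ip R (\<phi> g) y = 0) \<and> (\<exists>g\<in>\<Gamma>. ip R (\<phi> g) y \<noteq> 0)"
proof (rule ccontr)
  assume "\<not> ?thesis"
  then have no: "ip R (\<phi> g) y = 0" if "g \<in> \<Gamma>" "\<And>g. g \<in> \<Gamma>' \<Longrightarrow> ip R (\<phi> g) y = 0" for g y
    using that by blast
  have fin': "finite \<Gamma>'" using sub' finite_J finite_subset by blast
  \<comment> \<open>Columns are compared as functions, so their values outside \<open>R\<close> are fixed to be zero.\<close>
  define \<psi> where "\<psi> g = (\<lambda>r. if r \<in> R then \<phi> g r else 0)" for g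
  have synth_\<psi>: "(\<Sum>g\<in>G. (\<lambda>r. x g * \<psi> g r)) = (\<lambda>r. if r \<in> R then synth \<phi> G x r else 0)" for G x
    by (auto simp: cfun_sum_apply synth_def \<psi>_def)
  have in_span: "\<psi> g \<in> cfun.span (\<psi> ` \<Gamma>')" if g: "g \<in> \<Gamma>" for g
  proof -
    obtain w where w: "\<And>h. h \<in> \<Gamma>' \<Longrightarrow> ip R (\<lambda>r. \<phi> g r - synth \<phi> \<Gamma>' w r) (\<phi> h) = 0"
      using orthogonal_projection_exists[OF finite_R fin'] by blast
    let ?e = "\<lambda>r. \<phi> g r - synth \<phi> \<Gamma>' w r"
    have w': "ip R (\<phi> h) ?e = 0" if "h \<in> \<Gamma>'" for h
      using w[OF that] by (subst ip_commute) simp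
    have "ip R ?e ?e = 0"
      unfolding ip_diff_left[of R "\<phi> g"] using no[OF g w'] by (simp add: ip_synth_left w')
    then have "\<psi> g = (\<Sum>h\<in>\<Gamma>'. (\<lambda>r. w h * \<psi> h r))"
      unfolding synth_\<psi> ip_zero_iff[OF finite_R] by (auto simp: \<psi>_def)
    also have "\<dots> \<in> cfun.span (\<psi> ` \<Gamma>')"
      by (intro cfun.span_sum cfun.span_scale cfun.span_base imageI)
    finally show ?thesis .
  qed
  have inj: "inj_on \<psi> \<Gamma>"
  proof (rule inj_onI, rule ccontr)
    fix g h assume gh: "g \<in> \<Gamma>" "h \<in> \<Gamma>" "\<psi> g = \<psi> h" "g \<noteq> h"
    let ?x = "\<lambda>k. if k = g then 1 else if k = h then - 1 else 0 :: complex"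
    have "synth \<phi> \<Gamma> ?x r = 0" if "r \<in> R" for r
    proof -
      have "synth \<phi> \<Gamma> ?x r = (\<Sum>k\<in>{g, h}. ?x k * \<phi> k r)"
        unfolding synth_def using gh finite_\<Gamma> by (intro sum.mono_neutral_right) auto
      also have "\<dots> = 0" using fun_cong[OF gh(3), of r] that gh(4) by (simp add: \<psi>_def)
      finally show ?thesis .
    qed
    from synth_injective[OF this gh(1)] show False by simp
  qed
  have indep: "cfun.independent (\<psi> ` \<Gamma>)"
  proof (rule cfun.independent_if_scalars_zero)
    fix f x assume f: "(\<Sum>x\<in>\<psi> ` \<Gamma>. (\<lambda>r. f x * x r)) = 0" and x: "x \<in> \<psi> ` \<Gamma>"
    then obtain g where g: "g \<in> \<Gamma>" "x = \<psi> g" by blast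
    have "(\<Sum>g\<in>\<Gamma>. (\<lambda>r. f (\<psi> g) * \<psi> g r)) = 0"
      using f by (simp add: sum.reindex[OF inj])
    then have "synth \<phi> \<Gamma> (\<lambda>g. f (\<psi> g)) r = 0" if "r \<in> R" for r
      unfolding synth_\<psi> using that by (auto simp: fun_eq_iff split: if_splits)
    then show "f x = 0" using synth_injective g by blast
  qed (simp add: finite_\<Gamma>)
  have card_im: "card (\<psi> ` \<Gamma>') \<le> card \<Gamma>'" using fin' by (rule card_image_le)
  show False
  proof (cases "\<Gamma>' \<subseteq> \<Gamma>")
    case True
    have "card (\<psi> ` \<Gamma>) \<le> card (\<psi> ` \<Gamma>')"
      by (rule conjunct2[OF cfun.independent_span_bound[OF _ indep]]) (use in_span fin' in auto)
    then have "card \<Gamma> \<le> card \<Gamma>'" using card_im by (simp add: card_image[OF inj])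
    then show False using card_seteq[OF finite_\<Gamma> True] ne by blast
  next
    case False
    then obtain \<gamma> where \<gamma>: "\<gamma> \<in> \<Gamma>'" "\<gamma> \<in> J - \<Gamma>" using sub' by blast
    have notin: "\<psi> \<gamma> \<notin> cfun.span (\<psi> ` \<Gamma>)"
    proof
      assume "\<psi> \<gamma> \<in> cfun.span (\<psi> ` \<Gamma>)"
      then obtain f where "\<psi> \<gamma> = (\<Sum>x\<in>\<psi> ` \<Gamma>. (\<lambda>r. f x * x r))"
        using cfun.span_finite[of "\<psi> ` \<Gamma>"] finite_\<Gamma> by auto
      then have eq: "\<psi> \<gamma> = (\<lambda>r. if r \<in> R then synth \<phi> \<Gamma> (\<lambda>g. f (\<psi> g)) r else 0)"
        by (simp add: sum.reindex[OF inj] synth_\<psi>[symmetric])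
      let ?s = "synth \<phi> \<Gamma> (\<lambda>g. f (\<psi> g))"
      have s: "\<phi> \<gamma> r = ?s r" if "r \<in> R" for r
        using fun_cong[OF eq, of r] that by (simp add: \<psi>_def)
      have "ip R ?s ?s = 1" "ip R (\<phi> \<gamma>) ?s = 1"
        using unit[OF \<gamma>(2)] s by (simp_all add: ip_def)
      then have "1 \<le> (\<Sum>g\<in>\<Gamma>. (cmod (f (\<psi> g)))\<^sup>2) * \<eta>" "(\<Sum>g\<in>\<Gamma>. (cmod (f (\<psi> g)))\<^sup>2) \<le> 2"
        using cross_bound[OF \<gamma>(2), of "\<lambda>g. f (\<psi> g)"] coercive[of "\<lambda>g. f (\<psi> g)"] by simp_all
      moreover have "0 \<le> \<eta>" using order_trans[OF sum_nonneg cross[OF \<gamma>(2)]] by simp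
      ultimately have "1 \<le> 2 * \<eta>"
        using mult_right_mono[of "\<Sum>g\<in>\<Gamma>. (cmod (f (\<psi> g)))\<^sup>2" 2 \<eta>] by linarith
      then show False using \<eta>_less by simp
    qed
    have ins: "insert (\<psi> \<gamma>) (\<psi> ` \<Gamma>) \<subseteq> cfun.span (\<psi> ` \<Gamma>')"
      using in_span cfun.span_base[OF imageI[OF \<gamma>(1)]] by auto
    have "card (insert (\<psi> \<gamma>) (\<psi> ` \<Gamma>)) \<le> card (\<psi> ` \<Gamma>')"
      by (rule conjunct2[OF cfun.independent_span_bound[OF finite_imageI[OF fin']
            cfun.independent_insertI[OF notin indep] ins]])
    moreover have "\<psi> \<gamma> \<notin> \<psi> ` \<Gamma>" using notin by (auto intro: cfun.span_base)
    then have "card (insert (\<psi> \<gamma>) (\<psi> ` \<Gamma>)) = Suc (card \<Gamma>)"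
      using finite_\<Gamma> card_image[OF inj] by (metis card_insert_disjoint finite_imageI)
    ultimately have "Suc (card \<Gamma>) \<le> card \<Gamma>'" using card_im by linarith
    then show False using card by simp
  qed
qed

text \<open>
  A competitor supported on \<open>\<Gamma>\<close> itself is excluded by injectivity, one supported on another small set
  \<open>\<Gamma>'\<close> by the functional \<open>y \<Gamma>'\<close>, which annihilates the competitor but not \<open>\<alpha>\<close>.
\<close>

lemma l0_recovery:
  assumes orth: "\<And>\<Gamma>' g. \<Gamma>' \<subseteq> J \<Longrightarrow> \<Gamma>' \<noteq> \<Gamma> \<Longrightarrow> card \<Gamma>' \<le> card \<Gamma> \<Longrightarrow> g \<in> \<Gamma>' \<Longrightarrow> ip R (\<phi> g) (y \<Gamma>') = 0"
    and generic: "\<And>\<Gamma>'. \<Gamma>' \<subseteq> J \<Longrightarrow> \<Gamma>' \<noteq> \<Gamma> \<Longrightarrow> card \<Gamma>' \<le> card \<Gamma> \<Longrightarrow>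
      (\<Sum>g\<in>\<Gamma>. \<alpha> g * ip R (\<phi> g) (y \<Gamma>')) \<noteq> 0"
    and supp: "\<And>\<gamma>. \<gamma> \<in> J - \<Gamma> \<Longrightarrow> \<alpha> \<gamma> = 0"
    and ker: "\<And>r. r \<in> R \<Longrightarrow> synth \<phi> J h r = 0" and nz: "\<exists>\<gamma>\<in>J. h \<gamma> \<noteq> 0"
  shows "card {\<gamma>\<in>J. \<alpha> \<gamma> \<noteq> 0} < card {\<gamma>\<in>J. \<alpha> \<gamma> + h \<gamma> \<noteq> 0}"
proof (rule ccontr)
  define \<Gamma>' where "\<Gamma>' = {\<gamma>\<in>J. \<alpha> \<gamma> + h \<gamma> \<noteq> 0}"
  assume "\<not> ?thesis"
  then have "card \<Gamma>' \<le> card {\<gamma>\<in>J. \<alpha> \<gamma> \<noteq> 0}" by (simp add: \<Gamma>'_def)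
  also have "\<dots> \<le> card \<Gamma>" using supp by (intro card_mono finite_\<Gamma>) auto
  finally have card: "card \<Gamma>' \<le> card \<Gamma>" .
  have sub': "\<Gamma>' \<subseteq> J" by (auto simp: \<Gamma>'_def)
  have \<alpha>_sum: "(\<Sum>\<gamma>\<in>J. \<alpha> \<gamma> * f \<gamma>) = (\<Sum>\<gamma>\<in>\<Gamma>. \<alpha> \<gamma> * f \<gamma>)" for f
    using supp sub finite_J by (intro sum.mono_neutral_right) auto
  show False
  proof (cases "\<Gamma>' = \<Gamma>")
    case True
    have h0: "h \<gamma> = 0" if "\<gamma> \<in> J - \<Gamma>" for \<gamma>
    proof -
      have "\<gamma> \<notin> \<Gamma>'" using that True by blast
      then show ?thesis using that supp[OF that] by (simp add: \<Gamma>'_def)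
    qed
    have "synth \<phi> \<Gamma> h r = 0" if "r \<in> R" for r
    proof -
      have "synth \<phi> J h r = synth \<phi> \<Gamma> h r"
        unfolding synth_def using h0 sub finite_J by (intro sum.mono_neutral_right) auto
      then show ?thesis using ker[OF that] by simp
    qed
    then have "\<forall>\<gamma>\<in>\<Gamma>. h \<gamma> = 0" using synth_injective by blast
    then show False using h0 nz by blast
  next
    case False
    have "ip R (synth \<phi> J (\<lambda>\<gamma>. \<alpha> \<gamma> + h \<gamma>)) (y \<Gamma>') = 0"
      unfolding ip_synth_left
    proof (intro sum.neutral ballI)
      fix g assume "g \<in> J"
      then show "(\<alpha> g + h g) * ip R (\<phi> g) (y \<Gamma>') = 0"
        using orth[OF sub' False card, of g] by (cases "g \<in> \<Gamma>'") (auto simp: \<Gamma>'_def)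
    qed
    moreover have "ip R (synth \<phi> J h) (y \<Gamma>') = 0" using ker by (simp add: ip_def)
    ultimately have "(\<Sum>g\<in>\<Gamma>. \<alpha> g * ip R (\<phi> g) (y \<Gamma>')) = 0"
      by (simp add: ip_synth_left distrib_right sum.distrib \<alpha>_sum)
    then show False using generic[OF sub' False card] by contradiction
  qed
qed

end

section \<open>Two orthonormal bases\<close>

text \<open>
  The columns \<open>\<phi> 0, \<dots>, \<phi> (N - 1)\<close> form the first basis and \<open>\<phi> N, \<dots>, \<phi> (2 N - 1)\<close> the second.
\<close>

locale orthonormal_pair =
  fixes N :: nat and \<phi> :: "nat \<Rightarrow> nat \<Rightarrow> complex" and \<mu> :: real
  assumes orthonormal: "\<And>i j. i < N \<Longrightarrow> j < N \<Longrightarrow> ip {..<N} (\<phi> i) (\<phi> j) = (if i = j then 1 else 0)"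
      "\<And>i j. i < N \<Longrightarrow> j < N \<Longrightarrow> ip {..<N} (\<phi> (N + i)) (\<phi> (N + j)) = (if i = j then 1 else 0)"
    and complete: "\<And>r s. r < N \<Longrightarrow> s < N \<Longrightarrow> (\<Sum>j<N. \<phi> (N + j) r * cnj (\<phi> (N + j) s)) = (if r = s then 1 else 0)"
    and coherence: "\<And>i j. i < N \<Longrightarrow> j < N \<Longrightarrow> cmod (ip {..<N} (\<phi> i) (\<phi> (N + j))) \<le> \<mu>"
begin

lemma second_basis_parseval: "(\<Sum>j<N. ip {..<N} x (\<phi> (N + j)) * ip {..<N} (\<phi> (N + j)) y) = ip {..<N} x y"
proof -
  interpret parseval_frame "{..<N}" "{..<N}" "\<lambda>j. \<phi> (N + j)"
    by unfold_locales (simp_all add: complete)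
  show ?thesis by (rule parseval)
qed

lemma coherence_sq: "i < N \<Longrightarrow> j < N \<Longrightarrow> (cmod (ip {..<N} (\<phi> i) (\<phi> (N + j))))\<^sup>2 \<le> \<mu>\<^sup>2"
  using coherence by (intro power_mono) auto

lemma coherence_sq': "i < N \<Longrightarrow> j < N \<Longrightarrow> (cmod (ip {..<N} (\<phi> (N + j)) (\<phi> i)))\<^sup>2 \<le> \<mu>\<^sup>2"
  using coherence_sq[of i j] by (subst ip_commute) simp

text \<open>
  Parseval's identity for a unit vector of the first basis, expanded in the second. It turns the bound on
  \<open>\<mu>\<^sup>2 N p\<close> into a bound on the sampling rate \<open>p\<close> itself.
\<close>

lemma coherence_lower_bound:
  assumes "0 < N" shows "1 \<le> real N * \<mu>\<^sup>2"
proof -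
  have "complex_of_real 1 = (\<Sum>j<N. ip {..<N} (\<phi> 0) (\<phi> (N + j)) * ip {..<N} (\<phi> (N + j)) (\<phi> 0))"
    unfolding second_basis_parseval using orthonormal(1)[of 0 0] assms by simp
  also have "\<dots> = of_real (\<Sum>j<N. (cmod (ip {..<N} (\<phi> 0) (\<phi> (N + j))))\<^sup>2)"
    unfolding ip_mult_commute by (simp only: of_real_sum)
  finally have "1 = (\<Sum>j<N. (cmod (ip {..<N} (\<phi> 0) (\<phi> (N + j))))\<^sup>2)" unfolding of_real_eq_iff .
  also have "\<dots> \<le> (\<Sum>j<N. \<mu>\<^sup>2)" using assms by (intro sum_mono coherence_sq) auto
  finally show ?thesis by simp
qed

text \<open>
  The columns of the unitary change-of-basis matrix, restricted to the rows in \<open>T\<close>, still resolve the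
  identity of \<open>\<complex>\<^sup>T\<close>.
\<close>

lemma cross_gram_frame:
  assumes "T \<subseteq> {..<N}"
  shows "parseval_frame T {..<N} (\<lambda>j i. ip {..<N} (\<phi> (N + j)) (\<phi> i))"
proof unfold_locales
  fix i k assume "i \<in> T" "k \<in> T"
  then have ik: "i < N" "k < N" using assms by auto
  have "(\<Sum>j<N. ip {..<N} (\<phi> (N + j)) (\<phi> i) * cnj (ip {..<N} (\<phi> (N + j)) (\<phi> k)))
      = (\<Sum>j<N. ip {..<N} (\<phi> k) (\<phi> (N + j)) * ip {..<N} (\<phi> (N + j)) (\<phi> i))"
    by (intro sum.cong refl) (simp only: ip_commute[symmetric] mult.commute)
  also have "\<dots> = (if k = i then 1 else 0)"
    unfolding second_basis_parseval using orthonormal(1)[OF ik(2,1)] .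
  finally show "(\<Sum>j<N. ip {..<N} (\<phi> (N + j)) (\<phi> i) * cnj (ip {..<N} (\<phi> (N + j)) (\<phi> k))) = (if i = k then 1 else 0)"
    by (simp only: eq_commute[of k i])
qed (use assms finite_subset in auto)

text \<open>
  The cross Gram matrix of the two parts of the support has operator norm at most \<open>1/2\<close>.
\<close>

definition small_cross_gram :: "nat set \<Rightarrow> nat set \<Rightarrow> bool" where
  "small_cross_gram G1 G2 \<longleftrightarrow> (\<forall>x. (\<Sum>j\<in>G2. (cmod (ip G1 x (\<lambda>i. ip {..<N} (\<phi> (N + j)) (\<phi> i))))\<^sup>2)
    \<le> 1 / 4 * (\<Sum>i\<in>G1. (cmod (x i))\<^sup>2))"

text \<open>
  Within each basis the columns are orthonormal, so only the cross term disturbs Parseval's identity, and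
  it is at most \<open>\<parallel>x\<^sub>1\<parallel> \<parallel>x\<^sub>2\<parallel> / 2 \<le> \<parallel>x\<parallel>\<^sup>2 / 4\<close>.
\<close>

lemma joint_support_coercive:
  assumes G: "G1 \<subseteq> {..<N}" "G2 \<subseteq> {..<N}" and small: "small_cross_gram G1 G2"
  shows "(\<Sum>g\<in>joint_support N G1 G2. (cmod (x g))\<^sup>2)
    \<le> 2 * Re (ip {..<N} (synth \<phi> (joint_support N G1 G2) x) (synth \<phi> (joint_support N G1 G2) x))"
proof -
  have fin: "finite G1" "finite G2" using G finite_subset by auto
  have disj: "G1 \<inter> (\<lambda>j. N + j) ` G2 = {}" using G(1) by auto
  have lt: "\<And>i. i \<in> G1 \<Longrightarrow> i < N" "\<And>j. j \<in> G2 \<Longrightarrow> j < N" using G by auto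
  define y where "y j = x (N + j)" for j
  let ?P = "synth \<phi> G1 x" and ?Q = "synth (\<lambda>j. \<phi> (N + j)) G2 y"
  define A where "A = (\<Sum>i\<in>G1. (cmod (x i))\<^sup>2)"
  define B where "B = (\<Sum>j\<in>G2. (cmod (y j))\<^sup>2)"
  have AB: "0 \<le> A" "0 \<le> B" by (simp_all add: A_def B_def sum_nonneg)
  have split: "(\<Sum>g\<in>joint_support N G1 G2. f g) = (\<Sum>g\<in>G1. f g) + (\<Sum>j\<in>G2. f (N + j))"
    for f :: "nat \<Rightarrow> 'z :: comm_monoid_add"
    unfolding joint_support_def by (simp add: sum.union_disjoint fin disj sum.reindex)
  have synth_eq: "synth \<phi> (joint_support N G1 G2) x = (\<lambda>r. ?P r + ?Q r)"
    unfolding synth_def split by (simp add: y_def)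
  have PP: "ip {..<N} ?P ?P = of_real A"
    unfolding A_def using fin lt orthonormal(1) by (intro synth_orthonormal) auto
  have QQ: "ip {..<N} ?Q ?Q = of_real B"
    unfolding B_def using fin lt orthonormal(2) by (intro synth_orthonormal) auto
  have PQ: "ip {..<N} ?P ?Q = (\<Sum>j\<in>G2. cnj (y j) * ip G1 x (\<lambda>i. ip {..<N} (\<phi> (N + j)) (\<phi> i)))"
    unfolding ip_synth_right
    by (intro sum.cong refl arg_cong2[where f = "(*)"])
      (simp add: ip_synth_left ip_def[of G1] ip_commute[of "{..<N}" "\<phi> (N + _)"])
  have "(cmod (ip {..<N} ?P ?Q))\<^sup>2
      \<le> (\<Sum>j\<in>G2. (cmod (cnj (y j)))\<^sup>2) * (\<Sum>j\<in>G2. (cmod (ip G1 x (\<lambda>i. ip {..<N} (\<phi> (N + j)) (\<phi> i))))\<^sup>2)"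
    unfolding PQ by (rule complex_Cauchy_Schwarz_sum)
  also have "\<dots> = B * (\<Sum>j\<in>G2. (cmod (ip G1 x (\<lambda>i. ip {..<N} (\<phi> (N + j)) (\<phi> i))))\<^sup>2)"
    by (simp add: B_def)
  also have "\<dots> \<le> B * (1 / 4 * A)"
    using small[unfolded small_cross_gram_def, rule_format, of x] AB(2)
    unfolding A_def by (rule mult_left_mono)
  also have "\<dots> \<le> (1 / 4 * (A + B))\<^sup>2"
    using zero_le_power2[of "A - B"] by (simp add: power2_eq_square algebra_simps)
  finally have "cmod (ip {..<N} ?P ?Q) \<le> 1 / 4 * (A + B)"
    by (rule power2_le_imp_le) (use AB in simp)
  then have cross: "- (1 / 4 * (A + B)) \<le> Re (ip {..<N} ?P ?Q)"
    using abs_Re_le_cmod[of "ip {..<N} ?P ?Q"] by linarith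
  define C where "C = Re (ip {..<N} ?P ?Q)"
  have form: "Re (ip {..<N} (\<lambda>r. ?P r + ?Q r) (\<lambda>r. ?P r + ?Q r)) = A + 2 * C + B"
    by (simp add: C_def ip_add_left ip_add_right PP QQ ip_commute[of "{..<N}" ?Q ?P])
  have coeffs: "(\<Sum>g\<in>joint_support N G1 G2. (cmod (x g))\<^sup>2) = A + B"
    by (simp add: split A_def B_def y_def)
  show ?thesis
    unfolding synth_eq form coeffs using cross[folded C_def] by (simp add: field_simps)
qed

text \<open>
  A column outside the support is orthogonal to the chosen columns of its own basis, and meets each
  chosen column of the other basis in an inner product of modulus at most \<open>\<mu>\<close>.
\<close>

lemma joint_support_separated:
  assumes G: "G1 \<subseteq> {..<N}" "G2 \<subseteq> {..<N}" and small: "small_cross_gram G1 G2"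
    and card: "\<mu>\<^sup>2 * real (card G1) \<le> \<eta>" "\<mu>\<^sup>2 * real (card G2) \<le> \<eta>" and \<eta>: "\<eta> < 1 / 2"
  shows "separated_support {..<N} {..<2 * N} (joint_support N G1 G2) \<phi> \<eta>"
proof unfold_locales
  show "joint_support N G1 G2 \<subseteq> {..<2 * N}" using G by (auto simp: joint_support_def)
  have fin: "finite G1" "finite G2" using G finite_subset by auto
  have disj: "G1 \<inter> (\<lambda>j. N + j) ` G2 = {}" using G(1) by auto
  have lt: "\<And>i. i \<in> G1 \<Longrightarrow> i < N" "\<And>j. j \<in> G2 \<Longrightarrow> j < N" using G by auto
  fix \<gamma> assume \<gamma>: "\<gamma> \<in> {..<2 * N} - joint_support N G1 G2"
  let ?f = "\<lambda>g. (cmod (ip {..<N} (\<phi> \<gamma>) (\<phi> g)))\<^sup>2"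
  have split: "(\<Sum>g\<in>joint_support N G1 G2. ?f g) = (\<Sum>g\<in>G1. ?f g) + (\<Sum>j\<in>G2. ?f (N + j))"
    unfolding joint_support_def by (simp add: sum.union_disjoint fin disj sum.reindex)
  show "(\<Sum>g\<in>joint_support N G1 G2. ?f g) \<le> \<eta>"
  proof (cases "\<gamma> < N")
    case True
    have "(\<Sum>g\<in>G1. ?f g) = 0"
      using True \<gamma> lt orthonormal(1) by (intro sum.neutral ballI) (auto simp: joint_support_def)
    moreover have "(\<Sum>j\<in>G2. ?f (N + j)) \<le> (\<Sum>j\<in>G2. \<mu>\<^sup>2)"
      using True lt by (intro sum_mono coherence_sq) auto
    ultimately show ?thesis unfolding split using card by (simp add: mult.commute)
  next
    case False
    define k where "k = \<gamma> - N"
    have k: "\<gamma> = N + k" using False by (simp add: k_def)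
    moreover have "k < N" "k \<notin> G2" using \<gamma> unfolding k by (auto simp: joint_support_def)
    ultimately have k: "\<gamma> = N + k" "k < N" "k \<notin> G2" by blast+
    have "(\<Sum>j\<in>G2. ?f (N + j)) = 0"
      unfolding k(1) using k(2,3) lt orthonormal(2) by (intro sum.neutral ballI) auto
    moreover have "(\<Sum>i\<in>G1. ?f i) \<le> (\<Sum>i\<in>G1. \<mu>\<^sup>2)"
      unfolding k(1) using k(2) lt by (intro sum_mono coherence_sq') auto
    ultimately show ?thesis unfolding split using card by (simp add: mult.commute)
  qed
  show "ip {..<N} (\<phi> \<gamma>) (\<phi> \<gamma>) = 1"
  proof (cases "\<gamma> < N")
    case False
    define k where "k = \<gamma> - N"
    have "\<gamma> < 2 * N" using \<gamma> by simp
    then have "\<gamma> = N + k" "k < N" using False unfolding k_def by linarith+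
    then show ?thesis using orthonormal(2)[of k k] by simp
  qed (simp add: orthonormal(1))
next
  fix x show "(\<Sum>g\<in>joint_support N G1 G2. (cmod (x g))\<^sup>2)
    \<le> 2 * Re (ip {..<N} (synth \<phi> (joint_support N G1 G2) x) (synth \<phi> (joint_support N G1 G2) x))"
    by (rule joint_support_coercive[OF G small])
qed (use \<eta> in simp_all)

lemma cross_gram_tail:
  assumes p: "0 \<le> p" "p \<le> 1" and T: "T \<subseteq> {..<N}"
    and n: "real (Suc n) * (\<mu>\<^sup>2 * real (card T)) \<le> 1 / 12" and small: "exp 1 * p \<le> 1 / 12"
  shows "measure_pmf.prob (bernoulli_subset N p) {S. \<not> small_cross_gram T S} \<le> real N * (1 / 3) ^ Suc n"
proof -
  let ?v = "\<lambda>j i. ip {..<N} (\<phi> (N + j)) (\<phi> i)"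
  have "measure_pmf.prob (bernoulli_subset N p) {S. \<not> small_cross_gram T S}
      \<le> real (card T) * ((1 / 12) / (1 / 4)) ^ Suc n"
    unfolding small_cross_gram_def
  proof (rule bernoulli_sampled_form_tail[OF cross_gram_frame[OF T] p, where \<rho> = "\<mu>\<^sup>2 * real (card T)"])
    fix j assume j: "j < N"
    have "Re (ip T (?v j) (?v j)) = (\<Sum>i\<in>T. (cmod (?v j i))\<^sup>2)" by (simp add: ip_self)
    also have "\<dots> \<le> (\<Sum>i\<in>T. \<mu>\<^sup>2)" using T j by (intro sum_mono coherence_sq') auto
    finally show "Re (ip T (?v j) (?v j)) \<le> \<mu>\<^sup>2 * real (card T)" by (simp add: mult.commute)
  next
    show "real (Suc n) * (\<mu>\<^sup>2 * real (card T)) \<le> 1 / 12" by (rule n)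
  next
    show "exp 1 * p \<le> 1 / 12" by (rule small)
  qed simp_all
  also have "\<dots> \<le> real N * (1 / 3) ^ Suc n"
    using card_mono[OF _ T] by (intro mult_mono) auto
  finally show ?thesis .
qed

end

section \<open>Random phases and generic coefficients\<close>

text \<open>
  The coordinate maps jointly have the product measure as their law, which characterises independence.
\<close>

lemma indep_vars_PiM_coordinates:
  assumes "finite I" "I \<noteq> {}" and prob: "\<And>i. i \<in> I \<Longrightarrow> prob_space (M i)"
  shows "prob_space.indep_vars (PiM I M) M (\<lambda>i z. z i) I"
proof -
  interpret P: prob_space "PiM I M" by (rule prob_space_PiM) (rule prob)
  have "distr (PiM I M) (PiM I M) (\<lambda>z. \<lambda>i\<in>I. z i) = distr (PiM I M) (PiM I M) (\<lambda>z. z)"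
    by (intro distr_cong) (auto simp: space_PiM PiE_def extensional_restrict)
  also have "\<dots> = PiM I M" by (rule distr_id)
  also have "\<dots> = (\<Pi>\<^sub>M i\<in>I. distr (PiM I M) (M i) (\<lambda>z. z i))"
    using assms by (intro PiM_cong) (auto simp: distr_PiM_component)
  finally show ?thesis
    by (subst P.indep_vars_iff_distr_eq_PiM'[OF assms(2)]) auto
qed

lemma continuous_distribution_sets: "continuous_distribution D \<Longrightarrow> sets D = sets borel"
  by (auto simp: continuous_distribution_def)

lemma continuous_distribution_prob_space: "continuous_distribution D \<Longrightarrow> prob_space D"
  by (simp add: continuous_distribution_def)

lemma continuous_distribution_point_null:
  assumes "continuous_distribution D" shows "emeasure D {c} = 0"
proof -
  obtain g where g: "g \<in> borel_measurable lborel" "D = density lborel g"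
    using assms by (auto simp: continuous_distribution_def)
  have "emeasure D {c} = (\<integral>\<^sup>+ x. g x * indicator {c} x \<partial>lborel)"
    unfolding g(2) using g(1) by (intro emeasure_density) auto
  also have "\<dots> = 0" by (rule nn_integral_null_set) (auto simp: null_sets_def)
  finally show ?thesis .
qed

text \<open>
  Rotation by \<open>\<pi>\<close> preserves the law and changes the sign of an odd function.
\<close>

lemma circularly_symmetric_expectation_zero:
  fixes f :: "complex \<Rightarrow> real"
  assumes symm: "circularly_symmetric D" and D: "sets D = sets borel"
    and f: "f \<in> borel_measurable borel" and odd: "\<And>z. f (- z) = - f z"
  shows "(\<integral>z. f z \<partial>D) = 0"
proof -
  have [measurable_cong]: "sets D = sets borel" by (fact D)
  note f[measurable]
  have "(\<integral>z. f z \<partial>D) = (\<integral>z. f z \<partial>distr D borel (\<lambda>z. cis pi * z))"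
    by (simp only: symm[unfolded circularly_symmetric_def, rule_format, of pi])
  also have "\<dots> = (\<integral>z. f (cis pi * z) \<partial>D)" by (rule integral_distr) measurable
  also have "\<dots> = - (\<integral>z. f z \<partial>D)" by (simp add: odd)
  finally show ?thesis by simp
qed

lemma borel_measurable_cnj [measurable]: "cnj \<in> borel_measurable borel"
  by (intro borel_measurable_continuous_onI continuous_intros)

text \<open>
  Hoeffding's inequality for the summands \<open>Re (\<omega> w\<^sub>g cnj (sgn z\<^sub>g))\<close>, which are centred and lie in
  \<open>[- |w\<^sub>g|, |w\<^sub>g|]\<close>.
\<close>

lemma phase_sum_tail_real:
  assumes D: "prob_space D" "sets D = sets borel" "circularly_symmetric D"
    and fin: "finite G" and W: "(\<Sum>g\<in>G. (cmod (w g))\<^sup>2) \<le> W" "0 < W" and \<epsilon>: "0 < \<epsilon>"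
    and \<omega>: "cmod \<omega> = 1"
  shows "measure (\<Pi>\<^sub>M g\<in>G. D) {z \<in> space (\<Pi>\<^sub>M g\<in>G. D). \<epsilon> \<le> Re (\<omega> * (\<Sum>g\<in>G. w g * cnj (sgn (z g))))}
    \<le> exp (- \<epsilon>\<^sup>2 / (2 * W))"
proof (cases "(\<Sum>g\<in>G. (cmod (w g))\<^sup>2) = 0")
  case True
  then have "\<forall>g\<in>G. w g = 0" using fin by (simp add: sum_nonneg_eq_0_iff)
  then show ?thesis using \<epsilon> by simp
next
  case False
  have pos: "0 < (\<Sum>g\<in>G. (cmod (w g))\<^sup>2)" using False sum_nonneg[of G "\<lambda>g. (cmod (w g))\<^sup>2"] by auto
  have ne: "G \<noteq> {}" using pos by auto
  let ?M = "\<Pi>\<^sub>M g\<in>G. D"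
  define F where "F g u = Re (\<omega> * (w g * cnj (sgn u)))" for g and u :: complex
  have F_meas: "F g \<in> borel_measurable borel" for g
    unfolding F_def[abs_def] by measurable
  have F_D: "F g \<in> measurable D borel" for g
    using F_meas D(2) by (simp cong: measurable_cong_sets)
  have F_bound: "\<bar>F g u\<bar> \<le> cmod (w g)" for g u
  proof -
    have "\<bar>F g u\<bar> \<le> cmod (\<omega> * (w g * cnj (sgn u)))" unfolding F_def by (rule abs_Re_le_cmod)
    also have "\<dots> \<le> cmod (w g)" using \<omega> by (simp add: norm_mult norm_sgn)
    finally show ?thesis .
  qed
  interpret P: prob_space ?M by (rule prob_space_PiM) (rule D)
  have indep: "P.indep_vars (\<lambda>_. borel) (\<lambda>g z. F g (z g)) G"
    using P.indep_vars_compose2[OF indep_vars_PiM_coordinates[OF fin ne, of "\<lambda>_. D"], of F "\<lambda>_. borel"] D F_D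
    by simp
  have E0: "P.expectation (\<lambda>z. F g (z g)) = 0" if g: "g \<in> G" for g
  proof -
    have "P.expectation (\<lambda>z. F g (z g)) = (\<integral>u. F g u \<partial>distr ?M D (\<lambda>z. z g))"
      using g F_D by (intro integral_distr[symmetric]) auto
    also have "distr ?M D (\<lambda>z. z g) = D"
      using g D(1) by (intro distr_PiM_component) auto
    also have "(\<integral>u. F g u \<partial>D) = 0"
      by (rule circularly_symmetric_expectation_zero[OF D(3) D(2) F_meas]) (simp add: F_def sgn_minus)
    finally show ?thesis .
  qed
  interpret H: Hoeffding_ineq ?M G "\<lambda>g z. F g (z g)" "\<lambda>g. - cmod (w g)" "\<lambda>g. cmod (w g)" 0
  proof unfold_locales
    fix g
    have "F g u \<in> {- cmod (w g)..cmod (w g)}" for u using F_bound[of g u] by (simp add: abs_le_iff)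
    then show "AE z in ?M. F g (z g) \<in> {- cmod (w g)..cmod (w g)}" by (intro AE_I2)
  qed (use fin indep E0 in auto)
  have sq: "(\<Sum>g\<in>G. (cmod (w g) - - cmod (w g))\<^sup>2) = 4 * (\<Sum>g\<in>G. (cmod (w g))\<^sup>2)"
    by (simp add: sum_distrib_left power_mult_distrib flip: mult_2)
  have "measure ?M {z \<in> space ?M. \<epsilon> \<le> Re (\<omega> * (\<Sum>g\<in>G. w g * cnj (sgn (z g))))}
      = P.prob {z \<in> space ?M. (\<Sum>g\<in>G. F g (z g)) \<ge> 0 + \<epsilon>}"
    by (simp add: F_def sum_distrib_left del: times_complex.sel)
  also have "\<dots> \<le> exp (-2 * \<epsilon>\<^sup>2 / (4 * (\<Sum>g\<in>G. (cmod (w g))\<^sup>2)))"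
    using H.Hoeffding_ineq_ge[of \<epsilon>] \<epsilon> pos unfolding sq by simp
  also have "\<dots> \<le> exp (- \<epsilon>\<^sup>2 / (2 * W))"
    using pos W \<epsilon> by (simp add: field_simps)
  finally show ?thesis .
qed

text \<open>
  A complex number of modulus at least 1 has real part at least \<open>1/\<surd>2\<close> after multiplication with one of
  the four units \<open>\<plusminus> 1\<close>, \<open>\<plusminus> \<i>\<close>.
\<close>

lemma phase_sum_tail:
  assumes D: "prob_space D" "sets D = sets borel" "circularly_symmetric D"
    and fin: "finite G" and W: "(\<Sum>g\<in>G. (cmod (w g))\<^sup>2) \<le> W" "0 < W"
  shows "measure (\<Pi>\<^sub>M g\<in>G. D) {z \<in> space (\<Pi>\<^sub>M g\<in>G. D). 1 \<le> cmod (\<Sum>g\<in>G. w g * cnj (sgn (z g)))}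
    \<le> 4 * exp (- 1 / (4 * W))"
proof -
  let ?M = "\<Pi>\<^sub>M g\<in>G. D" and ?Y = "\<lambda>z. \<Sum>g\<in>G. w g * cnj (sgn (z g))"
  interpret P: prob_space ?M by (rule prob_space_PiM) (rule D)
  have [measurable_cong]: "sets D = sets borel" by (fact D(2))
  define A where "A \<omega> = {z \<in> space ?M. sqrt (1 / 2) \<le> Re (\<omega> * ?Y z)}" for \<omega>
  have A: "A \<omega> \<in> sets ?M" for \<omega> unfolding A_def by measurable
  have tail: "P.prob (A \<omega>) \<le> exp (- 1 / (4 * W))" if "cmod \<omega> = 1" for \<omega>
    using phase_sum_tail_real[OF D fin W _ that, of "sqrt (1 / 2)"] unfolding A_def by simp
  have "P.prob {z \<in> space ?M. 1 \<le> cmod (?Y z)} \<le> P.prob (\<Union>\<omega>\<in>{1, - 1, \<i>, - \<i>}. A \<omega>)"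
  proof (intro P.finite_measure_mono subsetI)
    fix z assume z: "z \<in> {z \<in> space ?M. 1 \<le> cmod (?Y z)}"
    define y where "y = ?Y z"
    have "1 \<le> cmod y" using z unfolding y_def by blast
    then have "1 \<le> (cmod y)\<^sup>2" by (rule one_le_power)
    then have "1 \<le> (Re y)\<^sup>2 + (Im y)\<^sup>2" by (simp add: cmod_power2)
    then have "1 / 2 \<le> (Re y)\<^sup>2 \<or> 1 / 2 \<le> (Im y)\<^sup>2" by linarith
    then have "sqrt (1 / 2) \<le> \<bar>Re y\<bar> \<or> sqrt (1 / 2) \<le> \<bar>Im y\<bar>"
      by (metis real_sqrt_abs real_sqrt_le_iff)
    then have "\<exists>\<omega>\<in>{1, - 1, \<i>, - \<i>}. sqrt (1 / 2) \<le> Re (\<omega> * y)" by auto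
    then show "z \<in> (\<Union>\<omega>\<in>{1, - 1, \<i>, - \<i>}. A \<omega>)" using z unfolding A_def y_def by blast
  qed (use A in auto)
  also have "\<dots> \<le> (\<Sum>\<omega>\<in>{1, - 1, \<i>, - \<i>}. P.prob (A \<omega>))"
    using A by (intro P.finite_measure_subadditive_finite) auto
  also have "\<dots> \<le> (\<Sum>\<omega>\<in>{1, - 1, \<i>, - \<i>}. exp (- 1 / (4 * W)))"
    by (intro sum_mono tail) auto
  also have "\<dots> \<le> 4 * exp (- 1 / (4 * W))"
    by (simp add: complex_eq_iff)
  finally show ?thesis .
qed

text \<open>
  With all coordinates but \<open>g\<close> fixed, the equation determines the coordinate \<open>g\<close>; Fubini's theorem
  reduces the claim to the absence of atoms.
\<close>

lemma hyperplane_null: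
  assumes D: "continuous_distribution D" and fin: "finite G" and g: "g \<in> G" "y g \<noteq> 0"
  shows "emeasure (\<Pi>\<^sub>M g\<in>G. D) {z \<in> space (\<Pi>\<^sub>M g\<in>G. D). (\<Sum>g\<in>G. z g * y g) = 0} = 0"
proof -
  have D_sets [measurable_cong]: "sets D = sets borel" using D by (rule continuous_distribution_sets)
  have D_space: "space D = UNIV" using sets_eq_imp_space_eq[OF D_sets] by simp
  interpret D: prob_space D using D by (simp add: continuous_distribution_def)
  interpret product_sigma_finite "\<lambda>_ :: 'a. D" by unfold_locales
  define G0 where "G0 = G - {g}"
  have G: "G = insert g G0" "finite G0" "g \<notin> G0" using g fin by (auto simp: G0_def)
  let ?H = "{z \<in> space (\<Pi>\<^sub>M g\<in>G. D). (\<Sum>g\<in>G. z g * y g) = 0}"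
  have H [measurable]: "?H \<in> sets (\<Pi>\<^sub>M g\<in>G. D)" by measurable
  have "emeasure (\<Pi>\<^sub>M g\<in>G. D) ?H = (\<integral>\<^sup>+ z. indicator ?H z \<partial>(\<Pi>\<^sub>M g\<in>G. D))"
    using H by simp
  also have "\<dots> = (\<integral>\<^sup>+ x. (\<integral>\<^sup>+ u. indicator ?H (x(g := u)) \<partial>D) \<partial>(\<Pi>\<^sub>M g\<in>G0. D))"
    unfolding G(1) using G H by (intro product_nn_integral_insert) auto
  also have "\<dots> \<le> (\<integral>\<^sup>+ x. (\<integral>\<^sup>+ u. indicator {- (\<Sum>h\<in>G0. x h * y h) / y g} u \<partial>D) \<partial>(\<Pi>\<^sub>M g\<in>G0. D))"
  proof (intro nn_integral_mono)
    fix x u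
    have "u = - (\<Sum>h\<in>G0. x h * y h) / y g" if "x(g := u) \<in> ?H"
    proof -
      have "(\<Sum>h\<in>G. (x(g := u)) h * y h) = u * y g + (\<Sum>h\<in>G0. x h * y h)"
        using G by (simp, intro sum.cong) auto
      then show ?thesis using that g(2) by (simp add: field_simps add_eq_0_iff)
    qed
    then show "indicator ?H (x(g := u)) \<le> (indicator {- (\<Sum>h\<in>G0. x h * y h) / y g} u :: ennreal)"
      by (auto simp: indicator_def)
  qed
  also have "\<dots> = 0"
    by (simp add: continuous_distribution_point_null[OF D] D_sets)
  finally show ?thesis by simp
qed

section \<open>The recovery event and its measurability\<close>

lemma (in second_countable_topology) countable_dense_subset:
  "\<exists>T \<subseteq> S. countable T \<and> (\<forall>U. open U \<longrightarrow> U \<inter> S \<noteq> {} \<longrightarrow> U \<inter> T \<noteq> {})"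
proof -
  obtain B where B: "countable B" "topological_basis B" by (metis ex_countable_basis)
  define pick where "pick b = (SOME x. x \<in> b \<inter> S)" for b
  define T where "T = pick ` {b \<in> B. b \<inter> S \<noteq> {}}"
  have pick: "pick b \<in> b \<inter> S" if "b \<inter> S \<noteq> {}" for b
    unfolding pick_def using that by (metis all_not_in_conv someI_ex)
  have "U \<inter> T \<noteq> {}" if U: "open U" "U \<inter> S \<noteq> {}" for U
  proof -
    obtain x where "x \<in> U" "x \<in> S" using U by blast
    moreover from this obtain b where "b \<in> B" "x \<in> b" "b \<subseteq> U"
      using topological_basisE[OF B(2) U(1)] by blast
    ultimately show ?thesis using pick[of b] by (auto simp: T_def)
  qed
  then show ?thesis using B(1) pick by (intro exI[of _ T]) (auto simp: T_def)
qed

text \<open>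
  An existential quantifier over an uncountable set does not preserve measurability in general. Over a
  compact set, a continuous function attains a value \<open>\<le> 0\<close> iff it takes values below every
  positive number, and these can be searched for in a countable dense subset.
\<close>

lemma measurable_ex_compact_le_zero:
  fixes F :: "'a \<Rightarrow> 'b :: second_countable_topology \<Rightarrow> real"
  assumes K: "compact K"
    and cont: "\<And>x. x \<in> space M \<Longrightarrow> continuous_on UNIV (F x)"
    and meas: "\<And>h. (\<lambda>x. F x h) \<in> borel_measurable M"
  shows "{x \<in> space M. \<exists>h\<in>K. F x h \<le> 0} \<in> sets M"
proof -
  obtain T where T: "T \<subseteq> K" "countable T"
    "\<And>U. open U \<Longrightarrow> U \<inter> K \<noteq> {} \<Longrightarrow> U \<inter> T \<noteq> {}"
    using countable_dense_subset[of K] by blast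
  have "(\<exists>h\<in>K. F x h \<le> 0) \<longleftrightarrow> (\<forall>n. \<exists>h\<in>T. F x h < inverse (real (Suc n)))" if x: "x \<in> space M" for x
  proof
    assume "\<exists>h\<in>K. F x h \<le> 0"
    then obtain h where h: "h \<in> K" "F x h \<le> 0" by blast
    show "\<forall>n. \<exists>h\<in>T. F x h < inverse (real (Suc n))"
    proof
      fix n
      have "open {h. F x h < inverse (real (Suc n))}"
        using cont[OF x] by (intro open_Collect_less continuous_intros)
      moreover have "h \<in> {h. F x h < inverse (real (Suc n))} \<inter> K"
        using h by (auto intro: le_less_trans)
      ultimately show "\<exists>h\<in>T. F x h < inverse (real (Suc n))" using T(3) by blast
    qed
  next
    assume *: "\<forall>n. \<exists>h\<in>T. F x h < inverse (real (Suc n))"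
    have "K \<noteq> {}" using * T(1) by blast
    then obtain h where h: "h \<in> K" "\<And>k. k \<in> K \<Longrightarrow> F x h \<le> F x k"
      using continuous_attains_inf[OF K, of "F x"] continuous_on_subset[OF cont[OF x]] by blast
    have "F x h \<le> inverse (real (Suc n))" for n
      using * h(2) T(1) by (meson less_eq_real_def order_trans subsetD)
    then have "F x h \<le> 0"
      using LIMSEQ_le_const[OF LIMSEQ_inverse_real_of_nat] by blast
    then show "\<exists>h\<in>K. F x h \<le> 0" using h by blast
  qed
  then have "{x \<in> space M. \<exists>h\<in>K. F x h \<le> 0}
      = {x \<in> space M. \<forall>n. \<exists>h\<in>T. F x h < inverse (real (Suc n))}" by blast
  also have "\<dots> \<in> sets M"
    using meas T(2) by measurable
  finally show ?thesis .
qed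

lemma compact_bounded_functions:
  fixes B :: "nat \<Rightarrow> real"
  shows "compact {h :: nat \<Rightarrow> complex. \<forall>i. cmod (h i) \<le> B i}"
proof -
  have "{h :: nat \<Rightarrow> complex. \<forall>i. cmod (h i) \<le> B i} = (\<Pi>\<^sub>E i\<in>UNIV. cball 0 (B i))"
    by (auto simp: PiE_def)
  moreover have "compactin (product_topology (\<lambda>i::nat. euclidean) UNIV) (\<Pi>\<^sub>E i\<in>UNIV. cball (0::complex) (B i))"
    by (simp add: compactin_PiE)
  ultimately show ?thesis by (simp add: euclidean_product_topology)
qed

text \<open>
  The nonzero kernel vectors are a countable union of compact sets, cut out by bounding \<open>h\<close> from above
  and its \<open>l\<^sub>1\<close> norm away from zero.
\<close>

lemma measurable_ex_kernel_le_zero: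
  fixes F :: "'a \<Rightarrow> (nat \<Rightarrow> complex) \<Rightarrow> real"
  assumes cont: "\<And>x. x \<in> space M \<Longrightarrow> continuous_on UNIV (F x)"
    and meas: "\<And>h. (\<lambda>x. F x h) \<in> borel_measurable M"
  shows "{x \<in> space M. \<exists>h. (\<forall>i\<ge>m. h i = 0) \<and> (\<forall>r\<in>R. (\<Sum>i<m. h i * \<phi> i r) = 0) \<and>
    (\<exists>i<m. h i \<noteq> 0) \<and> F x h \<le> 0} \<in> sets M"
proof -
  define H where "H n = {h. \<forall>i. cmod (h i) \<le> (if i < m then real n else 0)} \<inter>
    (\<Inter>r\<in>R. {h. (\<Sum>i<m. h i * \<phi> i r) = 0}) \<inter> {h. inverse (real (Suc n)) \<le> (\<Sum>i<m. cmod (h i))}"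
    for n :: nat
  have "compact (H n)" for n
    unfolding H_def
    by (intro compact_Int_closed compact_bounded_functions closed_INT ballI closed_Collect_eq
        closed_Collect_le continuous_intros continuous_on_product_coordinates)
  then have 1: "{x \<in> space M. \<exists>h\<in>H n. F x h \<le> 0} \<in> sets M" for n
    using cont meas by (rule measurable_ex_compact_le_zero)
  have 2: "(\<exists>n. h \<in> H n) \<longleftrightarrow> (\<forall>i\<ge>m. h i = 0) \<and> (\<forall>r\<in>R. (\<Sum>i<m. h i * \<phi> i r) = 0) \<and> (\<exists>i<m. h i \<noteq> 0)" for h
  proof safe
    fix n i assume h: "h \<in> H n"
    then have b: "cmod (h i) \<le> (if i < m then real n else 0)" and k: "r \<in> R \<Longrightarrow> (\<Sum>i<m. h i * \<phi> i r) = 0"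
      and s: "inverse (real (Suc n)) \<le> (\<Sum>i<m. cmod (h i))" for i r
      by (auto simp: H_def)
    show "h i = 0" if "m \<le> i" using b[of i] that by simp
    show "(\<Sum>i<m. h i * \<phi> i r) = 0" if "r \<in> R" for r using k[OF that] .
    show "\<exists>i<m. h i \<noteq> 0"
    proof (rule ccontr)
      assume "\<not> ?thesis"
      then have "(\<Sum>i<m. cmod (h i)) = 0" by simp
      then show False using s by simp
    qed
  next
    fix i assume h: "\<forall>i\<ge>m. h i = 0" "\<forall>r\<in>R. (\<Sum>i<m. h i * \<phi> i r) = 0" "i < m" "h i \<noteq> 0"
    let ?s = "\<Sum>i<m. cmod (h i)"
    have le: "cmod (h j) \<le> ?s" if "j < m" for j using that by (intro member_le_sum) auto
    have "0 < cmod (h i)" using h by simp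
    then have s: "0 < ?s" using le[OF h(3)] by linarith
    obtain n1 where n1: "inverse (real (Suc n1)) < ?s" using reals_Archimedean[OF s] by blast
    obtain n2 where n2: "?s < real n2" using reals_Archimedean2 by blast
    define n where "n = max n1 n2"
    have "inverse (real (Suc n)) \<le> inverse (real (Suc n1))" by (simp add: n_def)
    then have 3: "inverse (real (Suc n)) \<le> ?s" using n1 by linarith
    have 4: "?s \<le> real n" using n2 by (simp add: n_def)
    have "h \<in> H n" unfolding H_def using h 3 order_trans[OF le 4] by auto
    then show "\<exists>n. h \<in> H n" by blast
  qed
  define ker where "ker h \<longleftrightarrow> (\<forall>i\<ge>m. h i = 0) \<and> (\<forall>r\<in>R. (\<Sum>i<m. h i * \<phi> i r) = 0) \<and> (\<exists>i<m. h i \<noteq> 0)" for h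
  have ker: "(\<exists>n. h \<in> H n) \<longleftrightarrow> ker h" for h unfolding ker_def by (rule 2)
  have "{x \<in> space M. \<exists>h. (\<forall>i\<ge>m. h i = 0) \<and> (\<forall>r\<in>R. (\<Sum>i<m. h i * \<phi> i r) = 0) \<and>
      (\<exists>i<m. h i \<noteq> 0) \<and> F x h \<le> 0} = {x \<in> space M. \<exists>h. ker h \<and> F x h \<le> 0}"
    unfolding ker_def by (simp only: conj_assoc)
  also have "\<dots> = (\<Union>n. {x \<in> space M. \<exists>h\<in>H n. F x h \<le> 0})"
    unfolding ker[symmetric] by auto
  also have "\<dots> \<in> sets M" using 1 by blast
  finally show ?thesis .
qed

text \<open>
  The event that \<open>a\<close> is the unique minimizer of both programs, with competitors written as \<open>a + h\<close> for
  \<open>h\<close> in the kernel of the matrix with columns \<open>\<phi> i\<close>.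
\<close>

definition strictly_optimal :: "nat \<Rightarrow> nat set \<Rightarrow> (nat \<Rightarrow> nat \<Rightarrow> complex) \<Rightarrow> (nat \<Rightarrow> complex) \<Rightarrow> bool" where
  "strictly_optimal m R \<phi> a \<longleftrightarrow> (\<forall>h. (\<forall>i\<ge>m. h i = 0) \<longrightarrow> (\<forall>r\<in>R. (\<Sum>i<m. h i * \<phi> i r) = 0) \<longrightarrow>
    (\<exists>i<m. h i \<noteq> 0) \<longrightarrow>
    (\<Sum>i<m. cmod (a i)) < (\<Sum>i<m. cmod (a i + h i)) \<and>
    card {i\<in>{..<m}. a i \<noteq> 0} < card {i\<in>{..<m}. a i + h i \<noteq> 0})"

text \<open>
  The complement is described by closed conditions on a kernel vector: a competitor is at least as sparse
  as \<open>a\<close> iff it vanishes outside some index set \<open>S\<close> with \<open>card S\<close> at most the size of the support of \<open>a\<close>.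
\<close>

lemma strictly_optimal_measurable:
  assumes coord: "\<And>i. i < m \<Longrightarrow> (\<lambda>a. a i) \<in> borel_measurable M"
  shows "{a \<in> space M. strictly_optimal m R \<phi> a} \<in> sets M"
proof -
  let ?ker = "\<lambda>h. (\<forall>i\<ge>m. h i = 0) \<and> (\<forall>r\<in>R. (\<Sum>i<m. h i * \<phi> i r) = 0) \<and> (\<exists>i<m. h i \<noteq> 0)"
  let ?supp = "\<lambda>a :: nat \<Rightarrow> complex. {i\<in>{..<m}. a i \<noteq> 0}"
  let ?ex = "\<lambda>F. {a \<in> space M. \<exists>h. (\<forall>i\<ge>m. h i = 0) \<and> (\<forall>r\<in>R. (\<Sum>i<m. h i * \<phi> i r) = 0) \<and>
    (\<exists>i<m. h i \<noteq> 0) \<and> F a h \<le> (0 :: real)}"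
  define F1 where "F1 a h = (\<Sum>i<m. cmod (a i + h i)) - (\<Sum>i<m. cmod (a i))"
    for a h :: "nat \<Rightarrow> complex"
  define F0 where "F0 S a h = (\<Sum>i\<in>{..<m} - S. cmod (a i + h i))"
    for S and a h :: "nat \<Rightarrow> complex"
  have F1: "?ex F1 \<in> sets M"
  proof (rule measurable_ex_kernel_le_zero)
    show "continuous_on UNIV (F1 a)" for a
      unfolding F1_def by (intro continuous_intros continuous_on_product_coordinates)
    show "(\<lambda>a. F1 a h) \<in> borel_measurable M" for h
      unfolding F1_def using coord
      by (intro borel_measurable_diff borel_measurable_sum borel_measurable_norm borel_measurable_add) auto
  qed
  have F0: "?ex (F0 S) \<in> sets M" for S
  proof (rule measurable_ex_kernel_le_zero)
    show "continuous_on UNIV (F0 S a)" for a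
      unfolding F0_def by (intro continuous_intros continuous_on_product_coordinates)
    show "(\<lambda>a. F0 S a h) \<in> borel_measurable M" for h
      unfolding F0_def using coord
      by (intro borel_measurable_sum borel_measurable_norm borel_measurable_add) auto
  qed
  have card: "{a \<in> space M. card S \<le> card (?supp a)} \<in> sets M" for S :: "nat set"
  proof -
    have rc: "real (card (?supp a)) = (\<Sum>i<m. indicator (- {0}) (a i))" for a :: "nat \<Rightarrow> complex"
    proof -
      have "(\<Sum>i<m. indicator (- {0}) (a i)) = (\<Sum>i<m. if a i \<noteq> 0 then 1 else 0 :: real)"
        by (intro sum.cong) (auto simp: indicator_def)
      also have "\<dots> = real (card (?supp a))" by (simp add: sum.If_cases Int_def)
      finally show ?thesis ..
    qed
    have "{a \<in> space M. card S \<le> card (?supp a)}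
        = {a \<in> space M. real (card S) \<le> (\<Sum>i<m. indicator (- {0}) (a i))}"
      unfolding rc[symmetric] of_nat_le_iff ..
    also have "\<dots> \<in> sets M"
    proof (intro borel_measurable_le borel_measurable_const borel_measurable_sum)
      fix i assume "i \<in> {..<m}"
      then have "(\<lambda>a. a i) \<in> borel_measurable M" using coord by simp
      then show "(\<lambda>a. indicator (- {0}) (a i) :: real) \<in> borel_measurable M"
        by (rule measurable_compose) (intro borel_measurable_indicator, simp)
    qed
    finally show ?thesis .
  qed
  have sparse: "card (?supp (\<lambda>i. a i + h i)) \<le> card (?supp a) \<longleftrightarrow>
      (\<exists>S\<in>Pow {..<m}. card S \<le> card (?supp a) \<and> F0 S a h \<le> 0)" for a h :: "nat \<Rightarrow> complex"
  proof
    assume "card (?supp (\<lambda>i. a i + h i)) \<le> card (?supp a)"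
    moreover have "F0 (?supp (\<lambda>i. a i + h i)) a h = 0"
      unfolding F0_def by (intro sum.neutral) auto
    ultimately show "\<exists>S\<in>Pow {..<m}. card S \<le> card (?supp a) \<and> F0 S a h \<le> 0"
      by (intro bexI[of _ "?supp (\<lambda>i. a i + h i)"]) auto
  next
    assume "\<exists>S\<in>Pow {..<m}. card S \<le> card (?supp a) \<and> F0 S a h \<le> 0"
    then obtain S where S: "S \<subseteq> {..<m}" "card S \<le> card (?supp a)" "F0 S a h \<le> 0" by blast
    have "F0 S a h = 0" using S(3) by (intro antisym) (auto simp: F0_def sum_nonneg)
    then have "?supp (\<lambda>i. a i + h i) \<subseteq> S" unfolding F0_def by (auto simp: sum_nonneg_eq_0_iff)
    then have "card (?supp (\<lambda>i. a i + h i)) \<le> card S"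
      using S(1) finite_subset by (intro card_mono) auto
    then show "card (?supp (\<lambda>i. a i + h i)) \<le> card (?supp a)" using S(2) by linarith
  qed
  have l1: "(\<Sum>i<m. cmod (a i)) < (\<Sum>i<m. cmod (a i + h i)) \<longleftrightarrow> \<not> F1 a h \<le> 0" for a h
    by (simp add: F1_def not_le)
  have l0: "card (?supp a) < card (?supp (\<lambda>i. a i + h i)) \<longleftrightarrow>
      \<not> (\<exists>S\<in>Pow {..<m}. card S \<le> card (?supp a) \<and> F0 S a h \<le> 0)" for a h
    by (simp only: sparse[symmetric] not_le)
  define P1 where "P1 a \<longleftrightarrow> (\<exists>h. ?ker h \<and> F1 a h \<le> 0)" for a
  define P0 where "P0 S a \<longleftrightarrow> (\<exists>h. ?ker h \<and> F0 S a h \<le> 0)" for S a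
  have P1: "{a \<in> space M. P1 a} \<in> sets M"
    using F1 unfolding P1_def by (simp only: conj_assoc)
  have P0: "{a \<in> space M. P0 S a} \<in> sets M" for S
    using F0[of S] unfolding P0_def by (simp only: conj_assoc)
  have opt: "strictly_optimal m R \<phi> a \<longleftrightarrow> \<not> P1 a \<and> \<not> (\<exists>S\<in>Pow {..<m}. card S \<le> card (?supp a) \<and> P0 S a)" for a
  proof -
    have "strictly_optimal m R \<phi> a \<longleftrightarrow>
        \<not> (\<exists>h. ?ker h \<and> (F1 a h \<le> 0 \<or> (\<exists>S\<in>Pow {..<m}. card S \<le> card (?supp a) \<and> F0 S a h \<le> 0)))"
      unfolding strictly_optimal_def l1 l0 by blast
    also have "\<dots> \<longleftrightarrow> \<not> P1 a \<and> \<not> (\<exists>S\<in>Pow {..<m}. card S \<le> card (?supp a) \<and> P0 S a)"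
      unfolding P1_def P0_def by blast
    finally show ?thesis .
  qed
  have "{a \<in> space M. strictly_optimal m R \<phi> a} = space M - ({a \<in> space M. P1 a} \<union>
      (\<Union>S\<in>Pow {..<m}. {a \<in> space M. card S \<le> card (?supp a)} \<inter> {a \<in> space M. P0 S a}))"
  proof (rule Set.set_eqI)
    fix a
    show "a \<in> {a \<in> space M. strictly_optimal m R \<phi> a} \<longleftrightarrow> a \<in> space M - ({a \<in> space M. P1 a} \<union>
        (\<Union>S\<in>Pow {..<m}. {a \<in> space M. card S \<le> card (?supp a)} \<inter> {a \<in> space M. P0 S a}))"
      by (cases "a \<in> space M")
        (simp_all only: mem_Collect_eq opt Diff_iff Un_iff UN_iff Int_iff simp_thms de_Morgan_disj)
  qed
  also have "\<dots> \<in> sets M"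
    by (intro sets.Diff sets.Un sets.finite_UN sets.Int P1 P0 card sets.top finite_Pow_iff[THEN iffD2] finite_lessThan)
  finally show ?thesis .
qed

lemma solutions_eq_singleton_iff:
  fixes J :: "complex vec \<Rightarrow> 'b :: linorder"
  assumes "x \<in> carrier_vec (dim_col A)"
  shows "solutions J A (A *\<^sub>v x) = {x} \<longleftrightarrow>
    (\<forall>y\<in>carrier_vec (dim_col A). A *\<^sub>v y = A *\<^sub>v x \<longrightarrow> y \<noteq> x \<longrightarrow> J x < J y)"
proof
  assume *: "solutions J A (A *\<^sub>v x) = {x}"
  then have min: "\<not> J y < J x" if "y \<in> carrier_vec (dim_col A)" "A *\<^sub>v y = A *\<^sub>v x" for y
    using that * unfolding solutions_def is_arg_min_def by blast
  show "\<forall>y\<in>carrier_vec (dim_col A). A *\<^sub>v y = A *\<^sub>v x \<longrightarrow> y \<noteq> x \<longrightarrow> J x < J y"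
  proof (intro ballI impI, rule ccontr)
    fix y assume y: "y \<in> carrier_vec (dim_col A)" "A *\<^sub>v y = A *\<^sub>v x" "y \<noteq> x" "\<not> J x < J y"
    have "\<not> J z < J y" if "z \<in> carrier_vec (dim_col A)" "A *\<^sub>v z = A *\<^sub>v x" for z
      using min[OF that] y(4) by (simp add: not_less)
    then have "y \<in> solutions J A (A *\<^sub>v x)"
      using y(1,2) unfolding solutions_def is_arg_min_def by blast
    then show False using * y(3) by simp
  qed
next
  assume *: "\<forall>y\<in>carrier_vec (dim_col A). A *\<^sub>v y = A *\<^sub>v x \<longrightarrow> y \<noteq> x \<longrightarrow> J x < J y"
  show "solutions J A (A *\<^sub>v x) = {x}"
  proof (rule Set.set_eqI, rule iffI)
    fix y assume "y \<in> solutions J A (A *\<^sub>v x)"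
    then show "y \<in> {x}" using * assms unfolding solutions_def is_arg_min_def by blast
  next
    fix y assume "y \<in> {x}"
    moreover have "\<not> J z < J x" if "z \<in> carrier_vec (dim_col A)" "A *\<^sub>v z = A *\<^sub>v x" for z
      using * that by (cases "z = x") (auto simp: not_less less_imp_le)
    ultimately show "y \<in> solutions J A (A *\<^sub>v x)"
      using assms unfolding solutions_def is_arg_min_def by blast
  qed
qed

lemma mult_mat_vec_eq_iff:
  fixes A :: "complex mat"
  assumes A: "A \<in> carrier_mat n m"
  shows "A *\<^sub>v vec m (\<lambda>i. a i + h i) = A *\<^sub>v vec m a \<longleftrightarrow> (\<forall>r<n. (\<Sum>i<m. h i * A $$ (r, i)) = 0)"
proof -
  have nth: "(A *\<^sub>v vec m b) $ r = (\<Sum>i<m. b i * A $$ (r, i))" if "r < n" for b :: "nat \<Rightarrow> complex" and r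
    using that A by (simp add: scalar_prod_def atLeast0LessThan mult.commute)
  have "A *\<^sub>v vec m (\<lambda>i. a i + h i) = A *\<^sub>v vec m a \<longleftrightarrow>
      (\<forall>r<n. (A *\<^sub>v vec m (\<lambda>i. a i + h i)) $ r = (A *\<^sub>v vec m a) $ r)"
  proof
    assume eq: "A *\<^sub>v vec m (\<lambda>i. a i + h i) = A *\<^sub>v vec m a"
    show "\<forall>r<n. (A *\<^sub>v vec m (\<lambda>i. a i + h i)) $ r = (A *\<^sub>v vec m a) $ r"
      unfolding eq by simp
  next
    assume "\<forall>r<n. (A *\<^sub>v vec m (\<lambda>i. a i + h i)) $ r = (A *\<^sub>v vec m a) $ r"
    then show "A *\<^sub>v vec m (\<lambda>i. a i + h i) = A *\<^sub>v vec m a"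
      using A by (intro eq_vecI) simp_all
  qed
  also have "\<dots> \<longleftrightarrow> (\<forall>r<n. (\<Sum>i<m. h i * A $$ (r, i)) = 0)"
    by (auto simp: nth distrib_right sum.distrib)
  finally show ?thesis .
qed

lemma unique_solutions_iff_strictly_optimal:
  assumes A: "A \<in> carrier_mat n m"
  shows "solutions l0_norm A (A *\<^sub>v vec m a) = {vec m a} \<and> solutions l1_norm A (A *\<^sub>v vec m a) = {vec m a}
    \<longleftrightarrow> strictly_optimal m {..<n} (\<lambda>i r. A $$ (r, i)) a"
proof -
  have l0: "l0_norm (vec m b) = card {i\<in>{..<m}. b i \<noteq> 0}" for b
    unfolding l0_norm_def by (rule arg_cong[where f = card]) auto
  have l1: "l1_norm (vec m b) = (\<Sum>i<m. cmod (b i))" for b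
    by (simp add: l1_norm_def)
  let ?better = "\<lambda>y. l0_norm (vec m a) < l0_norm y \<and> l1_norm (vec m a) < l1_norm y"
  have "solutions l0_norm A (A *\<^sub>v vec m a) = {vec m a} \<and> solutions l1_norm A (A *\<^sub>v vec m a) = {vec m a}
      \<longleftrightarrow> (\<forall>y\<in>carrier_vec m. A *\<^sub>v y = A *\<^sub>v vec m a \<longrightarrow> y \<noteq> vec m a \<longrightarrow> ?better y)"
    using A by (subst (1 2) solutions_eq_singleton_iff) auto
  also have "\<dots> \<longleftrightarrow> strictly_optimal m {..<n} (\<lambda>i r. A $$ (r, i)) a"
  proof
    assume *: "\<forall>y\<in>carrier_vec m. A *\<^sub>v y = A *\<^sub>v vec m a \<longrightarrow> y \<noteq> vec m a \<longrightarrow> ?better y"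
    show "strictly_optimal m {..<n} (\<lambda>i r. A $$ (r, i)) a"
      unfolding strictly_optimal_def
    proof (intro allI impI)
      fix h :: "nat \<Rightarrow> complex"
      assume ker: "\<forall>r\<in>{..<n}. (\<Sum>i<m. h i * A $$ (r, i)) = 0" and nz: "\<exists>i<m. h i \<noteq> 0"
      have "vec m (\<lambda>i. a i + h i) \<noteq> vec m a"
      proof
        assume eq: "vec m (\<lambda>i. a i + h i) = vec m a"
        obtain i where i: "i < m" "h i \<noteq> 0" using nz by blast
        have "a i + h i = a i" using arg_cong[OF eq, of "\<lambda>v. v $ i"] i(1) by simp
        then show False using i(2) by simp
      qed
      moreover have "A *\<^sub>v vec m (\<lambda>i. a i + h i) = A *\<^sub>v vec m a"
        using ker unfolding mult_mat_vec_eq_iff[OF A] by auto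
      ultimately have "?better (vec m (\<lambda>i. a i + h i))" using * by simp
      then show "(\<Sum>i<m. cmod (a i)) < (\<Sum>i<m. cmod (a i + h i)) \<and>
          card {i\<in>{..<m}. a i \<noteq> 0} < card {i\<in>{..<m}. a i + h i \<noteq> 0}"
        unfolding l0 l1 by blast
    qed
  next
    assume opt: "strictly_optimal m {..<n} (\<lambda>i r. A $$ (r, i)) a"
    show "\<forall>y\<in>carrier_vec m. A *\<^sub>v y = A *\<^sub>v vec m a \<longrightarrow> y \<noteq> vec m a \<longrightarrow> ?better y"
    proof (intro ballI impI)
      fix y :: "complex vec" assume y: "y \<in> carrier_vec m" "A *\<^sub>v y = A *\<^sub>v vec m a" "y \<noteq> vec m a"
      define h where "h i = (if i < m then y $ i - a i else 0)" for i
      have y_eq: "y = vec m (\<lambda>i. a i + h i)" using y(1) by (intro eq_vecI) (auto simp: h_def)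
      have "\<forall>r\<in>{..<n}. (\<Sum>i<m. h i * A $$ (r, i)) = 0"
        using y(2) unfolding y_eq mult_mat_vec_eq_iff[OF A] by auto
      moreover have "\<exists>i<m. h i \<noteq> 0"
      proof (rule ccontr)
        assume "\<not> ?thesis"
        then have "y = vec m a" unfolding y_eq by (intro eq_vecI) auto
        then show False using y(3) by contradiction
      qed
      moreover have "\<forall>i\<ge>m. h i = 0" by (simp add: h_def)
      ultimately show "?better y"
        using opt unfolding y_eq l0 l1 strictly_optimal_def by blast
    qed
  qed
  finally show ?thesis .
qed

section \<open>The coefficient law\<close>

lemma coeff_extension_measurable:
  assumes D: "sets D = sets borel"
  shows "(\<lambda>z. \<lambda>\<gamma>\<in>{..<2 * N}. if \<gamma> \<in> G then z \<gamma> else 0) \<in> measurable (\<Pi>\<^sub>M \<gamma>\<in>G. D) (coeff_space N)"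
  unfolding coeff_space_def
proof (rule measurable_restrict)
  fix \<gamma> :: nat
  have [measurable_cong]: "sets D = sets borel" by (fact D)
  have "(\<lambda>z. z \<gamma>) \<in> borel_measurable (\<Pi>\<^sub>M \<gamma>\<in>G. D)" if "\<gamma> \<in> G"
    using that by measurable
  then show "(\<lambda>z. if \<gamma> \<in> G then z \<gamma> else 0) \<in> borel_measurable (\<Pi>\<^sub>M \<gamma>\<in>G. D)"
    by (cases "\<gamma> \<in> G") auto
qed

lemma coeff_space_coordinate: "i < 2 * N \<Longrightarrow> (\<lambda>a. a i) \<in> borel_measurable (coeff_space N)"
  unfolding coeff_space_def by measurable

text \<open>
  Given a separated support, the \<open>l\<^sub>1\<close> certificate can fail for each of the at most \<open>2 N\<close> columns outside
  it with probability \<open>4 exp (- 1 / (16 \<eta>))\<close>, and the \<open>l\<^sub>0\<close> program fails only on the null set formed by the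
  hyperplanes of the finitely many competing supports.
\<close>

lemma coeff_law_on_strictly_optimal:
  assumes sep: "separated_support {..<N} {..<2 * N} \<Gamma> \<phi> \<eta>" and \<eta>: "0 < \<eta>"
    and D: "continuous_distribution D" "circularly_symmetric D"
  shows "1 - 8 * real N * exp (- 1 / (16 * \<eta>))
    \<le> measure (coeff_law_on N D \<Gamma>) {a \<in> space (coeff_space N). strictly_optimal (2 * N) {..<N} \<phi> a}"
proof -
  interpret separated_support "{..<N}" "{..<2 * N}" \<Gamma> \<phi> \<eta> by (fact sep)
  have D': "prob_space D" "sets D = sets borel"
    by (rule continuous_distribution_prob_space[OF D(1)], rule continuous_distribution_sets[OF D(1)])
  let ?M = "\<Pi>\<^sub>M \<gamma>\<in>\<Gamma>. D" and ?J = "{..<2 * N}"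
  interpret M: prob_space ?M by (rule prob_space_PiM) (rule D')
  have [measurable_cong]: "sets D = sets borel" by (fact D'(2))
  define ext :: "(nat \<Rightarrow> complex) \<Rightarrow> nat \<Rightarrow> complex"
    where "ext z = (\<lambda>\<gamma>\<in>?J. if \<gamma> \<in> \<Gamma> then z \<gamma> else 0)" for z
  have ext: "ext \<in> measurable ?M (coeff_space N)"
    unfolding ext_def[abs_def] by (rule coeff_extension_measurable[OF D'(2)])
  let ?E = "{a \<in> space (coeff_space N). strictly_optimal (2 * N) {..<N} \<phi> a}"
  have E: "?E \<in> sets (coeff_space N)"
    by (intro strictly_optimal_measurable coeff_space_coordinate)
  obtain w where w: "\<And>\<gamma>. \<gamma> \<in> ?J - \<Gamma> \<Longrightarrow> (\<Sum>g\<in>\<Gamma>. (cmod (w \<gamma> g))\<^sup>2) \<le> 4 * \<eta>"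
    and w_orth: "\<And>\<gamma> g. g \<in> \<Gamma> \<Longrightarrow> ip {..<N} (\<lambda>r. \<phi> \<gamma> r - synth \<phi> \<Gamma> (w \<gamma>) r) (\<phi> g) = 0"
  proof (rule projection_coefficients)
    fix w
    assume "\<And>\<gamma>. \<gamma> \<in> ?J - \<Gamma> \<Longrightarrow> (\<Sum>g\<in>\<Gamma>. (cmod (w \<gamma> g))\<^sup>2) \<le> 4 * \<eta>"
      and "\<And>\<gamma> g. g \<in> \<Gamma> \<Longrightarrow> ip {..<N} (\<lambda>r. \<phi> \<gamma> r - synth \<phi> \<Gamma> (w \<gamma>) r) (\<phi> g) = 0"
    then show thesis by (rule that)
  qed
  define \<G> where "\<G> = {\<Gamma>'\<in>Pow ?J. \<Gamma>' \<noteq> \<Gamma> \<and> card \<Gamma>' \<le> card \<Gamma>}"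
  have "\<exists>y. \<forall>\<Gamma>'\<in>\<G>. (\<forall>g\<in>\<Gamma>'. ip {..<N} (\<phi> g) (y \<Gamma>') = 0) \<and> (\<exists>g\<in>\<Gamma>. ip {..<N} (\<phi> g) (y \<Gamma>') \<noteq> 0)"
  proof (intro bchoice ballI)
    fix \<Gamma>' assume "\<Gamma>' \<in> \<G>"
    then have "\<Gamma>' \<subseteq> ?J" "\<Gamma>' \<noteq> \<Gamma>" "card \<Gamma>' \<le> card \<Gamma>" unfolding \<G>_def by blast+
    then show "\<exists>y. (\<forall>g\<in>\<Gamma>'. ip {..<N} (\<phi> g) y = 0) \<and> (\<exists>g\<in>\<Gamma>. ip {..<N} (\<phi> g) y \<noteq> 0)"
      by (rule separating_functional)
  qed
  then obtain y where sep: "\<forall>\<Gamma>'\<in>\<G>. (\<forall>g\<in>\<Gamma>'. ip {..<N} (\<phi> g) (y \<Gamma>') = 0) \<and>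
      (\<exists>g\<in>\<Gamma>. ip {..<N} (\<phi> g) (y \<Gamma>') \<noteq> 0)" by (rule exE)
  have y: "ip {..<N} (\<phi> g) (y \<Gamma>') = 0" if "\<Gamma>' \<in> \<G>" "g \<in> \<Gamma>'" for \<Gamma>' g
    using bspec[OF sep that(1)] that(2) by blast
  have y_nz: "\<exists>g\<in>\<Gamma>. ip {..<N} (\<phi> g) (y \<Gamma>') \<noteq> 0" if "\<Gamma>' \<in> \<G>" for \<Gamma>'
    using bspec[OF sep that] by blast
  define B where "B \<gamma> = {z \<in> space ?M. 1 \<le> cmod (\<Sum>g\<in>\<Gamma>. w \<gamma> g * cnj (sgn (z g)))}" for \<gamma>
  define H where "H \<Gamma>' = {z \<in> space ?M. (\<Sum>g\<in>\<Gamma>. z g * ip {..<N} (\<phi> g) (y \<Gamma>')) = 0}" for \<Gamma>'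
  have B_sets: "B \<gamma> \<in> sets ?M" for \<gamma> unfolding B_def by measurable
  have H_sets: "H \<Gamma>' \<in> sets ?M" for \<Gamma>' unfolding H_def by measurable
  have B_prob: "M.prob (B \<gamma>) \<le> 4 * exp (- 1 / (16 * \<eta>))" if "\<gamma> \<in> ?J - \<Gamma>" for \<gamma>
    using phase_sum_tail[OF D' D(2) finite_\<Gamma> w[OF that]] \<eta> unfolding B_def by (simp add: mult.assoc)
  have H_prob: "M.prob (H \<Gamma>') = 0" if "\<Gamma>' \<in> \<G>" for \<Gamma>'
  proof -
    have "\<exists>g\<in>\<Gamma>. ip {..<N} (\<phi> g) (y \<Gamma>') \<noteq> 0" by (rule y_nz[OF that])
    then obtain g where "g \<in> \<Gamma>" "ip {..<N} (\<phi> g) (y \<Gamma>') \<noteq> 0" by blast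
    then have "emeasure ?M (H \<Gamma>') = 0" unfolding H_def by (rule hyperplane_null[OF D(1) finite_\<Gamma>])
    then show ?thesis by (simp add: measure_def)
  qed
  have good: "strictly_optimal (2 * N) {..<N} \<phi> (ext z)"
    if z: "z \<in> space ?M" "\<And>\<gamma>. \<gamma> \<in> ?J - \<Gamma> \<Longrightarrow> z \<notin> B \<gamma>" "\<And>\<Gamma>'. \<Gamma>' \<in> \<G> \<Longrightarrow> z \<notin> H \<Gamma>'" for z
    unfolding strictly_optimal_def
  proof (intro allI impI)
    fix h :: "nat \<Rightarrow> complex"
    assume "\<forall>r\<in>{..<N}. (\<Sum>i<2 * N. h i * \<phi> i r) = 0" and nz: "\<exists>i<2 * N. h i \<noteq> 0"
    then have ker: "synth \<phi> ?J h r = 0" if "r \<in> {..<N}" for r using that by (simp add: synth_def)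
    have on: "ext z g = z g" if "g \<in> \<Gamma>" for g using that sub by (auto simp: ext_def)
    have off: "ext z \<gamma> = 0" if "\<gamma> \<in> ?J - \<Gamma>" for \<gamma> using that by (auto simp: ext_def)
    have nz': "\<exists>\<gamma>\<in>?J. h \<gamma> \<noteq> 0" using nz by auto
    have dual: "cmod (\<Sum>g\<in>\<Gamma>. w \<gamma> g * cnj (sgn (ext z g))) < 1" if "\<gamma> \<in> ?J - \<Gamma>" for \<gamma>
    proof -
      have "(\<Sum>g\<in>\<Gamma>. w \<gamma> g * cnj (sgn (ext z g))) = (\<Sum>g\<in>\<Gamma>. w \<gamma> g * cnj (sgn (z g)))"
        by (intro sum.cong refl) (simp add: on)
      then show ?thesis using z(1) z(2)[OF that] by (simp only: B_def mem_Collect_eq not_le simp_thms)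
    qed
    have generic: "(\<Sum>g\<in>\<Gamma>. ext z g * ip {..<N} (\<phi> g) (y \<Gamma>')) \<noteq> 0" if "\<Gamma>' \<in> \<G>" for \<Gamma>'
    proof -
      have "(\<Sum>g\<in>\<Gamma>. ext z g * ip {..<N} (\<phi> g) (y \<Gamma>')) = (\<Sum>g\<in>\<Gamma>. z g * ip {..<N} (\<phi> g) (y \<Gamma>'))"
        by (intro sum.cong refl) (simp add: on)
      then show ?thesis using z(1) z(3)[OF that] by (simp only: H_def mem_Collect_eq simp_thms)
    qed
    have "(\<Sum>\<gamma>\<in>?J. cmod (ext z \<gamma>)) < (\<Sum>\<gamma>\<in>?J. cmod (ext z \<gamma> + h \<gamma>))"
      by (rule l1_recovery[OF w_orth dual off ker nz'])
    moreover have "card {\<gamma>\<in>?J. ext z \<gamma> \<noteq> 0} < card {\<gamma>\<in>?J. ext z \<gamma> + h \<gamma> \<noteq> 0}"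
    proof (rule l0_recovery[OF _ _ off ker nz'])
      fix \<Gamma>' g assume "\<Gamma>' \<subseteq> ?J" "\<Gamma>' \<noteq> \<Gamma>" "card \<Gamma>' \<le> card \<Gamma>" "g \<in> \<Gamma>'"
      then show "ip {..<N} (\<phi> g) (y \<Gamma>') = 0" by (intro y) (auto simp: \<G>_def)
    next
      fix \<Gamma>' assume "\<Gamma>' \<subseteq> ?J" "\<Gamma>' \<noteq> \<Gamma>" "card \<Gamma>' \<le> card \<Gamma>"
      then show "(\<Sum>g\<in>\<Gamma>. ext z g * ip {..<N} (\<phi> g) (y \<Gamma>')) \<noteq> 0" by (intro generic) (auto simp: \<G>_def)
    qed
    ultimately show "(\<Sum>i<2 * N. cmod (ext z i)) < (\<Sum>i<2 * N. cmod (ext z i + h i)) \<and>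
        card {i\<in>?J. ext z i \<noteq> 0} < card {i\<in>?J. ext z i + h i \<noteq> 0}" by blast
  qed
  let ?S = "ext -` ?E \<inter> space ?M"
  let ?BU = "\<Union>\<gamma>\<in>?J - \<Gamma>. B \<gamma>" and ?HU = "\<Union>\<Gamma>'\<in>\<G>. H \<Gamma>'"
  have S: "?S \<in> sets ?M" using ext E by (rule measurable_sets)
  have fin_G: "finite \<G>" by (simp add: \<G>_def)
  have "space ?M - ?S \<subseteq> ?BU \<union> ?HU"
  proof
    fix z assume "z \<in> space ?M - ?S"
    then have z: "z \<in> space ?M" "\<not> strictly_optimal (2 * N) {..<N} \<phi> (ext z)"
      using measurable_space[OF ext, of z] by auto
    then show "z \<in> ?BU \<union> ?HU" using good[OF z(1)] by blast
  qed
  then have "M.prob (space ?M - ?S) \<le> M.prob (?BU \<union> ?HU)"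
    using B_sets H_sets fin_G by (intro M.finite_measure_mono sets.Un sets.finite_UN) auto
  also have "\<dots> \<le> M.prob ?BU + M.prob ?HU"
    using B_sets H_sets fin_G by (intro measure_Un_le sets.finite_UN) auto
  also have "M.prob ?BU \<le> (\<Sum>\<gamma>\<in>?J - \<Gamma>. M.prob (B \<gamma>))"
    using B_sets by (intro M.finite_measure_subadditive_finite) auto
  also have "\<dots> \<le> (\<Sum>\<gamma>\<in>?J - \<Gamma>. 4 * exp (- 1 / (16 * \<eta>)))" by (intro sum_mono B_prob)
  also have "\<dots> \<le> (\<Sum>\<gamma>\<in>?J. 4 * exp (- 1 / (16 * \<eta>)))" by (intro sum_mono2) auto
  also have "M.prob ?HU \<le> (\<Sum>\<Gamma>'\<in>\<G>. M.prob (H \<Gamma>'))"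
    using H_sets fin_G by (intro M.finite_measure_subadditive_finite) auto
  also have "\<dots> = 0" using H_prob by simp
  finally have "M.prob (space ?M - ?S) \<le> 8 * real N * exp (- 1 / (16 * \<eta>))" by simp
  then have "1 - 8 * real N * exp (- 1 / (16 * \<eta>)) \<le> M.prob ?S"
    using M.prob_compl[OF S] by simp
  also have "M.prob ?S = measure (coeff_law_on N D \<Gamma>) ?E"
    unfolding coeff_law_on_def ext_def[abs_def, symmetric] using measure_distr[OF ext E] by simp
  finally show ?thesis .
qed

lemma coeff_law_on_prob_space:
  assumes "prob_space D" "sets D = sets borel"
  shows "prob_space (coeff_law_on N D G)" "sets (coeff_law_on N D G) = sets (coeff_space N)"
proof -
  interpret M: prob_space "\<Pi>\<^sub>M \<gamma>\<in>G. D" by (rule prob_space_PiM) (rule assms)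
  show "prob_space (coeff_law_on N D G)"
    unfolding coeff_law_on_def by (rule M.prob_space_distr[OF coeff_extension_measurable[OF assms(2)]])
qed (simp add: coeff_law_on_def)

lemma coeff_law_kernel:
  assumes "prob_space D" "sets D = sets borel"
  shows "(\<lambda>(G1, G2). coeff_law_on N D (joint_support N G1 G2)) \<in>
    measurable (measure_pmf P) (subprob_algebra (coeff_space N))"
  using coeff_law_on_prob_space[OF assms]
  by (auto simp: space_subprob_algebra intro: prob_space_imp_subprob_space)

lemma space_coeff_law:
  assumes "prob_space D" "sets D = sets borel"
  shows "space (coeff_law N p1 p2 D) = space (coeff_space N)"
  unfolding coeff_law_def by (rule space_bind_measurable[OF coeff_law_kernel[OF assms]]) simp

lemma coeff_law_lower_bound:
  assumes D: "prob_space D" "sets D = sets borel" and E: "E \<in> sets (coeff_space N)"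
    and good: "\<And>G1 G2. (G1, G2) \<in> Good \<Longrightarrow> 1 - \<epsilon> \<le> measure (coeff_law_on N D (joint_support N G1 G2)) E"
    and Good: "1 - \<delta> \<le> measure_pmf.prob (pair_pmf (bernoulli_subset N p1) (bernoulli_subset N p2)) Good"
    and nonneg: "0 \<le> \<epsilon>" "0 \<le> \<delta>"
  shows "1 - \<epsilon> - \<delta> \<le> measure (coeff_law N p1 p2 D) E"
proof (cases "\<epsilon> \<le> 1")
  case False
  then show ?thesis using nonneg measure_nonneg[of "coeff_law N p1 p2 D" E] by linarith
next
  case True
  let ?P = "pair_pmf (bernoulli_subset N p1) (bernoulli_subset N p2)"
  let ?K = "\<lambda>(G1, G2). coeff_law_on N D (joint_support N G1 G2)"
  have K: "?K \<in> measurable (measure_pmf ?P) (subprob_algebra (coeff_space N))"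
    by (rule coeff_law_kernel[OF D])
  have Kprob: "prob_space (?K x)" for x
    by (cases x) (simp add: coeff_law_on_prob_space[OF D])
  have le1: "emeasure (coeff_law N p1 p2 D) E \<le> 1"
  proof -
    interpret subprob_space "coeff_law N p1 p2 D"
      unfolding coeff_law_def
      by (rule subprob_space_bind[OF _ K]) (intro prob_space_imp_subprob_space measure_pmf.prob_space_axioms)
    show ?thesis by (rule subprob_emeasure_le_1)
  qed
  have "ennreal ((1 - \<epsilon>) * measure_pmf.prob ?P Good) = (\<integral>\<^sup>+ x. ennreal (1 - \<epsilon>) * indicator Good x \<partial>measure_pmf ?P)"
    using True by (simp add: nn_integral_cmult_indicator ennreal_mult measure_pmf.emeasure_eq_measure)
  also have "\<dots> \<le> (\<integral>\<^sup>+ x. emeasure (?K x) E \<partial>measure_pmf ?P)"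
  proof (intro nn_integral_mono)
    fix x
    interpret prob_space "?K x" by (rule Kprob)
    show "ennreal (1 - \<epsilon>) * indicator Good x \<le> emeasure (?K x) E"
    proof (cases "x \<in> Good")
      case x: True
      then have "1 - \<epsilon> \<le> measure (?K x) E" using good by (cases x) simp
      then show ?thesis using x by (simp add: emeasure_eq_measure ennreal_leI)
    qed simp
  qed
  also have "\<dots> = emeasure (coeff_law N p1 p2 D) E"
    unfolding coeff_law_def by (rule emeasure_bind[OF _ K E, symmetric]) simp
  also have "\<dots> = ennreal (measure (coeff_law N p1 p2 D) E)"
    by (rule emeasure_eq_ennreal_measure) (use le_less_trans[OF le1 ennreal_one_less_top] in simp)
  finally have "(1 - \<epsilon>) * measure_pmf.prob ?P Good \<le> measure (coeff_law N p1 p2 D) E"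
    by (simp add: ennreal_le_iff)
  moreover have "1 - \<epsilon> - \<delta> \<le> (1 - \<epsilon>) * (1 - \<delta>)" using nonneg by (simp add: algebra_simps)
  moreover have "(1 - \<epsilon>) * (1 - \<delta>) \<le> (1 - \<epsilon>) * measure_pmf.prob ?P Good"
    using True Good by (intro mult_left_mono) auto
  ultimately show ?thesis by linarith
qed

section \<open>The dictionary of two orthonormal bases\<close>

lemma orthonormal_basis_col_ip:
  assumes A: "A \<in> carrier_mat N N" and B: "B \<in> carrier_mat N N" and ij: "i < N" "j < N"
  shows "col A i \<bullet>c col B j = ip {..<N} (\<lambda>r. A $$ (r, i)) (\<lambda>r. B $$ (r, j))"
  using assms by (simp add: scalar_prod_def ip_def atLeast0LessThan conjugate_complex_def)

text \<open>
  Orthonormality of the columns says that the conjugate transpose is a left inverse; for square matrices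
  it is then a right inverse too.
\<close>

lemma orthonormal_basis_complete:
  assumes on: "orthonormal_basis N A" and rs: "r < N" "s < N"
  shows "(\<Sum>j<N. A $$ (r, j) * cnj (A $$ (s, j))) = (if r = s then 1 else 0)"
proof -
  have A: "A \<in> carrier_mat N N" using on by (simp add: orthonormal_basis_def)
  define C where "C = mat N N (\<lambda>(i, r). cnj (A $$ (r, i)))"
  have C: "C \<in> carrier_mat N N" by (simp add: C_def)
  have "C * A = 1\<^sub>m N"
  proof (rule eq_matI)
    fix i j assume ij: "i < dim_row (1\<^sub>m N)" "j < dim_col (1\<^sub>m N)"
    then have "(C * A) $$ (i, j) = ip {..<N} (\<lambda>r. A $$ (r, j)) (\<lambda>r. A $$ (r, i))"
      using A by (simp add: C_def scalar_prod_def ip_def atLeast0LessThan mult.commute)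
    also have "\<dots> = col A j \<bullet>c col A i"
      using ij by (simp add: orthonormal_basis_col_ip[OF A A])
    also have "\<dots> = 1\<^sub>m N $$ (i, j)"
      using on ij by (simp add: orthonormal_basis_def)
    finally show "(C * A) $$ (i, j) = 1\<^sub>m N $$ (i, j)" .
  qed (use A in \<open>simp_all add: C_def\<close>)
  then have AC: "A * C = 1\<^sub>m N" by (rule mat_mult_left_right_inverse[OF C A])
  have "(\<Sum>j<N. A $$ (r, j) * cnj (A $$ (s, j))) = (A * C) $$ (r, s)"
    using A rs by (simp add: C_def scalar_prod_def atLeast0LessThan)
  then show ?thesis using rs by (simp add: AC)
qed

lemma cmod_ip_le_mutual_incoherence:
  assumes A: "A \<in> carrier_mat N N" and B: "B \<in> carrier_mat N N" and ij: "i < N" "j < N"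
  shows "cmod (ip {..<N} (\<lambda>r. A $$ (r, i)) (\<lambda>r. B $$ (r, j))) \<le> mutual_incoherence A B"
proof -
  let ?S = "{cmod (x \<bullet>c y) | x y. x \<in> set (cols A) \<and> y \<in> set (cols B)}"
  have "?S = (\<lambda>(x, y). cmod (x \<bullet>c y)) ` (set (cols A) \<times> set (cols B))" by auto
  then have fin: "finite ?S" by simp
  have "col A i \<in> set (cols A)" "col B j \<in> set (cols B)"
    using A B ij by (auto simp: cols_def)
  then have "cmod (col A i \<bullet>c col B j) \<in> ?S" by blast
  then have "cmod (col A i \<bullet>c col B j) \<le> Max ?S" by (rule Max_ge[OF fin])
  then show ?thesis
    unfolding mutual_incoherence_def orthonormal_basis_col_ip[OF A B ij] .
qed

lemma dictionary_carrier:
  assumes "A \<in> carrier_mat N N" "B \<in> carrier_mat N N"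
  shows "dictionary A B \<in> carrier_mat N (2 * N)"
  using assms by (intro carrier_matI) (simp_all add: dictionary_def)

lemma dictionary_index:
  assumes "A \<in> carrier_mat N N" "B \<in> carrier_mat N N" "r < N" "j < N"
  shows "dictionary A B $$ (r, j) = A $$ (r, j)" "dictionary A B $$ (r, N + j) = B $$ (r, j)"
  using assms by (simp_all add: dictionary_def mat_of_cols_index nth_append)

lemma dictionary_orthonormal_pair:
  assumes on: "orthonormal_basis N A" "orthonormal_basis N B"
  shows "orthonormal_pair N (\<lambda>i r. dictionary A B $$ (r, i)) (mutual_incoherence A B)"
proof -
  have A: "A \<in> carrier_mat N N" and B: "B \<in> carrier_mat N N"
    using on by (simp_all add: orthonormal_basis_def)
  note idx = dictionary_index[OF A B]
  have ips: "ip {..<N} (\<lambda>r. dictionary A B $$ (r, i)) (\<lambda>r. dictionary A B $$ (r, j)) = col A i \<bullet>c col A j"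
    "ip {..<N} (\<lambda>r. dictionary A B $$ (r, N + i)) (\<lambda>r. dictionary A B $$ (r, N + j)) = col B i \<bullet>c col B j"
    "ip {..<N} (\<lambda>r. dictionary A B $$ (r, i)) (\<lambda>r. dictionary A B $$ (r, N + j))
      = ip {..<N} (\<lambda>r. A $$ (r, i)) (\<lambda>r. B $$ (r, j))" if "i < N" "j < N" for i j
    unfolding orthonormal_basis_col_ip[OF A A that] orthonormal_basis_col_ip[OF B B that]
    using that by (simp_all add: ip_def idx)
  show ?thesis
  proof unfold_locales
    fix i j assume ij: "i < N" "j < N"
    show "ip {..<N} (\<lambda>r. dictionary A B $$ (r, i)) (\<lambda>r. dictionary A B $$ (r, j)) = (if i = j then 1 else 0)"
      unfolding ips(1)[OF ij] using on(1) ij by (simp add: orthonormal_basis_def)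
    show "ip {..<N} (\<lambda>r. dictionary A B $$ (r, N + i)) (\<lambda>r. dictionary A B $$ (r, N + j)) = (if i = j then 1 else 0)"
      unfolding ips(2)[OF ij] using on(2) ij by (simp add: orthonormal_basis_def)
    show "cmod (ip {..<N} (\<lambda>r. dictionary A B $$ (r, i)) (\<lambda>r. dictionary A B $$ (r, N + j))) \<le> mutual_incoherence A B"
      unfolding ips(3)[OF ij] by (rule cmod_ip_le_mutual_incoherence[OF A B ij])
  next
    fix r s assume rs: "r < N" "s < N"
    show "(\<Sum>j<N. dictionary A B $$ (r, N + j) * cnj (dictionary A B $$ (s, N + j))) = (if r = s then 1 else 0)"
      using orthonormal_basis_complete[OF on(2) rs] rs by (simp add: idx)
  qed
qed

section \<open>Probability of recovery\<close>

lemma prob_pair_pmf_fst: "measure_pmf.prob (pair_pmf A B) {x. fst x \<in> X} = measure_pmf.prob A X"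
proof -
  have "measure_pmf.prob (map_pmf fst (pair_pmf A B)) X = measure_pmf.prob (pair_pmf A B) (fst -` X)"
    by (rule measure_map_pmf)
  then show ?thesis by (simp add: map_fst_pair_pmf vimage_def)
qed

lemma prob_pair_pmf_snd: "measure_pmf.prob (pair_pmf A B) {x. snd x \<in> X} = measure_pmf.prob B X"
proof -
  have "measure_pmf.prob (map_pmf snd (pair_pmf A B)) X = measure_pmf.prob (pair_pmf A B) (snd -` X)"
    by (rule measure_map_pmf)
  then show ?thesis by (simp add: map_snd_pair_pmf vimage_def)
qed

lemma prob_pair_pmf_le:
  assumes "\<And>a. measure_pmf.prob B {b. R a b} \<le> q" and "0 \<le> q"
  shows "measure_pmf.prob (pair_pmf A B) {(a, b). R a b} \<le> q"
proof -
  have "emeasure (pair_pmf A B) {(a, b). R a b} = (\<integral>\<^sup>+ x. indicator {(a, b). R a b} x \<partial>pair_pmf A B)"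
    by simp
  also have "\<dots> = (\<integral>\<^sup>+ a. \<integral>\<^sup>+ b. indicator {(a, b). R a b} (a, b) \<partial>B \<partial>A)"
    by (rule nn_integral_pair_pmf')
  also have "\<dots> = (\<integral>\<^sup>+ a. \<integral>\<^sup>+ b. indicator {b. R a b} b \<partial>B \<partial>A)"
    by (intro nn_integral_cong) (simp add: indicator_def)
  also have "\<dots> \<le> (\<integral>\<^sup>+ a. ennreal q \<partial>A)"
    by (intro nn_integral_mono) (simp add: measure_pmf.emeasure_eq_measure ennreal_leI assms)
  also have "\<dots> = ennreal q" by simp
  finally show ?thesis using assms(2) by (simp add: measure_pmf.emeasure_eq_measure)
qed

lemma one_le_ln:
  assumes "3 \<le> N" shows "1 \<le> ln (real N)"
proof -
  have "exp 1 \<le> real N" using exp_le assms by linarith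
  then show ?thesis using assms by (simp add: ln_ge_iff)
qed

context orthonormal_pair begin

text \<open>
  The three failure events are that one of the two index sets is more than four times as large as
  expected, or that the first has admissible size and the cross Gram matrix is too large. The last one is
  estimated conditionally on the first index set. The smallness assumption, multiplied by 4, gives
  \<open>\<mu>\<^sup>2 c \<le> 1 / (36 L)\<close> for both cardinalities \<open>c\<close> of an admissible pair.
\<close>

lemma supports_good_prob:
  fixes \<beta> p1 p2 :: real
  defines "L \<equiv> (\<beta> + 1) * ln (real N)"
  assumes N: "512 \<le> N" and \<beta>: "1 \<le> \<beta>" and p1: "0 \<le> p1" "p1 \<le> 1" and p2: "0 \<le> p2" "p2 \<le> 1"
    and m: "4 * L \<le> real N * p1" "4 * L \<le> real N * p2"
    and small: "\<mu>\<^sup>2 * (real N * p1 + real N * p2) \<le> 1 / (144 * L)"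
  shows "1 - 3 * real N powr (- \<beta>) \<le>
    measure_pmf.prob (pair_pmf (bernoulli_subset N p1) (bernoulli_subset N p2))
      {(G1, G2). separated_support {..<N} {..<2 * N} (joint_support N G1 G2) \<phi> (1 / (36 * L))}"
    (is "_ \<le> measure_pmf.prob ?P ?Good")
proof -
  define \<eta> where "\<eta> = 1 / (36 * L)"
  define q where "q = real N powr (- \<beta>)"
  let ?m1 = "real N * p1" and ?m2 = "real N * p2"
  have lnN: "1 \<le> ln (real N)" using N by (intro one_le_ln) simp
  have L2: "2 \<le> L" using mult_mono[of 2 "\<beta> + 1" 1 "ln (real N)"] \<beta> lnN by (simp add: L_def)
  have q: "q = exp (- (\<beta> * ln (real N)))" using N by (simp add: q_def powr_def)
  have \<beta>L: "\<beta> * ln (real N) \<le> L" using lnN by (simp add: L_def distrib_right)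
  have \<eta>_small: "\<eta> < 1 / 2" using L2 by (simp add: \<eta>_def field_simps)
  have m1_small: "4 * (\<mu>\<^sup>2 * ?m1) \<le> \<eta>" and m2_small: "4 * (\<mu>\<^sup>2 * ?m2) \<le> \<eta>"
  proof -
    have "0 \<le> \<mu>\<^sup>2 * ?m1" "0 \<le> \<mu>\<^sup>2 * ?m2" using p1 p2 by simp_all
    then have "\<mu>\<^sup>2 * ?m1 \<le> 1 / (144 * L)" "\<mu>\<^sup>2 * ?m2 \<le> 1 / (144 * L)"
      using small by (simp_all add: distrib_left)
    moreover have "4 * (1 / (144 * L)) = \<eta>" using L2 by (simp add: \<eta>_def field_simps)
    ultimately show "4 * (\<mu>\<^sup>2 * ?m1) \<le> \<eta>" "4 * (\<mu>\<^sup>2 * ?m2) \<le> \<eta>" by linarith+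
  qed
  have card_small: "\<mu>\<^sup>2 * c \<le> \<eta>" if "c \<le> 4 * ?m1 \<or> c \<le> 4 * ?m2" for c
  proof -
    have "\<mu>\<^sup>2 * c \<le> \<mu>\<^sup>2 * (4 * ?m1) \<or> \<mu>\<^sup>2 * c \<le> \<mu>\<^sup>2 * (4 * ?m2)"
      using that mult_left_mono[of c _ "\<mu>\<^sup>2"] by auto
    moreover have "\<mu>\<^sup>2 * (4 * ?m1) = 4 * (\<mu>\<^sup>2 * ?m1)" "\<mu>\<^sup>2 * (4 * ?m2) = 4 * (\<mu>\<^sup>2 * ?m2)"
      by simp_all
    ultimately show ?thesis using m1_small m2_small by linarith
  qed
  have p2_small: "exp 1 * p2 \<le> 1 / 12"
  proof -
    have "p2 \<le> p2 * (real N * \<mu>\<^sup>2)"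
      using mult_left_mono[OF coherence_lower_bound p2(1)] N by simp
    also have "\<dots> = \<mu>\<^sup>2 * ?m2" by simp
    finally have "4 * p2 \<le> \<eta>" using m2_small by linarith
    moreover have "\<eta> \<le> 1 / 72" using L2 by (simp add: \<eta>_def field_simps)
    moreover have "exp 1 * p2 \<le> 3 * p2" using exp_le p2(1) by (intro mult_right_mono)
    ultimately show ?thesis by linarith
  qed
  \<comment> \<open>The exponent is large enough for \<open>N (1/3)\<^sup>n\<close> to be small, yet \<open>n \<rho> \<le> 3 L \<eta> = 1/12\<close> stays bounded.\<close>
  obtain n where n: "2 * L \<le> real (Suc n)" "real (Suc n) \<le> 3 * L"
  proof
    define n where "n = nat \<lceil>2 * L\<rceil> - 1"
    have "1 \<le> nat \<lceil>2 * L\<rceil>" using L2 by linarith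
    then have "real (Suc n) = of_int \<lceil>2 * L\<rceil>" using L2 by (simp add: n_def)
    then show "2 * L \<le> real (Suc n)" "real (Suc n) \<le> 3 * L" using L2 by linarith+
  qed
  have gram_prob: "measure_pmf.prob (bernoulli_subset N p2) {S. \<not> small_cross_gram T S} \<le> q"
    if T: "T \<subseteq> {..<N}" "real (card T) \<le> 4 * ?m1" for T
  proof -
    have "real (Suc n) * (\<mu>\<^sup>2 * real (card T)) \<le> (3 * L) * \<eta>"
      using n(2) card_small[of "real (card T)"] T(2) L2 by (intro mult_mono) auto
    also have "\<dots> = 1 / 12" using L2 by (simp add: \<eta>_def)
    finally have "measure_pmf.prob (bernoulli_subset N p2) {S. \<not> small_cross_gram T S}
        \<le> real N * (1 / 3) ^ Suc n"
      by (intro cross_gram_tail p2 T p2_small)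
    also have "\<dots> \<le> real N * exp (- (2 * L))"
    proof (rule mult_left_mono)
      have "(1 / 3 :: real) ^ Suc n \<le> exp (- 1) ^ Suc n"
        using exp_le by (intro power_mono) (simp_all add: exp_minus field_simps)
      also have "\<dots> = exp (real (Suc n) * - 1)" by (rule exp_of_nat_mult[symmetric])
      also have "\<dots> \<le> exp (- (2 * L))" unfolding exp_le_cancel_iff using n(1) by simp
      finally show "(1 / 3 :: real) ^ Suc n \<le> exp (- (2 * L))" .
    qed simp
    also have "\<dots> = exp (ln (real N) - 2 * L)" using N by (simp add: exp_diff exp_minus field_simps)
    also have "\<dots> \<le> q" unfolding q exp_le_cancel_iff using \<beta>L L2 lnN by (simp add: L_def algebra_simps)
    finally show ?thesis .
  qed
  have tail: "measure_pmf.prob (bernoulli_subset N p) {S. 4 * (real N * p) < real (card S)} \<le> q"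
    if "0 \<le> p" "p \<le> 1" "4 * L \<le> real N * p" for p
  proof -
    have "- (real N * p) \<le> - (\<beta> * ln (real N))" using that(3) \<beta>L L2 by linarith
    then have "exp (- (real N * p)) \<le> q" unfolding q by simp
    then show ?thesis using bernoulli_subset_card_tail[OF that(1,2), of N] by linarith
  qed
  define X where "X p = {S :: nat set. 4 * (real N * p) < real (card S)}" for p
  define R where "R G1 G2 \<longleftrightarrow> G1 \<subseteq> {..<N} \<and> real (card G1) \<le> 4 * ?m1 \<and> \<not> small_cross_gram G1 G2" for G1 G2
  have q0: "0 \<le> q" by (simp add: q_def)
  have "measure_pmf.prob ?P (- ?Good) \<le>
      measure_pmf.prob ?P ({x. fst x \<in> X p1} \<union> {x. snd x \<in> X p2} \<union> {(G1, G2). R G1 G2})"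
  proof (rule measure_pmf.finite_measure_mono_AE)
    show "AE x in measure_pmf ?P. x \<in> - ?Good \<longrightarrow>
        x \<in> {x. fst x \<in> X p1} \<union> {x. snd x \<in> X p2} \<union> {(G1, G2). R G1 G2}"
    proof (rule AE_pmfI, rule impI, rule ccontr)
      fix x assume x: "x \<in> set_pmf ?P" "x \<in> - ?Good"
        "x \<notin> {x. fst x \<in> X p1} \<union> {x. snd x \<in> X p2} \<union> {(G1, G2). R G1 G2}"
      obtain G1 G2 where G: "x = (G1, G2)" by (cases x)
      have sub: "G1 \<subseteq> {..<N}" "G2 \<subseteq> {..<N}"
        using x(1) set_bernoulli_subset[of N p1] set_bernoulli_subset[of N p2] unfolding G by auto
      have card: "real (card G1) \<le> 4 * ?m1" "real (card G2) \<le> 4 * ?m2" and gram: "small_cross_gram G1 G2"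
        using x(3) sub unfolding G X_def R_def by (auto simp: not_less)
      have "separated_support {..<N} {..<2 * N} (joint_support N G1 G2) \<phi> \<eta>"
        using card by (intro joint_support_separated sub gram card_small \<eta>_small) auto
      then show False using x(2) unfolding G \<eta>_def by simp
    qed
  qed simp
  also have "\<dots> \<le> measure_pmf.prob ?P {x. fst x \<in> X p1} + measure_pmf.prob ?P {x. snd x \<in> X p2}
      + measure_pmf.prob ?P {(G1, G2). R G1 G2}"
    by (intro order_trans[OF measure_Un_le] add_mono order_refl) auto
  also have "\<dots> \<le> q + q + q"
  proof (intro add_mono)
    show "measure_pmf.prob ?P {x. fst x \<in> X p1} \<le> q"
      unfolding prob_pair_pmf_fst X_def by (rule tail[OF p1 m(1)])
    show "measure_pmf.prob ?P {x. snd x \<in> X p2} \<le> q"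
      unfolding prob_pair_pmf_snd X_def by (rule tail[OF p2 m(2)])
    show "measure_pmf.prob ?P {(G1, G2). R G1 G2} \<le> q"
    proof (rule prob_pair_pmf_le[OF _ q0])
      fix G1
      show "measure_pmf.prob (bernoulli_subset N p2) {G2. R G1 G2} \<le> q"
      proof (cases "G1 \<subseteq> {..<N} \<and> real (card G1) \<le> 4 * ?m1")
        case True
        then have "{G2. R G1 G2} = {S. \<not> small_cross_gram G1 S}" by (simp add: R_def)
        then show ?thesis using gram_prob[of G1] True by simp
      next
        case False
        then have "{G2. R G1 G2} = {}" unfolding R_def by blast
        then show ?thesis using q0 by simp
      qed
    qed
  qed
  finally have "measure_pmf.prob ?P (- ?Good) \<le> 3 * q" by simp
  then show ?thesis
    using measure_pmf.prob_compl[of ?Good ?P] by (simp add: Compl_eq_Diff_UNIV q_def)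
qed

text \<open>
  With \<open>\<eta> = 1 / (36 L)\<close> the conditional failure probability is at most \<open>8 N exp (- 9 L / 4)\<close>, and the excess of
  \<open>9/4 (\<beta> + 1)\<close> over \<open>\<beta> + 1\<close> absorbs the factor \<open>N\<close>.
\<close>

lemma strictly_optimal_prob:
  fixes \<beta> p1 p2 :: real
  defines "L \<equiv> (\<beta> + 1) * ln (real N)"
  assumes N: "512 \<le> N" and \<beta>: "1 \<le> \<beta>" and p1: "0 \<le> p1" "p1 \<le> 1" and p2: "0 \<le> p2" "p2 \<le> 1"
    and m: "4 * L \<le> real N * p1" "4 * L \<le> real N * p2"
    and small: "\<mu>\<^sup>2 * (real N * p1 + real N * p2) \<le> 1 / (144 * L)"
    and D: "continuous_distribution D" "circularly_symmetric D"
  shows "1 - 11 * real N powr (- \<beta>) \<le>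
    measure (coeff_law N p1 p2 D) {a \<in> space (coeff_space N). strictly_optimal (2 * N) {..<N} \<phi> a}"
proof -
  let ?E = "{a \<in> space (coeff_space N). strictly_optimal (2 * N) {..<N} \<phi> a}"
  define q where "q = real N powr (- \<beta>)"
  have D': "prob_space D" "sets D = sets borel"
    by (rule continuous_distribution_prob_space[OF D(1)], rule continuous_distribution_sets[OF D(1)])
  have lnN: "1 \<le> ln (real N)" using N by (intro one_le_ln) simp
  have L2: "2 \<le> L" using mult_mono[of 2 "\<beta> + 1" 1 "ln (real N)"] \<beta> lnN by (simp add: L_def)
  have q: "q = exp (- (\<beta> * ln (real N)))" using N by (simp add: q_def powr_def)
  have phase: "8 * real N * exp (- 1 / (16 * (1 / (36 * L)))) \<le> 8 * q"
  proof -
    have "- 1 / (16 * (1 / (36 * L))) = - (9 / 4 * L)" using L2 by (simp add: field_simps)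
    then have "real N * exp (- 1 / (16 * (1 / (36 * L)))) = exp (ln (real N) - 9 / 4 * L)"
      using N by (simp only: exp_diff exp_minus divide_inverse) simp
    also have "\<dots> \<le> q"
      unfolding q exp_le_cancel_iff using \<beta> lnN mult_nonneg_nonneg[of "\<beta> - 1" "ln (real N)"]
      by (simp add: L_def algebra_simps)
    finally show ?thesis by simp
  qed
  have "1 - 8 * q - 3 * q \<le> measure (coeff_law N p1 p2 D) ?E"
  proof (rule coeff_law_lower_bound[OF D'])
    show "?E \<in> sets (coeff_space N)"
      by (intro strictly_optimal_measurable coeff_space_coordinate)
    show "1 - 3 * q \<le> measure_pmf.prob (pair_pmf (bernoulli_subset N p1) (bernoulli_subset N p2))
      {(G1, G2). separated_support {..<N} {..<2 * N} (joint_support N G1 G2) \<phi> (1 / (36 * L))}"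
      unfolding q_def L_def
      by (rule supports_good_prob[OF N \<beta> p1 p2 m[unfolded L_def] small[unfolded L_def]])
  next
    fix G1 G2
    assume "(G1, G2) \<in> {(G1, G2). separated_support {..<N} {..<2 * N} (joint_support N G1 G2) \<phi> (1 / (36 * L))}"
    then have "separated_support {..<N} {..<2 * N} (joint_support N G1 G2) \<phi> (1 / (36 * L))" by simp
    from coeff_law_on_strictly_optimal[OF this _ D] L2 phase
    show "1 - 8 * q \<le> measure (coeff_law_on N D (joint_support N G1 G2)) ?E" by simp
  qed (simp_all add: q_def)
  then show ?thesis by (simp add: q_def)
qed

end

theorem theorem5p3:
  shows "\<exists>C3::real. C3 > 0 \<and> (\<forall>\<beta>::real. \<beta> \<ge> 1 \<longrightarrow> (\<exists>C::real. C > 0 \<and>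
    (\<forall>(N::nat) (\<Phi>1::complex mat) (\<Phi>2::complex mat) (p1::real) (p2::real) (D::complex measure).
       N \<ge> 512 \<longrightarrow>
       orthonormal_basis N \<Phi>1 \<longrightarrow>
       orthonormal_basis N \<Phi>2 \<longrightarrow>
       mutual_incoherence \<Phi>1 \<Phi>2 \<le> 1 / sqrt (2 * (\<beta> + 1) * ln (real N)) \<longrightarrow>
       p1 \<in> {0..1} \<longrightarrow>
       p2 \<in> {0..1} \<longrightarrow>
       min (expected_card (bernoulli_subset N p1)) (expected_card (bernoulli_subset N p2))
         \<ge> 4 * (\<beta> + 1) * ln (real N) \<longrightarrow>
       expected_card (bernoulli_subset N p1) + expected_card (bernoulli_subset N p2)
         \<le> C3 / ((mutual_incoherence \<Phi>1 \<Phi>2)\<^sup>2 * ((\<beta> + 1) * ln (real N)) powr (5 / 2)) \<longrightarrow>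
       continuous_distribution D \<longrightarrow>
       circularly_symmetric D \<longrightarrow>
       measure (coeff_law N p1 p2 D)
         {a \<in> space (coeff_law N p1 p2 D).
            let \<Phi> = dictionary \<Phi>1 \<Phi>2; \<alpha> = vec (2 * N) a; f = \<Phi> *\<^sub>v \<alpha> in
              solutions l0_norm \<Phi> f = {\<alpha>} \<and> solutions l1_norm \<Phi> f = {\<alpha>}}
         \<ge> 1 - C * ln (real N) * real N powr (- \<beta>))))"
proof (rule exI[of _ "1 / 144 :: real"], rule conjI, simp, intro allI impI, rule exI[of _ "11 :: real"],
    rule conjI, simp, intro allI impI)
  fix \<beta> :: real and N :: nat and A B :: "complex mat" and p1 p2 :: real and D :: "complex measure"
  let ?L = "(\<beta> + 1) * ln (real N)" and ?\<mu> = "mutual_incoherence A B" and ?\<Phi> = "dictionary A B"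
  assume \<beta>: "1 \<le> \<beta>" and N: "512 \<le> N" and on: "orthonormal_basis N A" "orthonormal_basis N B"
    and p1: "p1 \<in> {0..1}" and p2: "p2 \<in> {0..1}"
    and m: "4 * (\<beta> + 1) * ln (real N)
      \<le> min (expected_card (bernoulli_subset N p1)) (expected_card (bernoulli_subset N p2))"
    and size: "expected_card (bernoulli_subset N p1) + expected_card (bernoulli_subset N p2)
         \<le> 1 / 144 / (?\<mu>\<^sup>2 * ?L powr (5 / 2))"
    and D: "continuous_distribution D" "circularly_symmetric D"
  interpret orthonormal_pair N "\<lambda>i r. ?\<Phi> $$ (r, i)" ?\<mu>
    by (rule dictionary_orthonormal_pair[OF on])
  have carrier: "?\<Phi> \<in> carrier_mat N (2 * N)"
    using on by (intro dictionary_carrier) (simp_all add: orthonormal_basis_def)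
  have D': "prob_space D" "sets D = sets borel"
    by (rule continuous_distribution_prob_space[OF D(1)], rule continuous_distribution_sets[OF D(1)])
  have p: "0 \<le> p1" "p1 \<le> 1" "0 \<le> p2" "p2 \<le> 1" using p1 p2 by simp_all
  have lnN: "1 \<le> ln (real N)" using N by (intro one_le_ln) simp
  have L2: "2 \<le> ?L" using mult_mono[of 2 "\<beta> + 1" 1 "ln (real N)"] \<beta> lnN by simp
  have m': "4 * ?L \<le> real N * p1" "4 * ?L \<le> real N * p2"
    using m[unfolded expected_card_bernoulli_subset[OF p(1,2)] expected_card_bernoulli_subset[OF p(3,4)]
        min.bounded_iff mult.assoc] by blast+
  have \<mu>: "0 < ?\<mu>\<^sup>2"
    using coherence_lower_bound N by (cases "?\<mu>\<^sup>2 = 0") auto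
  have small: "?\<mu>\<^sup>2 * (real N * p1 + real N * p2) \<le> 1 / (144 * ?L)"
  proof -
    \<comment> \<open>As \<open>L \<ge> 1\<close>, the assumed bound is at least as strong as the one with \<open>L\<close> in place of its power \<open>5/2\<close>.\<close>
    have "?L powr 1 \<le> ?L powr (5 / 2)" using L2 by (intro powr_mono) auto
    then have pow: "144 * ?L \<le> 144 * ?L powr (5 / 2)" using L2 by simp
    have pos: "0 < 144 * ?L" using L2 by linarith
    have "?\<mu>\<^sup>2 * (real N * p1 + real N * p2) \<le> ?\<mu>\<^sup>2 * (1 / 144 / (?\<mu>\<^sup>2 * ?L powr (5 / 2)))"
      using size p \<mu> by (intro mult_left_mono) (simp_all add: expected_card_bernoulli_subset)
    also have "\<dots> = 1 / (144 * ?L powr (5 / 2))" using \<mu> by simp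
    also have "\<dots> \<le> 1 / (144 * ?L)" by (rule frac_le[OF zero_le_one order_refl pos pow])
    finally show ?thesis .
  qed
  have event: "{a \<in> space (coeff_law N p1 p2 D).
      let \<Phi> = ?\<Phi>; \<alpha> = vec (2 * N) a; f = \<Phi> *\<^sub>v \<alpha> in
        solutions l0_norm \<Phi> f = {\<alpha>} \<and> solutions l1_norm \<Phi> f = {\<alpha>}}
      = {a \<in> space (coeff_space N). strictly_optimal (2 * N) {..<N} (\<lambda>i r. ?\<Phi> $$ (r, i)) a}"
    unfolding Let_def unique_solutions_iff_strictly_optimal[OF carrier] space_coeff_law[OF D'] ..
  have "11 * real N powr (- \<beta>) \<le> 11 * ln (real N) * real N powr (- \<beta>)"
    using lnN by (intro mult_right_mono) auto
  then show "1 - 11 * ln (real N) * real N powr (- \<beta>) \<le> measure (coeff_law N p1 p2 D)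
      {a \<in> space (coeff_law N p1 p2 D).
        let \<Phi> = ?\<Phi>; \<alpha> = vec (2 * N) a; f = \<Phi> *\<^sub>v \<alpha> in
          solutions l0_norm \<Phi> f = {\<alpha>} \<and> solutions l1_norm \<Phi> f = {\<alpha>}}"
    unfolding event using strictly_optimal_prob[OF N \<beta> p m' small D] by linarith
qed

end
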